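(* Let $\mathcal{G}$ be a dual equivalence graph of type $(n,n)$ with vertex set $V(\mathcal{G})$ and signature function $\sigma$, and let $\alpha:V(\mathcal{G})\to\mathbb{Z}$ be a statistic on the vertices. For a partition $\lambda$ of $n$ let $C(\lambda)$ denote the set of connected components of $\mathcal{G}$ that are isomorphic to $\mathcal{G}_\lambda$. If $\alpha$ is constant on connected components of $\mathcal{G}$ (write $\alpha(\mathcal{C})$ for its value on a component $\mathcal{C}$), then $$\sum_{v\in V(\mathcal{G})}q^{\alpha(v)}Q_{\sigma(v)}(X)=\sum_{\lambda}\sum_{\mathcal{C}\in C(\lambda)}q^{\alpha(\mathcal{C})}s_\lambda(X),$$ where $\lambda$ ranges over partitions of $n$. In particular, the generating function on the left is symmetric and Schur positive.
   Context: **Signed, colored graphs.** A signed, colored graph of type $(n,N)$, written $(V,\sigma,E_2\cup\cdots\cup E_{n-1})$, consists of a finite vertex set $V$, a signature function $\sigma:V\to\{\pm1\}^{N-1}$, and for each $1<i<n$ a collection $E_i$ of (unordered) pairs of distinct vertices, the edges of color $i$. **Dual equivalence graphs.** A signed, colored graph of type $(n,N)$ is a dual equivalence graph of type $(n,N)$ if $n\le N$ and the following hold (conditions on coordinates of $\sigma$ being imposed only for indices in $\{1,\dots,N-1\}$). (ax1) For $w\in V$ and $1<i<n$, $\sigma(w)_{i-1}=-\sigma(w)_i$ iff there exists $x\in V$ with $\{w,x\}\in E_i$; moreover $x$ is unique when it exists. (ax2) For $\{w,x\}\in E_i$, $\sigma(w)_j=-\sigma(x)_j$ for $j=i-1,i$,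 and $\sigma(w)_h=\sigma(x)_h$ for $h<i-2$ and $h>i+1$. (ax3) For $\{w,x\}\in E_i$: if $\sigma(w)_{i-2}=-\sigma(x)_{i-2}$ then $\sigma(w)_{i-2}=-\sigma(w)_{i-1}$; and if $\sigma(w)_{i+1}=-\sigma(x)_{i+1}$ then $\sigma(w)_{i+1}=-\sigma(w)_i$. (ax4) For $2<i<n$, every connected component of $(V,\sigma,E_{i-1}\cup E_i)$ is, as an edge-colored graph, one of: a single vertex; a path on three vertices with one edge of color $i-1$ and one of color $i$; two vertices joined by both an edge of color $i-1$ and an edge of color $i$. For $3<i<n$, every connected component of $(V,\sigma,E_{i-2}\cup E_{i-1}\cup E_i)$ is one of: a single vertex; a path $v_1v_2v_3v_4$ with successive colors $i-2,i-1,i$; a graph on $v_1,\dots,v_5$ with $\{v_1,v_2\}\in E_{i-2}\cap E_{i-1}$, $\{v_2,v_3\}\in E_i$, $\{v_3,v_4\}\in E_{i-2}$, $\{v_4,v_5\}\in E_{i-1}\cap E_i$ and no other edges; a graph on $u,v,w,x,y,z$ with $\{u,v\}\in E_{i-1}$, $\{v,w\}\in E_{i-2}$, $\{v,x\}\in E_i$, $\{w,y\}\in E_i$, $\{x,y\}\in E_{i-2}$, $\{y,z\}\in E_{i-1}$ and no other edges. (ax5) If $\{w,x\}\in E_i$ and $\{x,y\}\in E_j$ with $|i-j|\ge3$, then $\{w,v\}\in E_j$ and $\{v,y\}\in E_i$ for some $v\in V$. (ax6) For each $1<i<n$, any two vertices of a connected component of $(V,\sigma,E_2\cup\cdots\cup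 E_i)$ may be connected by a path crossing at most one $E_i$ edge. **Standard graphs.** The diagram of $\lambda$ is the set of cells $(i,j)$ with $1\le i\le\lambda_j$ ($i$ the column, $j$ the row, rows numbered bottom to top). $\mathrm{SYT}(\lambda)$: bijective fillings by $1,\dots,n$ increasing along rows left to right and up columns. The content of $(i,j)$ is $i-j$; the content reading word $w_T$ lists the entries of $T$ in increasing order of content, reading each diagonal southwest to northeast. $\sigma(T)\in\{\pm1\}^{n-1}$ has $\sigma(T)_i=+1$ if $i$ is left of $i+1$ in $w_T$, and $-1$ otherwise. An elementary dual equivalence for $i-1,i,i+1$ is defined on permutations in which $i$ does not lie between $i-1$ and $i+1$ in position: it switches the two of the letters $i-1,i,i+1$ in the outermost positions. $\mathcal{G}_\lambda$ is the signed, colored graph of type $(n,n)$ on $\mathrm{SYT}(\lambda)$ with signature $\sigma(T)$ and $\{T,U\}\in E_i$ iff $w_T,w_U$ differ by an elementary dual equivalence for $i-1,i,i+1$. **Isomorphism.** An isomorphism of signed, colored graphs of the same type is a signature-preserving bijection on vertices that maps edges of color $i$ to edges of color $i$ for every $i$. **Quasisymmetric functions.** For $\sigma\in\{\pm1\}^{n-1}$, $Q_\sigma(X)=\sum x_{i_1}\cdots x_{i_n}$ over $i_1\le\cdots\le i_n$ such that $i_j=i_{j+1}\Rightarrow\sigma_j=+1$. $s_\lambda$ is the Schur function. Schur positive means that the coefficients in the Schur basis are (Laurent) polynomials in $q$ with nonnegative integer coefficients. *)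

theory Defs
  imports "HOL-Library.Multiset" "HOL-Library.FuncSet" "HOL-Library.Poly_Mapping"
begin

section \<open>Signed, colored graphs\<close>

text \<open>The colors of a graph of type \<open>(n, N)\<close> are \<open>2, \<dots>, n - 1\<close>; the value of \<open>edges\<close> at any
  other number is never looked at. A signature is a function that is extensional on
  \<open>{1..<N}\<close>, so that equality of signatures is equality in \<open>{\<plusminus>1}\<close> to the power \<open>N - 1\<close>.\<close>

record 'v scgraph =
  verts :: "'v set"
  sig :: "'v \<Rightarrow> nat \<Rightarrow> int"
  edges :: "nat \<Rightarrow> 'v set set"

definition signed_colored_graph :: "nat \<Rightarrow> nat \<Rightarrow> 'v scgraph \<Rightarrow> bool" where
  "signed_colored_graph n N G \<longleftrightarrow>
     finite (verts G) \<and>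
     (\<forall>v\<in>verts G. sig G v \<in> {1..<N} \<rightarrow>\<^sub>E {1, -1}) \<and>
     (\<forall>i. 1 < i \<and> i < n \<longrightarrow>
        edges G i \<subseteq> {{u, v} |u v. u \<in> verts G \<and> v \<in> verts G \<and> u \<noteq> v})"

text \<open>\<open>walk G u cs v\<close>: there is a walk from \<open>u\<close> to \<open>v\<close> whose successive edges can be taken in
  the colors \<open>cs\<close>. Recording the colors matters since a pair of vertices may be joined by edges
  of several colors.\<close>

inductive walk :: "'v scgraph \<Rightarrow> 'v \<Rightarrow> nat list \<Rightarrow> 'v \<Rightarrow> bool" for G where
  walk_Nil: "v \<in> verts G \<Longrightarrow> walk G v [] v"
| walk_Cons: "{u, v} \<in> edges G c \<Longrightarrow> walk G v cs w \<Longrightarrow> walk G u (c # cs) w"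

text \<open>Vertex sets of the connected components of the graph that keeps only the edges with
  colors in \<open>I\<close>.\<close>

definition components :: "'v scgraph \<Rightarrow> nat set \<Rightarrow> 'v set set" where
  "components G I = (\<lambda>v. {w. \<exists>cs. set cs \<subseteq> I \<and> walk G v cs w}) ` verts G"

definition induced :: "'v scgraph \<Rightarrow> 'v set \<Rightarrow> 'v scgraph" where
  "induced G C = G\<lparr>verts := C, edges := (\<lambda>i. {e \<in> edges G i. e \<subseteq> C})\<rparr>"

text \<open>The edge condition is one-directional, as in the usual definition; between graphs
  satisfying \<open>ax1\<close> below the converse follows from preservation of signatures.\<close>

definition scgraph_iso ::
    "nat \<Rightarrow> 'v scgraph \<Rightarrow> 'w scgraph \<Rightarrow> ('v \<Rightarrow> 'w) \<Rightarrow> bool" where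
  "scgraph_iso n G H f \<longleftrightarrow>
     bij_betw f (verts G) (verts H) \<and>
     (\<forall>v\<in>verts G. sig H (f v) = sig G v) \<and>
     (\<forall>i. 1 < i \<and> i < n \<longrightarrow> (\<forall>e\<in>edges G i. f ` e \<in> edges H i))"

definition scgraph_isomorphic :: "nat \<Rightarrow> 'v scgraph \<Rightarrow> 'w scgraph \<Rightarrow> bool" where
  "scgraph_isomorphic n G H \<longleftrightarrow> (\<exists>f. scgraph_iso n G H f)"

section \<open>Dual equivalence graphs\<close>

text \<open>The edge-colored graph induced on \<open>C\<close> by the colors in \<open>I\<close> is the one with vertices
  \<open>0, \<dots>, k - 1\<close> and an edge of color \<open>c\<close> between \<open>a\<close> and \<open>b\<close> for each \<open>(c, a, b)\<close> in \<open>es\<close>, and no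
  other edges.\<close>

definition has_shape ::
    "'v scgraph \<Rightarrow> nat set \<Rightarrow> 'v set \<Rightarrow> nat \<Rightarrow> (nat \<times> nat \<times> nat) set \<Rightarrow> bool" where
  "has_shape G I C k es \<longleftrightarrow>
     (\<exists>vs. distinct vs \<and> length vs = k \<and> set vs = C \<and>
        (\<forall>c\<in>I. {e \<in> edges G c. e \<subseteq> C} = {{vs ! a, vs ! b} |a b. (c, a, b) \<in> es}))"

definition ax1 :: "nat \<Rightarrow> 'v scgraph \<Rightarrow> bool" where
  "ax1 n G \<longleftrightarrow>
     (\<forall>w\<in>verts G. \<forall>i. 1 < i \<and> i < n \<longrightarrow>
        (sig G w (i - 1) = - sig G w i \<longleftrightarrow> (\<exists>x\<in>verts G. {w, x} \<in> edges G i)) \<and>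
        (\<forall>x y. {w, x} \<in> edges G i \<and> {w, y} \<in> edges G i \<longrightarrow> x = y))"

definition ax2 :: "nat \<Rightarrow> nat \<Rightarrow> 'v scgraph \<Rightarrow> bool" where
  "ax2 n N G \<longleftrightarrow>
     (\<forall>i w x. 1 < i \<and> i < n \<and> {w, x} \<in> edges G i \<longrightarrow>
        sig G w (i - 1) = - sig G x (i - 1) \<and>
        sig G w i = - sig G x i \<and>
        (\<forall>h\<in>{1..<N}. h + 2 < i \<or> i + 1 < h \<longrightarrow> sig G w h = sig G x h))"

definition ax3 :: "nat \<Rightarrow> nat \<Rightarrow> 'v scgraph \<Rightarrow> bool" where
  "ax3 n N G \<longleftrightarrow>
     (\<forall>i w x. 1 < i \<and> i < n \<and> {w, x} \<in> edges G i \<longrightarrow>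
        (2 < i \<and> sig G w (i - 2) = - sig G x (i - 2) \<longrightarrow>
           sig G w (i - 2) = - sig G w (i - 1)) \<and>
        (i + 1 < N \<and> sig G w (i + 1) = - sig G x (i + 1) \<longrightarrow>
           sig G w (i + 1) = - sig G w i))"

definition ax4 :: "nat \<Rightarrow> 'v scgraph \<Rightarrow> bool" where
  "ax4 n G \<longleftrightarrow>
     (\<forall>i. 2 < i \<and> i < n \<longrightarrow>
        (\<forall>C\<in>components G {i - 1, i}.
           has_shape G {i - 1, i} C 1 {} \<or>
           has_shape G {i - 1, i} C 3 {(i - 1, 0, 1), (i, 1, 2)} \<or>
           has_shape G {i - 1, i} C 2 {(i - 1, 0, 1), (i, 0, 1)})) \<and>
     (\<forall>i. 3 < i \<and> i < n \<longrightarrow>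
        (\<forall>C\<in>components G {i - 2, i - 1, i}.
           has_shape G {i - 2, i - 1, i} C 1 {} \<or>
           has_shape G {i - 2, i - 1, i} C 4 {(i - 2, 0, 1), (i - 1, 1, 2), (i, 2, 3)} \<or>
           has_shape G {i - 2, i - 1, i} C 5
             {(i - 2, 0, 1), (i - 1, 0, 1), (i, 1, 2), (i - 2, 2, 3), (i - 1, 3, 4), (i, 3, 4)} \<or>
           has_shape G {i - 2, i - 1, i} C 6
             {(i - 1, 0, 1), (i - 2, 1, 2), (i, 1, 3), (i, 2, 4), (i - 2, 3, 4), (i - 1, 4, 5)}))"

definition ax5 :: "nat \<Rightarrow> 'v scgraph \<Rightarrow> bool" where
  "ax5 n G \<longleftrightarrow>
     (\<forall>i j w x y. 1 < i \<and> i < n \<and> 1 < j \<and> j < n \<and> \<bar>int i - int j\<bar> \<ge> 3 \<and>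
        {w, x} \<in> edges G i \<and> {x, y} \<in> edges G j \<longrightarrow>
        (\<exists>v\<in>verts G. {w, v} \<in> edges G j \<and> {v, y} \<in> edges G i))"

definition ax6 :: "nat \<Rightarrow> 'v scgraph \<Rightarrow> bool" where
  "ax6 n G \<longleftrightarrow>
     (\<forall>i. 1 < i \<and> i < n \<longrightarrow>
        (\<forall>C\<in>components G {2..i}. \<forall>v\<in>C. \<forall>w\<in>C.
           \<exists>cs. set cs \<subseteq> {2..i} \<and> walk G v cs w \<and> count_list cs i \<le> 1))"

definition dual_equivalence_graph :: "nat \<Rightarrow> nat \<Rightarrow> 'v scgraph \<Rightarrow> bool" where
  "dual_equivalence_graph n N G \<longleftrightarrow>
     signed_colored_graph n N G \<and> n \<le> N \<and>
     ax1 n G \<and> ax2 n N G \<and> ax3 n N G \<and> ax4 n G \<and> ax5 n G \<and> ax6 n G"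

section \<open>Partitions, tableaux and the standard graphs\<close>

definition partitions :: "nat \<Rightarrow> nat list set" where
  "partitions n = {lam. sorted_wrt (\<ge>) lam \<and> (\<forall>p\<in>set lam. 0 < p) \<and> sum_list lam = n}"

text \<open>A cell is a pair (column, row), both counted from 1; rows are numbered bottom to top.\<close>

definition diagram :: "nat list \<Rightarrow> (nat \<times> nat) set" where
  "diagram lam = {(i, j). 1 \<le> j \<and> j \<le> length lam \<and> 1 \<le> i \<and> i \<le> lam ! (j - 1)}"

type_synonym tableau = "nat \<times> nat \<Rightarrow> nat"

definition SYT :: "nat list \<Rightarrow> tableau set" where
  "SYT lam =
     {T \<in> extensional (diagram lam).
        bij_betw T (diagram lam) {1..sum_list lam} \<and>
        (\<forall>i j. (i, j) \<in> diagram lam \<and> (i + 1, j) \<in> diagram lam \<longrightarrow> T (i, j) < T (i + 1, j)) \<and>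
        (\<forall>i j. (i, j) \<in> diagram lam \<and> (i, j + 1) \<in> diagram lam \<longrightarrow> T (i, j) < T (i, j + 1))}"

text \<open>Contents \<open>c = i - j\<close> in increasing order; on a fixed diagonal, increasing \<open>i\<close> means from
  southwest to northeast, and \<open>j\<close> is determined by \<open>i\<close>.\<close>

definition content_word :: "nat list \<Rightarrow> tableau \<Rightarrow> nat list" where
  "content_word lam T =
     (let n = sum_list lam in
      [T (i, j). c \<leftarrow> [- int n..int n], i \<leftarrow> [1..<n + 1], j \<leftarrow> [1..<n + 1],
                 (i, j) \<in> diagram lam \<and> int i - int j = c])"

definition left_of :: "'a list \<Rightarrow> 'a \<Rightarrow> 'a \<Rightarrow> bool" where
  "left_of w a b \<longleftrightarrow> (\<exists>k l. k < l \<and> l < length w \<and> w ! k = a \<and> w ! l = b)"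

definition tableau_sig :: "nat list \<Rightarrow> tableau \<Rightarrow> nat \<Rightarrow> int" where
  "tableau_sig lam T =
     restrict (\<lambda>i. if left_of (content_word lam T) i (i + 1) then 1 else -1) {1..<sum_list lam}"

text \<open>\<open>elem_dual_equiv i w w'\<close>: the elementary dual equivalence for \<open>i - 1, i, i + 1\<close> is defined on
  the permutation \<open>w\<close> and takes it to \<open>w'\<close>.\<close>

definition elem_dual_equiv :: "nat \<Rightarrow> nat list \<Rightarrow> nat list \<Rightarrow> bool" where
  "elem_dual_equiv i w w' \<longleftrightarrow>
     \<not> (left_of w (i - 1) i \<and> left_of w i (i + 1)) \<and>
     \<not> (left_of w (i + 1) i \<and> left_of w i (i - 1)) \<and>
     (let P = {k. k < length w \<and> w ! k \<in> {i - 1, i, i + 1}}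
      in w' = w[Min P := w ! Max P, Max P := w ! Min P])"

definition standard_graph :: "nat list \<Rightarrow> tableau scgraph" where
  "standard_graph lam =
     \<lparr>verts = SYT lam,
      sig = tableau_sig lam,
      edges = (\<lambda>i. {{T, U} |T U. 1 < i \<and> i < sum_list lam \<and> T \<in> SYT lam \<and> U \<in> SYT lam \<and>
                     elem_dual_equiv i (content_word lam T) (content_word lam U)})\<rparr>"

definition components_of_shape :: "nat \<Rightarrow> 'v scgraph \<Rightarrow> nat list \<Rightarrow> 'v set set" where
  "components_of_shape n G lam =
     {C \<in> components G {2..<n}. scgraph_isomorphic n (induced G C) (standard_graph lam)}"

section \<open>Quasisymmetric and Schur functions\<close>

text \<open>Laurent polynomials in \<open>q\<close> with integer coefficients are the group ring of the integers,
  that is, finitely supported maps from exponents to coefficients with convolution.\<close>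

type_synonym laurent = "int \<Rightarrow>\<^sub>0 int"

definition qpow :: "int \<Rightarrow> laurent" where
  "qpow k = Poly_Mapping.single k 1"

text \<open>A formal power series is the function of its coefficients. The variables are indexed by
  \<open>nat\<close>, and a monomial is the multiset of the indices of its variables.\<close>

type_synonym 'a series = "nat multiset \<Rightarrow> 'a"

definition Qsym :: "nat \<Rightarrow> (nat \<Rightarrow> int) \<Rightarrow> 'a::semiring_1 series" where
  "Qsym n s m =
     of_nat (card {xs. length xs = n \<and> sorted xs \<and>
                       (\<forall>j. 1 \<le> j \<and> j < n \<and> xs ! (j - 1) = xs ! j \<longrightarrow> s j = 1) \<and>
                       mset xs = m})"

definition SSYT :: "nat list \<Rightarrow> tableau set" where
  "SSYT lam =
     {T \<in> extensional (diagram lam).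
        (\<forall>i j. (i, j) \<in> diagram lam \<and> (i + 1, j) \<in> diagram lam \<longrightarrow> T (i, j) \<le> T (i + 1, j)) \<and>
        (\<forall>i j. (i, j) \<in> diagram lam \<and> (i, j + 1) \<in> diagram lam \<longrightarrow> T (i, j) < T (i, j + 1))}"

definition schur :: "nat list \<Rightarrow> 'a::semiring_1 series" where
  "schur lam m = of_nat (card {T \<in> SSYT lam. image_mset T (mset_set (diagram lam)) = m})"

definition symmetric_function :: "'a::zero series \<Rightarrow> bool" where
  "symmetric_function F \<longleftrightarrow>
     (\<exists>d. \<forall>m. F m \<noteq> 0 \<longrightarrow> size m \<le> d) \<and>
     (\<forall>p m. bij p \<longrightarrow> F (image_mset p m) = F m)"

text \<open>Schur functions are linearly independent, so the coefficients \<open>c\<close> are the coefficients in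
  the Schur basis.\<close>

definition schur_positive :: "laurent series \<Rightarrow> bool" where
  "schur_positive F \<longleftrightarrow>
     (\<exists>S c. finite S \<and> S \<subseteq> (\<Union>n. partitions n) \<and>
        (\<forall>lam\<in>S. \<forall>k. 0 \<le> Poly_Mapping.lookup (c lam) k) \<and>
        F = (\<lambda>m. \<Sum>lam\<in>S. c lam * schur lam m))"

definition gen_fun :: "nat \<Rightarrow> 'v scgraph \<Rightarrow> ('v \<Rightarrow> int) \<Rightarrow> laurent series" where
  "gen_fun n G \<alpha> = (\<lambda>m. \<Sum>v\<in>verts G. qpow (\<alpha> v) * Qsym n (sig G v) m)"

end

theory Submission
  imports Defs "HOL-Combinatorics.Permutations"
begin

text \<open>A standard tableau is recorded by the contents of its entries \<open>n, \<dots>, 1\<close>, and a shape by the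
  set of integers that its boundary path occupies: adding a box of content \<open>a\<close> moves a particle from
  \<open>a - 1\<close> to \<open>a\<close>. Between two addable boxes there is a removable one, which makes chains of contents
  rigid: signatures and dual equivalences determine them.

  By induction on \<open>k\<close> the components of a dual equivalence graph under the colors below \<open>k\<close> are
  labelled bijectively by the chains of length \<open>k\<close> of one shape. The signature in place \<open>k\<close> cuts the
  removable boxes into a left and a right part, and the box of \<open>k + 1\<close> is the addable one at the
  cut. An edge of color \<open>k\<close> preserves the part of the label below its top three boxes by \<open>ax5\<close> and
  rigidity; \<open>ax3\<close> and \<open>ax4\<close> then force it to be the dual equivalence on those three, and \<open>ax6\<close>
  makes the labelling injective. So every component is standard, and its contribution is a Schur
  function by standardization. Symmetry comes from the Bender--Knuth involutions.\<close>

section \<open>Chains of boxes\<close>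

text \<open>The axioms speak of a vertex only through the signs and edges at it, so a difference
  between two contents becomes visible only where another entry lies between them. Hence the
  recurring device: two contents under comparison are addable to one shape, so if they differ, a
  removable box \<open>c\<close> lies strictly between them; a component already carries every chain
  of its shape, so the lower entries can be rearranged until \<open>c\<close> comes next, and there
  a sign or an edge of the next lower color tells the two contents apart. One comparison needs a
  second such box \<open>d\<close> below \<open>c\<close>. An edge of color \<open>k\<close> can be
  carried along in these rearrangements as long as they use colors up to \<open>k - 3\<close>, which
  commute with color \<open>k\<close>; this is why exactly the top three of the \<open>k + 1\<close>
  boxes are left to be studied. That the cut of the removable boxes is a cut, with all signs
  \<open>1\<close> on its left, is the contribution of \<open>ax3\<close>.\<close>

definition addable :: "int \<Rightarrow> int set \<Rightarrow> bool" where
  "addable a S \<longleftrightarrow> a - 1 \<in> S \<and> a \<notin> S"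

definition removable :: "int \<Rightarrow> int set \<Rightarrow> bool" where
  "removable a S \<longleftrightarrow> a \<in> S \<and> a - 1 \<notin> S"

definition add_box :: "int \<Rightarrow> int set \<Rightarrow> int set" where
  "add_box a S = insert a (S - {a - 1})"

definition between :: "int \<Rightarrow> int \<Rightarrow> int \<Rightarrow> bool" where
  "between x a b \<longleftrightarrow> a < x \<and> x < b \<or> b < x \<and> x < a"

text \<open>Going right from \<open>a\<close>, which is not in \<open>S\<close>, the first integer
  that lies in \<open>S\<close> is removable, and it is met at \<open>b - 1\<close> at the
  latest.\<close>

lemma removable_between_less:
  assumes "addable a S" "addable b S" "a < b"
  shows "\<exists>c. removable c S \<and> a < c \<and> c < b"
proof -
  let ?P = "\<lambda>d. a + 1 + int d \<in> S"
  have "?P (nat (b - a - 2))"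
    using assms by (cases "b = a + 1") (auto simp: addable_def)
  then have P: "?P (LEAST d. ?P d)" by (rule LeastI)
  have le: "(LEAST d. ?P d) \<le> nat (b - a - 2)"
    using \<open>?P (nat (b - a - 2))\<close> by (rule Least_le)
  have "a + 1 + int (LEAST d. ?P d) - 1 \<notin> S"
  proof (cases "LEAST d. ?P d")
    case 0
    with assms show ?thesis by (simp add: addable_def)
  next
    case (Suc e)
    then have "\<not> ?P e" using not_less_Least[of e ?P] by simp
    with Suc show ?thesis by (simp add: algebra_simps)
  qed
  moreover have "b \<noteq> a + 1" using assms by (auto simp: addable_def)
  ultimately show ?thesis using P le assms(3)
    by (intro exI[of _ "a + 1 + int (LEAST d. ?P d)"]) (auto simp: removable_def)
qed

lemma removable_between:
  assumes "addable a S" "addable b S" "a \<noteq> b"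
  obtains c where "removable c S" "between c a b"
proof (cases "a < b")
  case True
  then show thesis using removable_between_less[OF assms(1,2)] that by (auto simp: between_def)
next
  case False
  then have "b < a" using assms(3) by simp
  then show thesis using removable_between_less[OF assms(2,1)] that by (auto simp: between_def)
qed

section \<open>Chains of contents and the shapes that they build\<close>

fun shape :: "int list \<Rightarrow> int set" where
  "shape [] = {..<0}"
| "shape (a # l) = add_box a (shape l)"

fun valid :: "int list \<Rightarrow> bool" where
  "valid [] \<longleftrightarrow> True"
| "valid (a # l) \<longleftrightarrow> addable a (shape l) \<and> valid l"

lemma removable_add_box [simp]: "removable a (add_box a S)"
  by (auto simp: removable_def add_box_def)

lemma add_box_inject:
  "addable a S \<Longrightarrow> addable a S' \<Longrightarrow> add_box a S = add_box a S' \<longleftrightarrow> S = S'"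
  by (auto simp: addable_def add_box_def)

lemma add_box_commute: "a \<noteq> b + 1 \<Longrightarrow> b \<noteq> a + 1 \<Longrightarrow> add_box a (add_box b S) = add_box b (add_box a S)"
  by (auto simp: add_box_def)

text \<open>Any removable box can be the last one added. If the head \<open>a\<close> differs from
  \<open>c\<close>, the two are not neighbours, so \<open>c\<close> is removable already below
  \<open>a\<close>; by induction it can be put on top there, and then \<open>a\<close> and
  \<open>c\<close> trade places.\<close>

lemma valid_remove:
  "valid l \<Longrightarrow> removable c (shape l) \<Longrightarrow>
    \<exists>l'. valid (c # l') \<and> shape (c # l') = shape l \<and> Suc (length l') = length l"
proof (induction l arbitrary: c)
  case Nil
  then show ?case by (auto simp: removable_def)
next
  case (Cons a l)
  show ?case
  proof (cases "a = c")
    case False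
    then have "removable c (shape l)" and ne: "a \<noteq> c + 1" "c \<noteq> a + 1"
      using Cons.prems by (auto simp: removable_def add_box_def addable_def)
    then obtain m where m: "valid (c # m)" "shape (c # m) = shape l" "Suc (length m) = length l"
      using Cons.IH Cons.prems by fastforce
    have a: "addable a (shape (c # m))" using m Cons.prems by simp
    then have "addable a (shape m)" "addable c (shape (a # m))"
      using ne False m by (auto simp: addable_def add_box_def)
    moreover have "shape (c # a # m) = shape (a # l)"
      using m(2) add_box_commute[OF ne, of "shape m"] by simp
    ultimately show ?thesis using m
      by (intro exI[of _ "a # m"]) simp
  qed (use Cons in auto)
qed

lemma shape_bounds: "\<exists>lo hi. {..<lo} \<subseteq> shape l \<and> shape l \<subseteq> {..<hi}"
proof (induction l)
  case (Cons a l)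
  then obtain lo hi where "{..<lo} \<subseteq> shape l" "shape l \<subseteq> {..<hi}" by auto
  then show ?case
    by (intro exI[of _ "min lo (a - 1)"] exI[of _ "max hi (a + 1)"]) (auto simp: add_box_def)
qed auto

text \<open>The addable boxes and the removable boxes alternate, so an addable box realizes any way of
  cutting the removable ones into a left and a right part.\<close>

lemma addable_cut:
  assumes mono: "\<And>c c'. removable c (shape l) \<Longrightarrow> removable c' (shape l) \<Longrightarrow> c < c' \<Longrightarrow> P c' \<Longrightarrow> P c"
  obtains a where "addable a (shape l)" "\<And>c. removable c (shape l) \<Longrightarrow> P c \<longleftrightarrow> c < a"
proof -
  obtain lo hi where lo: "{..<lo} \<subseteq> shape l" and hi: "shape l \<subseteq> {..<hi}"
    using shape_bounds by blast
  \<comment> \<open>\<open>lo - 1\<close> is a sentinel that lies in the shape: if no removable box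
    satisfies \<open>P\<close>, the search for a gap starts at the far left.\<close>
  define A where "A = insert (lo - 1) {c. removable c (shape l) \<and> P c}"
  have ge: "lo \<le> c - 1" "c < hi" if "removable c (shape l)" for c
  proof -
    have "\<not> c - 1 < lo" using that lo by (auto simp: removable_def)
    then show "lo \<le> c - 1" by simp
    show "c < hi" using that hi by (auto simp: removable_def)
  qed
  have lohi: "lo \<le> hi"
  proof (rule ccontr)
    assume "\<not> lo \<le> hi"
    then have "hi \<in> {..<lo}" by simp
    with lo hi show False by blast
  qed
  have "A \<subseteq> {lo - 1..hi}"
  proof
    fix c assume "c \<in> A"
    then show "c \<in> {lo - 1..hi}" using ge[of c] lohi by (auto simp: A_def)
  qed
  then have fin: "finite A" by (rule finite_subset) simp
  define c0 where "c0 = Max A"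
  have c0: "c0 \<in> A" "\<And>c. c \<in> A \<Longrightarrow> c \<le> c0"
    using fin Max_in[OF fin] by (auto simp: c0_def A_def)
  then have c0S: "c0 \<in> shape l" using lo by (auto simp: A_def removable_def)
  define B where "B = {x. c0 < x \<and> x \<le> hi \<and> x \<notin> shape l}"
  have finB: "finite B" by (rule finite_subset[of _ "{c0..hi}"]) (auto simp: B_def)
  have "hi \<in> B" using hi c0S by (auto simp: B_def)
  define a where "a = Min B"
  have aB: "a \<in> B" "\<And>x. x \<in> B \<Longrightarrow> a \<le> x"
    unfolding a_def using Min_in[OF finB] Min_le[OF finB] \<open>hi \<in> B\<close> by blast+
  have "a - 1 \<in> shape l"
  proof (rule ccontr)
    assume "a - 1 \<notin> shape l"
    then have "a - 1 \<noteq> c0" using c0S by auto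
    then have "a - 1 \<in> B" using aB(1) \<open>a - 1 \<notin> shape l\<close> by (auto simp: B_def)
    then show False using aB(2) by force
  qed
  then have "addable a (shape l)" using aB(1) by (auto simp: addable_def B_def)
  moreover have "P c \<longleftrightarrow> c < a" if c: "removable c (shape l)" for c
  proof
    assume "P c"
    then have "c \<le> c0" using c c0(2) by (auto simp: A_def)
    then show "c < a" using aB(1) by (auto simp: B_def)
  next
    assume "c < a"
    have "c \<le> c0"
    proof (rule ccontr)
      assume "\<not> c \<le> c0"
      \<comment> \<open>As \<open>c\<close> is removable, \<open>c - 1\<close> is a gap beyond
        \<open>c0\<close>, so the first gap \<open>a\<close> cannot come after
        \<open>c\<close>.\<close>
      then have "c - 1 \<in> B" using c c0S ge[OF c] by (cases "c - 1 = c0") (auto simp: B_def removable_def)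
      with aB(2) \<open>c < a\<close> show False by force
    qed
    with c0(1) ge(1)[OF c] have "removable c0 (shape l)" "P c0" by (auto simp: A_def)
    with \<open>c \<le> c0\<close> show "P c" using mono[OF c, of c0] by (cases "c = c0") auto
  qed
  ultimately show ?thesis using that by blast
qed

text \<open>The list runs downwards, so the content of entry \<open>i\<close> has index
  \<open>length l - i\<close>. In a valid chain consecutive contents differ, hence comparing them
  gives the order of \<open>i\<close> and \<open>i + 1\<close> in the content reading word.\<close>

definition chain_sig :: "nat \<Rightarrow> int list \<Rightarrow> int" where
  "chain_sig i l = (if l ! (length l - i) < l ! (length l - Suc i) then 1 else - 1)"

lemma chain_sig_Cons [simp]: "i < length l \<Longrightarrow> chain_sig i (a # l) = chain_sig i l"
  by (auto simp: chain_sig_def Suc_diff_le nth_Cons' Suc_diff_Suc)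

lemma chain_sig_top [simp]: "i = Suc (length l) \<Longrightarrow> chain_sig i (a # b # l) = (if b < a then 1 else - 1)"
  by (simp add: chain_sig_def)

text \<open>The elementary dual equivalence for \<open>i - 1, i, i + 1\<close>, where
  \<open>a\<close>, \<open>b\<close>, \<open>c\<close> are the contents of \<open>i + 1\<close>,
  \<open>i\<close>, \<open>i - 1\<close>. If \<open>a\<close> is in the middle, \<open>i\<close> and
  \<open>i - 1\<close> trade places; the other branch takes \<open>c\<close> to be in the middle,
  which is right for \<open>alternating\<close> chains.\<close>

fun dual :: "nat \<Rightarrow> int list \<Rightarrow> int list" where
  "dual i (a # b # c # l) =
     (if i = length l + 2 then (if between a b c then a # c # b # l else b # a # c # l)
      else a # dual i (b # c # l))"
| "dual i l = l"

lemma length_dual [simp]: "length (dual i l) = length l"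
  by (induction i l rule: dual.induct) auto

lemma dual_Cons [simp]: "i < length l \<Longrightarrow> dual i (a # l) = a # dual i l"
  by (cases l rule: remdups_adj.cases) (auto split: if_splits)

text \<open>Says that \<open>i\<close> does not lie between \<open>i - 1\<close> and
  \<open>i + 1\<close>, the domain of the dual equivalence; under a labelling it is the condition of
  \<open>ax1\<close> for an edge of color \<open>i\<close>.\<close>

definition alternating :: "nat \<Rightarrow> int list \<Rightarrow> bool" where
  "alternating i l \<longleftrightarrow> chain_sig (i - 1) l \<noteq> chain_sig i l"

lemma alternating_Cons [simp]: "i < length l \<Longrightarrow> alternating i (a # l) \<longleftrightarrow> alternating i l"
  by (simp add: alternating_def)

lemma alternating_top:
  "i = length l + 2 \<Longrightarrow> alternating i (a # b # c # l) \<longleftrightarrow> (c < b \<longleftrightarrow> \<not> b < a)"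
  by (simp add: alternating_def)

section \<open>Dual equivalences on the chains of one shape: connectivity and rigidity\<close>

lemma valid_top_distinct:
  assumes "valid (a # b # c # l)"
  shows "a \<noteq> b" "b \<noteq> c" "a \<noteq> c"
  using assms by (auto simp: addable_def add_box_def)

lemma addable_far:
  "addable b (add_box a S) \<Longrightarrow> addable a S \<Longrightarrow> b \<noteq> a + 1 \<Longrightarrow> b \<noteq> a - 1 \<Longrightarrow>
    addable b S \<and> addable a (add_box b S)"
  by (auto simp: addable_def add_box_def)

lemma between_far: "between x a b \<Longrightarrow> b \<noteq> a + 1 \<and> b \<noteq> a - 1"
  by (auto simp: between_def)

lemma valid_swap:
  assumes "valid (a # b # l)" "a \<noteq> b + 1" "a \<noteq> b - 1"
  shows "valid (b # a # l)" "shape (b # a # l) = shape (a # b # l)"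
proof -
  have "addable a (shape l) \<and> addable b (add_box a (shape l))"
    using assms addable_far[of a b "shape l"] by auto
  then show "valid (b # a # l)" using assms by simp
  show "shape (b # a # l) = shape (a # b # l)"
    using assms(2,3) add_box_commute[of b a "shape l"] by simp
qed

text \<open>The two boxes that trade places have a third content strictly between them, so they are
  not neighbours and can be added in either order.\<close>

lemma dual_valid_shape:
  assumes "valid l" "2 \<le> i" "i < length l" "alternating i l"
  shows "valid (dual i l) \<and> shape (dual i l) = shape l"
  using assms
proof (induction i l rule: dual.induct)
  case (1 i a b c l)
  note dist = valid_top_distinct[OF 1(2)]
  show ?case
  proof (cases "i = length l + 2")
    case True
    then have alt: "c < b \<longleftrightarrow> \<not> b < a" using 1 by (simp add: alternating_top)
    show ?thesis
    proof (cases "between a b c")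
      case bt: True
      with 1(2) valid_swap[of b c l] between_far[OF bt] True show ?thesis
        by (auto simp: algebra_simps)
    next
      case False
      then have "between c a b" using alt dist by (auto simp: between_def)
      with 1(2) valid_swap[of a b "c # l"] between_far[OF this] True False show ?thesis
        by (auto simp: algebra_simps)
    qed
  next
    case False
    then have "i < length (b # c # l)" using 1 by simp
    then show ?thesis using 1 False by auto
  qed
qed auto

lemma dual_dual:
  assumes "valid l" "2 \<le> i" "i < length l" "alternating i l"
  shows "dual i (dual i l) = l \<and> alternating i (dual i l)"
  using assms
proof (induction i l rule: dual.induct)
  case (1 i a b c l)
  note dist = valid_top_distinct[OF 1(2)]
  show ?case
  proof (cases "i = length l + 2")
    case True
    then have alt: "c < b \<longleftrightarrow> \<not> b < a" using 1 by (simp add: alternating_top)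
    with True dist show ?thesis
      by (auto simp: alternating_top between_def)
  next
    case False
    then have "i < length (b # c # l)" using 1 by simp
    then show ?thesis using 1 False by (simp del: dual.simps)
  qed
qed auto

text \<open>Connectivity is phrased through an invariant \<open>Q\<close>, so that it can transport
  relations between chains or between vertices. For different heads \<open>a\<close> and
  \<open>b\<close>, both boxes can be put on top, with a removable \<open>c\<close> between them as
  the third; there the dual equivalence exchanges \<open>a\<close> and \<open>b\<close>, and equal
  heads are left to the induction.\<close>

theorem chains_connected:
  assumes "valid l" "valid l'" "length l = length l'" "shape l = shape l'" "Q l"
    and "\<And>m i. Q m \<Longrightarrow> valid m \<Longrightarrow> length m = length l \<Longrightarrow> shape m = shape l \<Longrightarrow> 2 \<le> i \<Longrightarrow>
            i < length l \<Longrightarrow> alternating i m \<Longrightarrow> Q (dual i m)"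
  shows "Q l'"
  using assms
proof (induction "length l" arbitrary: l l' Q rule: less_induct)
  case less
  note closed = less.prems(6)
  \<comment> \<open>Chains with a common head: the induction hypothesis is applied to the tails,
    with \<open>Q\<close> read below that head.\<close>
  have step: "Q (a # s')" if "valid (a # s)" "valid (a # s')" "length s = length s'"
    "shape (a # s) = shape (a # s')" "shape (a # s) = shape l" "length (a # s) = length l" "Q (a # s)"
    for a s s'
  proof (rule less.hyps[of s s' "\<lambda>m. Q (a # m)"])
    show sh: "shape s = shape s'" using that(1,2,4) add_box_inject by auto
    show "Q (a # dual i m)" if m: "Q (a # m)" "valid m" "length m = length s" "shape m = shape s"
      "2 \<le> i" "i < length s" "alternating i m" for m i
      using closed[of "a # m" i] m \<open>valid (a # s)\<close> \<open>shape (a # s) = shape l\<close> \<open>length (a # s) = length l\<close>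
      by simp
  qed (use that in auto)
  show ?case
  proof (cases l)
    case Nil
    then show ?thesis using less.prems by simp
  next
    case (Cons a t)
    then obtain b t' where l': "l' = b # t'" using less.prems(3) by (cases l') auto
    show ?thesis
    proof (cases "a = b")
      case True
      then show ?thesis using step[of a t t'] less.prems Cons l' by simp
    next
      case False
      have rem: "removable b (shape l)" using less.prems(4) l' by simp
      then have rb: "removable b (shape t)" and far: "a \<noteq> b + 1" "a \<noteq> b - 1"
        using False less.prems(1,4) Cons l' by (auto simp: removable_def addable_def add_box_def)
      then obtain u where u: "valid (b # u)" "shape (b # u) = shape t" "Suc (length u) = length t"
        using valid_remove less.prems(1) Cons by fastforce
      have v1: "valid (a # b # u)" using u less.prems(1) Cons by simp
      then have ad: "addable a (shape u)" "addable b (shape u)"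
        using valid_swap[OF v1 far] by auto
      obtain c where c: "removable c (shape u)" "between c a b"
        using removable_between[OF ad False] .
      then obtain w where w: "valid (c # w)" "shape (c # w) = shape u" "Suc (length w) = length u"
        using valid_remove u by fastforce
      have v: "valid (a # b # c # w)" using v1 w by simp
      have sh: "shape (a # b # c # w) = shape l" using u w Cons by simp
      have "Q (a # b # c # w)"
        by (rule step[of a t]) (use v sh u w less.prems(1,5) Cons in auto)
      moreover have alt: "alternating (length w + 2) (a # b # c # w)"
        using c(2) by (simp add: alternating_top between_def) linarith
      ultimately have "Q (dual (length w + 2) (a # b # c # w))"
        using closed[of "a # b # c # w" "length w + 2"] v sh u w Cons by auto
      moreover have "dual (length w + 2) (a # b # c # w) = b # a # c # w"
        using c(2) by (auto simp: between_def)
      ultimately have "Q (b # a # c # w)" by simp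
      moreover have "valid (b # a # c # w)" "shape (b # a # c # w) = shape l"
        using valid_swap[OF v far] sh by auto
      ultimately show ?thesis unfolding l'
        using less.prems(2-4) l' u w Cons step[of b "a # c # w" t'] by auto
    qed
  qed
qed

text \<open>A bisimulation between chains is the identity: by induction the tails agree, and then the
  signatures of all chains with the same tail shape locate the top box.\<close>

theorem chains_rigid:
  assumes "\<And>l l'. R l l' \<Longrightarrow> valid l \<and> valid l' \<and> length l = n \<and> length l' = n"
    and "\<And>l l' i. R l l' \<Longrightarrow> 1 \<le> i \<Longrightarrow> i < n \<Longrightarrow> chain_sig i l = chain_sig i l'"
    and "\<And>l l' i. R l l' \<Longrightarrow> 2 \<le> i \<Longrightarrow> i < n \<Longrightarrow> alternating i l \<Longrightarrow> R (dual i l) (dual i l')"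
    and "R l l'"
  shows "l = l'"
  using assms
proof (induction n arbitrary: R l l')
  case 0
  then show ?case by (metis length_0_conv)
next
  case (Suc n)
  obtain a s b s' where l: "l = a # s" "l' = b # s'"
    using Suc.prems(1)[OF Suc.prems(4)] by (metis length_Suc_conv)
  \<comment> \<open>With the heads held fixed, \<open>R\<close> is a bisimulation between the tails,
    because the dual equivalences within a tail do not reach its head.\<close>
  have tails: "m = m'" if "R (a # m) (b # m')" for m m'
  proof (rule Suc.IH[of "\<lambda>m m'. R (a # m) (b # m')"])
    fix k k' i assume R: "R (a # k) (b # k')"
    show v: "valid k \<and> valid k' \<and> length k = n \<and> length k' = n"
      using Suc.prems(1)[OF R] by simp
    show "chain_sig i k = chain_sig i k'" if "1 \<le> i" "i < n"
      using Suc.prems(2)[OF R, of i] v that by simp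
    show "R (a # dual i k) (b # dual i k')" if "2 \<le> i" "i < n" "alternating i k"
      using Suc.prems(3)[OF R, of i] v that by simp
  qed (use that in auto)
  have ss: "s = s'" and R0: "R (a # s) (b # s)" using tails Suc.prems(4) l by auto
  have v: "valid (a # s)" "valid (b # s)" "length s = n" using Suc.prems(1)[OF R0] by auto
  have "a = b"
  proof (rule ccontr)
    assume "a \<noteq> b"
    then obtain c where c: "removable c (shape s)" "between c a b"
      using removable_between[of a "shape s" b] v by auto
    then obtain w where w: "valid (c # w)" "shape (c # w) = shape s" "Suc (length w) = length s"
      using valid_remove v by fastforce
    have "R (a # (c # w)) (b # (c # w))"
    proof (rule chains_connected[of s "c # w" "\<lambda>m. R (a # m) (b # m)"])
      show "R (a # dual i m) (b # dual i m)"
        if "R (a # m) (b # m)" "length m = length s" "2 \<le> i" "i < length s" "alternating i m" for m i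
        using Suc.prems(3)[OF that(1), of i] that v by simp
    qed (use v w R0 in auto)
    from Suc.prems(2)[OF this, of n] have "c < a \<longleftrightarrow> c < b"
      using v w by (auto split: if_splits)
    with c(2) show False by (auto simp: between_def)
  qed
  with l ss show ?case by simp
qed

section \<open>Labellings of dual equivalence graphs\<close>

lemma valid_appendD: "valid (xs @ l) \<Longrightarrow> valid l"
  by (induction xs) auto

lemma dual_append: "i < length l \<Longrightarrow> dual i (xs @ l) = xs @ dual i l"
  by (induction xs) auto

lemma alternating_append: "i < length l \<Longrightarrow> alternating i (xs @ l) \<longleftrightarrow> alternating i l"
  by (induction xs) auto

lemma chain_sig_append: "i < length l \<Longrightarrow> chain_sig i (xs @ l) = chain_sig i l"
  by (induction xs) auto

lemma walk_append: "walk G u cs v \<Longrightarrow> walk G v ds w \<Longrightarrow> walk G u (cs @ ds) w"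
  by (induction rule: walk.induct) (auto intro: walk.intros)

lemma shape_edges_insert:
  "{f a b |a b. (c, a, b) \<in> insert (d, x, y) es} =
    (if c = d then {f x y} else {}) \<union> {f a b |a b. (c, a, b) \<in> es}"
  by auto

lemma shape_edges_empty: "{f a b |a b. (c, a, b) \<in> {}} = {}"
  by auto

section \<open>The axioms as rules for single edges\<close>

locale deg =
  fixes G :: "'v scgraph" and n :: nat
  assumes deg: "dual_equivalence_graph n n G"
begin

lemma axioms:
  shows "signed_colored_graph n n G" "ax1 n G" "ax2 n n G" "ax3 n n G" "ax4 n G" "ax5 n G" "ax6 n G"
  using deg by (auto simp: dual_equivalence_graph_def)

lemma sig_cases: "v \<in> verts G \<Longrightarrow> 1 \<le> i \<Longrightarrow> i < n \<Longrightarrow> sig G v i = 1 \<or> sig G v i = - 1"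
  using axioms(1) unfolding signed_colored_graph_def by (auto dest!: PiE_mem[of _ _ _ i])

lemma edge_verts:
  assumes "{u, v} \<in> edges G i" "1 < i" "i < n"
  shows "u \<in> verts G" "v \<in> verts G"
proof -
  have "{u, v} \<in> {{u, v} |u v. u \<in> verts G \<and> v \<in> verts G \<and> u \<noteq> v}"
    using assms axioms(1) unfolding signed_colored_graph_def by blast
  then show "u \<in> verts G" "v \<in> verts G" by (auto simp: doubleton_eq_iff)
qed

lemma edge_exists_iff:
  assumes "w \<in> verts G" "1 < i" "i < n"
  shows "(\<exists>x. {w, x} \<in> edges G i) \<longleftrightarrow> sig G w (i - 1) \<noteq> sig G w i"
proof -
  have "sig G w (i - 1) = - sig G w i \<longleftrightarrow> (\<exists>x\<in>verts G. {w, x} \<in> edges G i)"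
    using assms axioms(2) unfolding ax1_def by blast
  then show ?thesis
    using sig_cases[of w i] sig_cases[of w "i - 1"] assms edge_verts by force
qed

lemma edge_sig_flip:
  assumes "{w, x} \<in> edges G i" "1 < i" "i < n"
  shows "sig G x (i - 1) = - sig G w (i - 1)" "sig G x i = - sig G w i"
proof -
  have "sig G w (i - 1) = - sig G x (i - 1) \<and> sig G w i = - sig G x i"
    using assms axioms(3) unfolding ax2_def by blast
  then show "sig G x (i - 1) = - sig G w (i - 1)" "sig G x i = - sig G w i" by auto
qed

lemma edge_sig_same:
  assumes "{w, x} \<in> edges G i" "1 < i" "i < n" "1 \<le> h" "h < n" "h + 2 < i \<or> i + 1 < h"
  shows "sig G x h = sig G w h"
proof -
  have "\<forall>h\<in>{1..<n}. h + 2 < i \<or> i + 1 < h \<longrightarrow> sig G w h = sig G x h"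
    using assms axioms(3) unfolding ax2_def by blast
  then show ?thesis using assms by auto
qed

lemma edge_sig_lower:
  assumes e: "{w, x} \<in> edges G i" and i: "2 < i" "i < n" and "sig G w (i - 2) \<noteq> sig G x (i - 2)"
  shows "sig G w (i - 2) = - sig G w (i - 1)"
proof -
  have i': "1 < i" using i by simp
  have "sig G w (i - 2) = - sig G x (i - 2)"
    using sig_cases[of w "i - 2"] sig_cases[of x "i - 2"] assms edge_verts[OF e i' i(2)] by force
  then show ?thesis using e i i' axioms(4) unfolding ax3_def by blast
qed

lemma edge_sig_upper:
  assumes e: "{w, x} \<in> edges G i" and i: "1 < i" "i + 1 < n" and "sig G w (i + 1) \<noteq> sig G x (i + 1)"
  shows "sig G w (i + 1) = - sig G w i"
proof -
  have i': "i < n" using i by simp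
  have "sig G w (i + 1) = - sig G x (i + 1)"
    using sig_cases[of w "i + 1"] sig_cases[of x "i + 1"] assms edge_verts[OF e i(1) i'] by force
  then show ?thesis using e i i' axioms(4) unfolding ax3_def by blast
qed

lemma edge_commute:
  assumes "{w, x} \<in> edges G i" "{x, y} \<in> edges G j" "1 < i" "i + 3 \<le> j" "j < n"
  obtains v where "{w, v} \<in> edges G j" "{v, y} \<in> edges G i"
proof -
  have "\<bar>int i - int j\<bar> \<ge> 3" "i < n" "1 < j" using assms by auto
  then show ?thesis using assms axioms(6) that unfolding ax5_def by meson
qed

lemma component_closed:
  assumes "x \<in> verts G" "I \<subseteq> {2..<n}"
  shows "\<exists>C\<in>components G I. x \<in> C \<and>
    (\<forall>c\<in>I. \<forall>u v. u \<in> C \<longrightarrow> {u, v} \<in> edges G c \<longrightarrow> v \<in> C)"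
proof (intro bexI conjI ballI allI impI)
  let ?C = "{w. \<exists>cs. set cs \<subseteq> I \<and> walk G x cs w}"
  show "?C \<in> components G I" using assms by (auto simp: components_def)
  show "x \<in> ?C" using assms walk_Nil[of x G] by (auto intro: exI[of _ "[]"])
  fix c u v assume c: "c \<in> I" and u: "u \<in> ?C" and e: "{u, v} \<in> edges G c"
  obtain cs where cs: "set cs \<subseteq> I" "walk G x cs u" using u by auto
  have "v \<in> verts G" using edge_verts[OF e] c assms by auto
  then have "walk G x (cs @ [c]) v"
    using walk_append[OF cs(2)] e by (auto intro!: walk.intros)
  then show "v \<in> ?C" using cs c by (auto intro!: exI[of _ "cs @ [c]"])
qed

text \<open>\<open>x\<close> must be the centre of the path or an end of the double edge. Mostly
  used to recognise double edges: once \<open>z\<close> also has an edge of color \<open>i\<close>,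
  or \<open>y\<close> one of color \<open>i - 1\<close>, the path is excluded.\<close>

lemma double_edge_or_path:
  assumes i: "2 < i" "i < n" and e: "{x, z} \<in> edges G (i - 1)" "{x, y} \<in> edges G i"
  shows "y = z \<or> (\<nexists>u. {z, u} \<in> edges G i) \<and> (\<nexists>u. {y, u} \<in> edges G (i - 1))"
proof -
  have "x \<in> verts G" using edge_verts[OF e(2)] i by auto
  moreover have "{i - 1, i} \<subseteq> {2..<n}" using i by auto
  ultimately obtain C where comp: "C \<in> components G {i - 1, i}" and x: "x \<in> C"
    and C: "\<forall>c\<in>{i - 1, i}. \<forall>u v. u \<in> C \<longrightarrow> {u, v} \<in> edges G c \<longrightarrow> v \<in> C"
    using component_closed by meson
  have shape: "has_shape G {i - 1, i} C 1 {} \<or>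
           has_shape G {i - 1, i} C 3 {(i - 1, 0, 1), (i, 1, 2)} \<or>
           has_shape G {i - 1, i} C 2 {(i - 1, 0, 1), (i, 0, 1)}"
    using comp axioms(5) i unfolding ax4_def by blast
  let ?E = "\<lambda>c. {e \<in> edges G c. e \<subseteq> C}"
  have zy: "z \<in> C" "y \<in> C" using C x e by blast+
  then have E: "{x, z} \<in> ?E (i - 1)" "{x, y} \<in> ?E i" using x e by auto
  have E': "{z, u} \<in> edges G i \<longleftrightarrow> {z, u} \<in> ?E i" "{y, u} \<in> edges G (i - 1) \<longleftrightarrow> {y, u} \<in> ?E (i - 1)" for u
    using C zy by blast+
  have ne: "i - 1 \<noteq> i" using i by simp
  from shape show ?thesis
  proof (elim disjE)
    assume "has_shape G {i - 1, i} C 1 {}"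
    then show ?thesis using E by (auto simp: has_shape_def)
  next
    assume "has_shape G {i - 1, i} C 3 {(i - 1, 0, 1), (i, 1, 2)}"
    then obtain vs where vs: "distinct vs" "length vs = 3"
      "?E (i - 1) = {{vs ! 0, vs ! 1}}" "?E i = {{vs ! 1, vs ! 2}}"
      using ne unfolding has_shape_def shape_edges_insert shape_edges_empty by auto
    have "vs ! 0 \<noteq> vs ! 1" "vs ! 0 \<noteq> vs ! 2" "vs ! 1 \<noteq> vs ! 2"
      using vs(1,2) by (simp_all add: nth_eq_iff_index_eq)
    then show ?thesis using E unfolding E' vs by (auto simp: doubleton_eq_iff)
  next
    assume "has_shape G {i - 1, i} C 2 {(i - 1, 0, 1), (i, 0, 1)}"
    then obtain vs where vs: "?E (i - 1) = {{vs ! 0, vs ! 1}}" "?E i = {{vs ! 0, vs ! 1}}"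
      using ne unfolding has_shape_def shape_edges_insert shape_edges_empty by auto
    then show ?thesis using E unfolding vs by (auto simp: doubleton_eq_iff)
  qed
qed

text \<open>Among the four shapes on three consecutive colors, these edges only fit the one on five
  vertices, where both equations hold, and the one on six vertices, where both fail.\<close>

lemma double_edge_transfer:
  assumes i: "3 < i" "i < n"
    and e: "{x, y} \<in> edges G i" "{x, u} \<in> edges G (i - 2)" "{x, t} \<in> edges G (i - 1)"
      "{y, z} \<in> edges G (i - 2)" "\<nexists>u. {y, u} \<in> edges G (i - 1)"
      "{z, w} \<in> edges G (i - 1)" "{z, v} \<in> edges G i"
  shows "u = t \<longleftrightarrow> w = v"
proof -
  let ?I = "{i - 2, i - 1, i}"
  have "x \<in> verts G" using edge_verts[OF e(1)] i by auto
  moreover have "?I \<subseteq> {2..<n}" using i by auto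
  ultimately obtain C where comp: "C \<in> components G ?I" and x: "x \<in> C"
    and C: "\<forall>c\<in>?I. \<forall>u v. u \<in> C \<longrightarrow> {u, v} \<in> edges G c \<longrightarrow> v \<in> C"
    using component_closed by meson
  have shape: "has_shape G ?I C 1 {} \<or>
           has_shape G ?I C 4 {(i - 2, 0, 1), (i - 1, 1, 2), (i, 2, 3)} \<or>
           has_shape G ?I C 5
             {(i - 2, 0, 1), (i - 1, 0, 1), (i, 1, 2), (i - 2, 2, 3), (i - 1, 3, 4), (i, 3, 4)} \<or>
           has_shape G ?I C 6
             {(i - 1, 0, 1), (i - 2, 1, 2), (i, 1, 3), (i, 2, 4), (i - 2, 3, 4), (i - 1, 4, 5)}"
    using comp axioms(5) i unfolding ax4_def by blast
  have in1: "y \<in> C" "u \<in> C" "t \<in> C" using C x e by blast+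
  then have in2: "z \<in> C" using C e by blast
  then have in3: "w \<in> C" "v \<in> C" using C e by blast+
  let ?E = "\<lambda>c. {e \<in> edges G c. e \<subseteq> C}"
  have E: "{x, y} \<in> ?E i" "{x, u} \<in> ?E (i - 2)" "{x, t} \<in> ?E (i - 1)"
      "{y, z} \<in> ?E (i - 2)" "\<forall>u. {y, u} \<notin> ?E (i - 1)"
      "{z, w} \<in> ?E (i - 1)" "{z, v} \<in> ?E i"
    using x in1 in2 in3 e by auto
  have ne: "i - 1 \<noteq> i" "i - 2 \<noteq> i" "i - 2 \<noteq> i - 1" using i by auto
  note ne = ne ne[symmetric]
  from shape show ?thesis
  proof (elim disjE)
    assume "has_shape G ?I C 1 {}"
    then show ?thesis using E by (auto simp: has_shape_def)
  next
    assume "has_shape G ?I C 4 {(i - 2, 0, 1), (i - 1, 1, 2), (i, 2, 3)}"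
    then obtain vs where vs: "distinct vs" "length vs = 4" "?E (i - 2) = {{vs ! 0, vs ! 1}}"
      "?E (i - 1) = {{vs ! 1, vs ! 2}}" "?E i = {{vs ! 2, vs ! 3}}"
      using ne unfolding has_shape_def shape_edges_insert shape_edges_empty by auto
    define f where "f = (\<lambda>k. vs ! k)"
    have "f 0 \<noteq> f 1" "f 0 \<noteq> f 2" "f 0 \<noteq> f 3" "f 1 \<noteq> f 2" "f 1 \<noteq> f 3" "f 2 \<noteq> f 3"
      using vs(1,2) by (simp_all add: nth_eq_iff_index_eq f_def)
    then show ?thesis using E unfolding vs f_def[symmetric] by (auto simp: doubleton_eq_iff)
  next
    assume "has_shape G ?I C 5
             {(i - 2, 0, 1), (i - 1, 0, 1), (i, 1, 2), (i - 2, 2, 3), (i - 1, 3, 4), (i, 3, 4)}"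
    then obtain vs where vs: "distinct vs" "length vs = 5"
      "?E (i - 2) = {{vs ! 0, vs ! 1}, {vs ! 2, vs ! 3}}"
      "?E (i - 1) = {{vs ! 0, vs ! 1}, {vs ! 3, vs ! 4}}"
      "?E i = {{vs ! 1, vs ! 2}, {vs ! 3, vs ! 4}}"
      using ne unfolding has_shape_def shape_edges_insert shape_edges_empty
      by (auto simp: insert_commute)
    define f where "f = (\<lambda>k. vs ! k)"
    have "f 0 \<noteq> f 1" "f 0 \<noteq> f 2" "f 0 \<noteq> f 3" "f 0 \<noteq> f 4" "f 1 \<noteq> f 2" "f 1 \<noteq> f 3" "f 1 \<noteq> f 4"
      "f 2 \<noteq> f 3" "f 2 \<noteq> f 4" "f 3 \<noteq> f 4"
      using vs(1,2) by (simp_all add: nth_eq_iff_index_eq f_def)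
    note d = this this[symmetric]
    from E(1) have "x = f 1 \<and> y = f 2 \<or> x = f 2 \<and> y = f 1 \<or> x = f 3 \<and> y = f 4 \<or> x = f 4 \<and> y = f 3"
      unfolding vs f_def[symmetric] by (auto simp: doubleton_eq_iff)
    \<comment> \<open>In the other three positions \<open>x\<close> has no edge of color
      \<open>i - 1\<close> or \<open>y\<close> has one.\<close>
    then have "x = f 1 \<and> y = f 2"
      using E(3,5) d unfolding vs f_def[symmetric] by (fastforce simp: doubleton_eq_iff)
    moreover from this have "z = f 3" using E(4) d
      unfolding vs f_def[symmetric] by (auto simp: doubleton_eq_iff)
    ultimately show ?thesis using E(2,3,6,7) d
      unfolding vs f_def[symmetric] by (auto simp: doubleton_eq_iff)
  next
    assume "has_shape G ?I C 6
             {(i - 1, 0, 1), (i - 2, 1, 2), (i, 1, 3), (i, 2, 4), (i - 2, 3, 4), (i - 1, 4, 5)}"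
    then obtain vs where vs: "distinct vs" "length vs = 6"
      "?E (i - 2) = {{vs ! 1, vs ! 2}, {vs ! 3, vs ! 4}}"
      "?E (i - 1) = {{vs ! 0, vs ! 1}, {vs ! 4, vs ! 5}}"
      "?E i = {{vs ! 1, vs ! 3}, {vs ! 2, vs ! 4}}"
      using ne unfolding has_shape_def shape_edges_insert shape_edges_empty
      by (auto simp: insert_commute)
    define f where "f = (\<lambda>k. vs ! k)"
    have "f 0 \<noteq> f 1" "f 0 \<noteq> f 2" "f 0 \<noteq> f 3" "f 0 \<noteq> f 4" "f 0 \<noteq> f 5" "f 1 \<noteq> f 2" "f 1 \<noteq> f 3" "f 1 \<noteq> f 4"
      "f 1 \<noteq> f 5" "f 2 \<noteq> f 3" "f 2 \<noteq> f 4" "f 2 \<noteq> f 5" "f 3 \<noteq> f 4" "f 3 \<noteq> f 5" "f 4 \<noteq> f 5"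
      using vs(1,2) by (simp_all add: nth_eq_iff_index_eq f_def)
    note d = this this[symmetric]
    from E(1) have "x = f 1 \<and> y = f 3 \<or> x = f 3 \<and> y = f 1 \<or> x = f 2 \<and> y = f 4 \<or> x = f 4 \<and> y = f 2"
      unfolding vs f_def[symmetric] by (auto simp: doubleton_eq_iff)
    \<comment> \<open>Two positions remain, exchanged by the symmetry of this shape that reverses
      the order of its vertices.\<close>
    then have "x = f 1 \<and> y = f 3 \<or> x = f 4 \<and> y = f 2"
      using E(3) d unfolding vs f_def[symmetric] by (auto simp: doubleton_eq_iff)
    then show ?thesis
    proof
      assume xy: "x = f 1 \<and> y = f 3"
      moreover from this have "z = f 4" using E(4) d
        unfolding vs f_def[symmetric] by (auto simp: doubleton_eq_iff)
      ultimately show ?thesis using E(2,3,6,7) d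
        unfolding vs f_def[symmetric] by (auto simp: doubleton_eq_iff)
    next
      assume xy: "x = f 4 \<and> y = f 2"
      moreover from this have "z = f 1" using E(4) d
        unfolding vs f_def[symmetric] by (auto simp: doubleton_eq_iff)
      ultimately show ?thesis using E(2,3,6,7) d
        unfolding vs f_def[symmetric] by (auto simp: doubleton_eq_iff)
    qed
  qed
qed

section \<open>Components under the colors below \<open>k\<close>, and their labellings\<close>

definition conn :: "nat \<Rightarrow> 'v \<Rightarrow> 'v \<Rightarrow> bool" where
  "conn k v w \<longleftrightarrow> (\<exists>cs. set cs \<subseteq> {2..<k} \<and> walk G v cs w)"

lemma walk_verts:
  "walk G v cs w \<Longrightarrow> set cs \<subseteq> {2..<n} \<Longrightarrow> v \<in> verts G \<and> w \<in> verts G"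
  by (induction rule: walk.induct) (auto dest: edge_verts)

lemma conn_verts: "conn k v w \<Longrightarrow> k \<le> n \<Longrightarrow> v \<in> verts G \<and> w \<in> verts G"
  unfolding conn_def using walk_verts by (meson ivl_subset le_refl order_trans)

lemma conn_refl: "v \<in> verts G \<Longrightarrow> conn k v v"
  unfolding conn_def by (intro exI[of _ "[]"]) (auto intro: walk.intros)

lemma conn_trans: "conn k u v \<Longrightarrow> conn k v w \<Longrightarrow> conn k u w"
  unfolding conn_def using walk_append by (metis le_sup_iff set_append)

lemma conn_mono: "conn j u v \<Longrightarrow> j \<le> k \<Longrightarrow> conn k u v"
  unfolding conn_def by (meson ivl_subset le_refl order_trans)

lemma conn_edge: "{u, v} \<in> edges G i \<Longrightarrow> 1 < i \<Longrightarrow> i < k \<Longrightarrow> k \<le> n \<Longrightarrow> conn k u v"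
  unfolding conn_def using edge_verts[of u v i]
  by (intro exI[of _ "[i]"]) (auto intro!: walk.intros)

lemma conn_invariant:
  assumes "conn k u v" "P u" "k \<le> n"
    and "\<And>i u v. {u, v} \<in> edges G i \<Longrightarrow> 1 < i \<Longrightarrow> i < k \<Longrightarrow> P u \<Longrightarrow> P v"
  shows "P v"
proof -
  obtain cs where "walk G u cs v" "set cs \<subseteq> {2..<k}" using assms(1) by (auto simp: conn_def)
  then show ?thesis using assms(2)
  proof (induction rule: walk.induct)
    case (walk_Cons u v c cs w)
    then show ?case using assms(4)[of u v c] by auto
  qed
qed

lemma conn_sym:
  assumes "conn k u v" "k \<le> n"
  shows "conn k v u"
proof (rule conn_invariant[OF assms(1) _ assms(2)])
  show "conn k u u" using assms conn_verts conn_refl by blast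
  show "conn k w u" if "{x, w} \<in> edges G i" "1 < i" "i < k" "conn k x u" for i x w
    using that conn_trans[OF conn_edge[of w x i k] that(4)] assms by (simp add: insert_commute)
qed

text \<open>A vertex is labelled by the chain of contents of the entries \<open>m, \<dots>, 1\<close> of a tableau; the
  edges of colors below \<open>k\<close> are already known to act as dual equivalences.\<close>

definition labelling :: "nat \<Rightarrow> nat \<Rightarrow> ('v \<Rightarrow> int list) \<Rightarrow> bool" where
  "labelling m k g \<longleftrightarrow>
     (\<forall>v\<in>verts G. valid (g v) \<and> length (g v) = m \<and>
        (\<forall>i. 1 \<le> i \<and> i < m \<longrightarrow> sig G v i = chain_sig i (g v))) \<and>
     (\<forall>i v w. 1 < i \<and> i < k \<and> {v, w} \<in> edges G i \<longrightarrow> g w = dual i (g v)) \<and>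
     (\<forall>v w. conn k v w \<and> g v = g w \<longrightarrow> v = w)"

lemma labelling_vertD:
  assumes "labelling m k g" "v \<in> verts G"
  shows "valid (g v)" "length (g v) = m" "1 \<le> i \<Longrightarrow> i < m \<Longrightarrow> sig G v i = chain_sig i (g v)"
  using assms by (auto simp: labelling_def)

lemma labelling_edgeD:
  "labelling m k g \<Longrightarrow> {v, w} \<in> edges G i \<Longrightarrow> 1 < i \<Longrightarrow> i < k \<Longrightarrow> g w = dual i (g v)"
  by (auto simp: labelling_def)

lemma labelling_injD: "labelling m k g \<Longrightarrow> conn k v w \<Longrightarrow> g v = g w \<Longrightarrow> v = w"
  by (auto simp: labelling_def)

lemma labelling_alternating:
  assumes "labelling m k g" "v \<in> verts G" "1 < i" "i < m" "i < n"
  shows "alternating i (g v) \<longleftrightarrow> (\<exists>w. {v, w} \<in> edges G i)"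
  using assms edge_exists_iff[of v i] labelling_vertD(3)[OF assms(1,2)]
  by (auto simp: alternating_def)

lemma labelling_shape:
  assumes "labelling m k g" "conn k v w" "k \<le> m" "m \<le> n"
  shows "shape (g w) = shape (g v)"
proof -
  have "shape (g w) = shape (g v) \<and> w \<in> verts G"
  proof (rule conn_invariant[OF assms(2)])
    show "shape (g v) = shape (g v) \<and> v \<in> verts G" using conn_verts assms by fastforce
    fix i u w assume e: "{u, w} \<in> edges G i" "1 < i" "i < k" "shape (g u) = shape (g v) \<and> u \<in> verts G"
    then have "alternating i (g u)" using labelling_alternating[OF assms(1), of u i] assms by auto
    then show "shape (g w) = shape (g v) \<and> w \<in> verts G"
      using dual_valid_shape[of "g u" i] labelling_edgeD[OF assms(1) e(1-3)] e assms
        labelling_vertD[OF assms(1), of u] edge_verts[OF e(1,2)] by auto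
  qed (use assms in auto)
  then show ?thesis by simp
qed

text \<open>The labels of a component exhaust the chains of its shape: these are connected by dual
  equivalences, each of which is realized by an edge because \<open>ax1\<close> provides one at
  every alternating place. Colors below \<open>j\<close> move only the lowest \<open>j\<close>
  entries, so the prefix \<open>xs\<close> survives.\<close>

lemma labelling_lift:
  assumes "labelling m k g" "m \<le> n" "v \<in> verts G" "g v = xs @ l" "length l = j" "j \<le> k" "k \<le> m"
    and "valid l'" "shape l' = shape l" "length l' = j"
  shows "\<exists>w. conn j v w \<and> g w = xs @ l'"
proof (rule chains_connected[of l l'])
  show "valid l" using labelling_vertD(1)[OF assms(1,3)] assms(4) valid_appendD by auto
  show "\<exists>w. conn j v w \<and> g w = xs @ l" using assms conn_refl by auto
  fix p i assume "\<exists>w. conn j v w \<and> g w = xs @ p" and p: "length p = length l" "2 \<le> i" "i < length l"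
    "alternating i p"
  then obtain w where w: "conn j v w" "g w = xs @ p" by blast
  have wv: "w \<in> verts G" using w conn_verts assms by fastforce
  have i: "1 < i" "i < m" "i < n" "i < k" "i < j" using p assms by auto
  then obtain z where z: "{w, z} \<in> edges G i"
    using labelling_alternating[OF assms(1) wv i(1-3)] w p assms by (auto simp: alternating_append)
  then have "g z = xs @ dual i p"
    using labelling_edgeD[OF assms(1) z i(1,4)] w p assms by (simp add: dual_append)
  moreover have "conn j v z" using conn_trans[OF w(1)] conn_edge[OF z] i assms by auto
  ultimately show "\<exists>w. conn j v w \<and> g w = xs @ dual i p" by blast
qed (use assms in auto)

end

section \<open>The box of the next entry\<close>

lemma chain_sig_nth:
  "Suc j < length l \<Longrightarrow> chain_sig (length l - Suc j) l = (if l ! Suc j < l ! j then 1 else - 1)"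
  by (simp add: chain_sig_def)

lemma removable_unfold:
  assumes "valid l" "removable c (shape l)"
  obtains l' where "valid (c # l')" "shape (c # l') = shape l" "length l = Suc (length l')"
  using valid_remove[OF assms] by auto

context deg
begin

lemma labellingI:
  assumes "\<And>v. v \<in> verts G \<Longrightarrow> valid (g v)" "\<And>v. v \<in> verts G \<Longrightarrow> length (g v) = m"
    and "\<And>v i. v \<in> verts G \<Longrightarrow> 1 \<le> i \<Longrightarrow> i < m \<Longrightarrow> sig G v i = chain_sig i (g v)"
    and "\<And>v w i. {v, w} \<in> edges G i \<Longrightarrow> 1 < i \<Longrightarrow> i < k \<Longrightarrow> g w = dual i (g v)"
    and "\<And>v w. conn k v w \<Longrightarrow> g v = g w \<Longrightarrow> v = w"
  shows "labelling m k g"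
  using assms unfolding labelling_def by blast

lemma labelling_neighbour:
  assumes "labelling m k g" "v \<in> verts G" "1 < i" "i < m" "i < n" "i < k" "alternating i (g v)"
  obtains w where "{v, w} \<in> edges G i" "g w = dual i (g v)" "w \<in> verts G"
proof -
  obtain w where w: "{v, w} \<in> edges G i" using labelling_alternating[OF assms(1-5)] assms(7) by auto
  show thesis
    using that[OF w labelling_edgeD[OF assms(1) w assms(3,6)] edge_verts(2)[OF w assms(3,5)]] .
qed

lemma conn_sig_const:
  assumes "conn j v w" "j < k" "k < n"
  shows "sig G w k = sig G v k"
proof (rule conn_invariant[OF assms(1), of "\<lambda>w. sig G w k = sig G v k"])
  fix i u w assume "{u, w} \<in> edges G i" "1 < i" "i < j" "sig G u k = sig G v k"
  then show "sig G w k = sig G v k" using edge_sig_same[of u w i k] assms by simp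
qed (use assms in auto)

text \<open>Below equal heads the tails have equal shapes, so colors below \<open>k - 1\<close> lead
  from \<open>v\<close> to a vertex with the label of \<open>w\<close>. By injectivity this vertex
  is \<open>w\<close>, and such colors are too low to change the sign in place
  \<open>k\<close>.\<close>

lemma labelling_top_sig:
  assumes L: "labelling k k g" and k: "1 \<le> k" "k < n"
    and vw: "conn k v w" "hd (g v) = hd (g w)"
  shows "sig G v k = sig G w k"
proof -
  have V: "v \<in> verts G" "w \<in> verts G" using conn_verts[OF vw(1)] k by auto
  note gv = labelling_vertD[OF L V(1)] and gw = labelling_vertD[OF L V(2)]
  obtain c l l' where l: "g v = [c] @ l" "g w = [c] @ l'"
    using gv(2) gw(2) vw(2) k by (cases "g v"; cases "g w") auto
  have "shape l = shape l'"
    using labelling_shape[OF L vw(1)] l gv(1) gw(1) add_box_inject k by auto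
  then obtain u where u: "conn (k - 1) v u" "g u = [c] @ l'"
    using labelling_lift[OF L _ V(1) l(1), of "k - 1" l'] gv(2) gw l k by auto
  have "conn k u v" using conn_sym[OF conn_mono[OF u(1)], of k] k by simp
  then have "conn k u w" using vw(1) by (rule conn_trans)
  then have "u = w" using labelling_injD[OF L] u(2) l(2) by simp
  then show ?thesis using conn_sig_const[OF u(1)] k by simp
qed

text \<open>Supplies the monotonicity that \<open>addable_cut\<close> asks for. With
  \<open>c\<close> and \<open>c' = hd (g w)\<close> stacked on a removable \<open>d\<close> between
  them, the edge of color \<open>k - 1\<close> exchanges \<open>c\<close> and \<open>c'\<close>. If
  the sign in place \<open>k\<close> changed along it, \<open>ax3\<close> would make it opposite to
  the sign in place \<open>k - 1\<close>, which is \<open>- 1\<close> because \<open>c < c'\<close>;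
  so at the end with head \<open>c\<close> it is \<open>1\<close> in either case.\<close>

lemma labelling_top_mono:
  assumes L: "labelling k k g" and k: "1 \<le> k" "k < n" and v: "v \<in> verts G"
    and c: "removable c (shape (g v))" and w: "conn k v w" "sig G w k = 1" "c < hd (g w)"
    and c': "removable (hd (g w)) (shape (g v))"
  obtains u where "conn k v u" "hd (g u) = c" "sig G u k = 1"
proof -
  note gv = labelling_vertD[OF L v]
  define c' where "c' = hd (g w)"
  have cc: "c < c'" "removable c' (shape (g v))" using w c' by (auto simp: c'_def)
  obtain l1 where l1: "valid (c # l1)" "shape (c # l1) = shape (g v)" "length (g v) = Suc (length l1)"
    using removable_unfold[OF gv(1) c] .
  have "removable c' (shape l1)"
    using cc l1(1) by (auto simp: removable_def add_box_def addable_def simp flip: l1(2))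
  then obtain l2 where l2: "valid (c' # l2)" "shape (c' # l2) = shape l1" "length l1 = Suc (length l2)"
    using removable_unfold l1(1) by auto
  have "c' \<noteq> c + 1" using cc l1(1) by (auto simp: removable_def add_box_def addable_def simp flip: l1(2))
  then have far: "c \<noteq> c' + 1" "c \<noteq> c' - 1" using cc by auto
  have "valid (c # c' # l2)" using l1 l2 by simp
  from valid_swap(1)[OF this far] obtain d where d: "removable d (shape l2)" "between d c c'"
    using removable_between[of c "shape l2" c'] cc l2(1) by auto
  then obtain l3 where l3: "valid (d # l3)" "shape (d # l3) = shape l2" "length l2 = Suc (length l3)"
    using removable_unfold l2(1) by auto
  have d: "c < d" "d < c'" using d(2) cc by (auto simp: between_def)
  let ?X = "c # c' # d # l3"
  have X: "valid ?X" "shape ?X = shape (g v)" "length ?X = k"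
    using l1 l2 l3 gv(2) by auto
  obtain u where u: "conn k v u" "g u = ?X"
    using labelling_lift[OF L _ v, of "[]" "g v" k ?X] X gv(2) k by auto
  have uV: "u \<in> verts G" using conn_verts[OF u(1)] k by simp
  have k3: "k = Suc (Suc (Suc (length l3)))" "2 < k" using X(3) by auto
  have "alternating (k - 1) (g u)"
    using d by (simp add: u(2) k3(1) alternating_top)
  then obtain z where z: "{u, z} \<in> edges G (k - 1)" "g z = dual (k - 1) (g u)" "z \<in> verts G"
    using labelling_neighbour[OF L uV, of "k - 1"] k k3 by auto
  have "hd (g z) = c'" using z(2) d by (simp add: u(2) k3(1) between_def)
  moreover have cz: "conn k v z" using conn_trans[OF u(1) conn_edge[OF z(1)]] k k3 by simp
  ultimately have zs: "sig G z k = 1"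
    using labelling_top_sig[OF L k, of z w] conn_trans[OF conn_sym[OF cz] w(1)] k w(2) by (simp add: c'_def)
  have "sig G u k = 1"
  proof (rule ccontr)
    assume "sig G u k \<noteq> 1"
    then have "sig G u k = - sig G u (k - 1)"
      using edge_sig_upper[OF z(1)] k k3 zs by simp
    moreover have "sig G u (k - 1) = - 1"
      using labelling_vertD(3)[OF L uV, of "k - 1"] k3 cc by (simp add: u(2) k3(1))
    ultimately show False using \<open>sig G u k \<noteq> 1\<close> by simp
  qed
  then show thesis using that[OF u(1)] u(2) by simp
qed

text \<open>The condition ranges over the whole component, whose heads run through all removable
  boxes. This pins \<open>a\<close> down and makes it the same for all vertices of the
  component.\<close>

definition new_box :: "nat \<Rightarrow> ('v \<Rightarrow> int list) \<Rightarrow> 'v \<Rightarrow> int \<Rightarrow> bool" where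
  "new_box k g v a \<longleftrightarrow> addable a (shape (g v)) \<and>
     (\<forall>w. conn k v w \<longrightarrow> sig G w k = (if hd (g w) < a then 1 else - 1))"

text \<open>By \<open>labelling_top_sig\<close> the sign is a property of the removable box on top,
  and \<open>addable_cut\<close> turns it into an addable box. Two candidates would have a removable
  box between them, and a vertex with that head would need both signs in place
  \<open>k\<close>.\<close>

lemma new_box_ex1:
  assumes L: "labelling k k g" and k: "1 \<le> k" "k < n" and v: "v \<in> verts G"
  shows "\<exists>!a. new_box k g v a"
proof -
  note gv = labelling_vertD[OF L v]
  have rem: "removable (hd (g w)) (shape (g v))" if "conn k v w" for w
  proof -
    have "w \<in> verts G" using conn_verts[OF that] k by simp
    then have "g w \<noteq> []" using labelling_vertD(2)[OF L] k by force
    then have "removable (hd (g w)) (shape (g w))" by (cases "g w") auto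
    then show ?thesis using labelling_shape[OF L that] k by simp
  qed
  have ex: "\<exists>w. conn k v w \<and> hd (g w) = c" if c: "removable c (shape (g v))" for c
  proof -
    obtain l where "valid (c # l)" "shape (c # l) = shape (g v)" "length (g v) = Suc (length l)"
      by (rule removable_unfold[OF gv(1) c])
    then show ?thesis
      using labelling_lift[OF L _ v, of "[]" "g v" k "c # l"] gv(2) k by fastforce
  qed
  define P where "P c \<longleftrightarrow> (\<exists>w. conn k v w \<and> hd (g w) = c \<and> sig G w k = 1)" for c
  obtain a where a: "addable a (shape (g v))" "\<And>c. removable c (shape (g v)) \<Longrightarrow> P c \<longleftrightarrow> c < a"
  proof (rule addable_cut[of "g v" P])
    fix c c' assume "removable c (shape (g v))" "removable c' (shape (g v))" "c < c'" "P c'"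
    then show "P c" using labelling_top_mono[OF L k v, of c] unfolding P_def by metis
  qed (use that in blast)
  have "new_box k g v a" unfolding new_box_def
  proof (intro conjI allI impI)
    fix w assume w: "conn k v w"
    have "sig G w k = 1 \<longleftrightarrow> P (hd (g w))"
      using w labelling_top_sig[OF L k] conn_trans conn_sym k unfolding P_def
      by (metis less_imp_le)
    then show "sig G w k = (if hd (g w) < a then 1 else - 1)"
      using a(2)[OF rem[OF w]] sig_cases[of w k] conn_verts[OF w] k by auto
  qed (use a in auto)
  moreover have "b = a" if b: "new_box k g v b" for b
  proof (rule ccontr)
    assume "b \<noteq> a"
    then obtain c where c: "removable c (shape (g v))" "between c a b"
      using removable_between[of a "shape (g v)" b] a b by (auto simp: new_box_def)
    obtain w where w: "conn k v w" "hd (g w) = c" using ex[OF c(1)] by blast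
    then have "c < a \<longleftrightarrow> c < b"
      using b \<open>new_box k g v a\<close> unfolding new_box_def by (metis one_neq_neg_one)
    then show False using c(2) by (auto simp: between_def)
  qed
  ultimately show ?thesis by blast
qed

lemma new_box_cong:
  assumes "labelling k k g" "conn k v w" "k \<le> n"
  shows "new_box k g v = new_box k g w"
proof -
  have "shape (g w) = shape (g v)" using labelling_shape[OF assms(1,2)] assms(3) by simp
  moreover have "conn k v u \<longleftrightarrow> conn k w u" for u
    using assms conn_trans conn_sym by meson
  ultimately show ?thesis by (auto simp: new_box_def fun_eq_iff)
qed

text \<open>Edges of colors below \<open>k\<close> stay within a component and so keep the new head.
  The second index remains \<open>k\<close>: nothing is claimed yet about edges of color
  \<open>k\<close>, which move the new entry.\<close>

lemma labelling_extend:
  assumes L: "labelling k k g" and k: "1 \<le> k" "k < n"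
  obtains A where "labelling (Suc k) k (\<lambda>v. A v # g v)"
proof -
  define A where "A v = (THE a. new_box k g v a)" for v
  have A: "new_box k g v (A v)" if "v \<in> verts G" for v
    using theI'[OF new_box_ex1[OF L k that]] unfolding A_def .
  have s: "sig G v i = chain_sig i (A v # g v)" if v: "v \<in> verts G" and i: "1 \<le> i" "i < Suc k" for v i
  proof (cases "i = k")
    case True
    have "sig G v k = (if hd (g v) < A v then 1 else - 1)"
      using A[OF v] conn_refl[OF v] by (auto simp: new_box_def)
    moreover obtain b l where "g v = b # l" "k = Suc (length l)"
      using labelling_vertD(2)[OF L v] k by (cases "g v") auto
    ultimately show ?thesis using True by simp
  next
    case False
    then show ?thesis using labelling_vertD[OF L v] i by simp
  qed
  have e: "A w # g w = dual i (A v # g v)" if vw: "{v, w} \<in> edges G i" and i: "1 < i" "i < k" for v w i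
  proof -
    have "new_box k g v = new_box k g w"
      using new_box_cong[OF L conn_edge[OF vw i]] k by simp
    then have "A v = A w" by (simp add: A_def)
    then show ?thesis
      using labelling_edgeD[OF L vw i] labelling_vertD(2)[OF L, of v] edge_verts[OF vw] i k by simp
  qed
  have "labelling (Suc k) k (\<lambda>v. A v # g v)"
  proof (rule labellingI)
    show "valid (A v # g v)" if "v \<in> verts G" for v
      using A[OF that] labelling_vertD(1)[OF L that] by (simp add: new_box_def)
    show "length (A v # g v) = Suc k" if "v \<in> verts G" for v
      using labelling_vertD(2)[OF L that] by simp
    show "v = w" if "conn k v w" "A v # g v = A w # g w" for v w
      using that labelling_injD[OF L, of v w] by simp
  qed (fact s, fact e)
  then show thesis by (rule that)
qed

end

section \<open>Edges of color \<open>k\<close> act as dual equivalences on the labels\<close>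

lemma between_commute: "between x a b \<longleftrightarrow> between x b a"
  by (auto simp: between_def)

context deg
begin

text \<open>The tails hold the entries \<open>1, ..., k - 2\<close>. Colors acting within them are
  at most \<open>k - 3\<close>, so \<open>ax5\<close> slides an edge of color \<open>k\<close> along
  such edges, and by \<open>ax2\<close> the signs in places below \<open>k - 2\<close> agree at its
  ends. The pairs of tails therefore form a bisimulation.\<close>

lemma edge_tails_eq:
  assumes L: "labelling (Suc k) k g" and k: "1 < k" "k < n" and e: "{x, y} \<in> edges G k"
  shows "drop 3 (g x) = drop 3 (g y)"
proof (rule chains_rigid[where n = "k - 2"
      and R = "\<lambda>l l'. \<exists>x y. {x, y} \<in> edges G k \<and> l = drop 3 (g x) \<and> l' = drop 3 (g y)"])
  have split: "g v = take 3 (g v) @ drop 3 (g v)" for v by simp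
  have len: "length (drop 3 (g v)) = k - 2" if "v \<in> verts G" for v
    using labelling_vertD(2)[OF L that] by simp
  have val: "valid (drop 3 (g v))" if "v \<in> verts G" for v
    using labelling_vertD(1)[OF L that] valid_appendD split by metis
  have sg: "sig G v i = chain_sig i (drop 3 (g v))" if "v \<in> verts G" "1 \<le> i" "i < k - 2" for v i
    using labelling_vertD(3)[OF L that(1), of i] chain_sig_append[of i "drop 3 (g v)" "take 3 (g v)"]
      len[OF that(1)] that by simp
  fix l l' assume "\<exists>x y. {x, y} \<in> edges G k \<and> l = drop 3 (g x) \<and> l' = drop 3 (g y)"
  then obtain x y where xy: "{x, y} \<in> edges G k" "l = drop 3 (g x)" "l' = drop 3 (g y)" by blast
  note V = edge_verts[OF xy(1) k]
  show "valid l \<and> valid l' \<and> length l = k - 2 \<and> length l' = k - 2"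
    using V val len xy by simp
  fix i
  show "chain_sig i l = chain_sig i l'" if i: "1 \<le> i" "i < k - 2"
  proof -
    have "sig G y i = sig G x i" by (rule edge_sig_same[OF xy(1) k]) (use i k in auto)
    then show ?thesis using sg[OF V(1) i] sg[OF V(2) i] xy by simp
  qed
  assume i: "2 \<le> i" "i < k - 2" and alt: "alternating i l"
  have i': "1 < i" "i < Suc k" "i < n" "i < k" "i + 3 \<le> k" using i k by auto
  have dl: "drop 3 (dual i (g v)) = dual i (drop 3 (g v))" if "v \<in> verts G" for v
    using dual_append[of i "drop 3 (g v)" "take 3 (g v)"] len[OF that] i
      labelling_vertD(2)[OF L that] by simp
  have "alternating i (g x)"
    using alt alternating_append[of i "drop 3 (g x)" "take 3 (g x)"] len[OF V(1)] i xy by simp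
  then obtain z where z: "{x, z} \<in> edges G i" "g z = dual i (g x)"
    using labelling_neighbour[OF L V(1) i'(1-4)] by blast
  obtain w where w: "{z, w} \<in> edges G k" "{w, y} \<in> edges G i"
    using edge_commute[of z x i y k] z(1) xy(1) i' k by (metis insert_commute)
  have "g w = dual i (g y)"
    using labelling_edgeD[OF L, of y w i] w(2) i' by (simp add: insert_commute)
  then show "\<exists>x y. {x, y} \<in> edges G k \<and> dual i l = drop 3 (g x) \<and> dual i l' = drop 3 (g y)"
    using w(1) z(2) dl V xy by metis
qed (use e in blast)

lemma edge_tops:
  assumes L: "labelling (Suc k) k g" and k: "1 < k" "k < n" and e: "{x, y} \<in> edges G k"
  obtains r q p r' q' p' T where "g x = r # q # p # T" "g y = r' # q' # p' # T" "length T = k - 2"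
proof -
  note V = edge_verts[OF e k]
  have m: "k = Suc (Suc (k - 2))" using k by simp
  obtain r q p T where x: "g x = r # q # p # T"
    using labelling_vertD(2)[OF L V(1)] by (subst (asm) m) (auto simp: length_Suc_conv)
  obtain r' q' p' T' where y: "g y = r' # q' # p' # T'"
    using labelling_vertD(2)[OF L V(2)] by (subst (asm) m) (auto simp: length_Suc_conv)
  have "T = T'" using edge_tails_eq[OF L k e] x y by simp
  then show thesis using that[OF x] y labelling_vertD(2)[OF L V(1)] x by auto
qed

text \<open>Makes the boxes below the top three free to choose, at both ends at once. The
  \<open>conn\<close> clauses allow conclusions about the new edge to be carried back to
  \<open>x\<close> and \<open>y\<close>.\<close>

lemma edge_lift:
  assumes L: "labelling (Suc k) k g" and k: "1 < k" "k < n" and e: "{x, y} \<in> edges G k"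
    and x: "g x = xs @ T" and y: "g y = ys @ T" and T: "length T = k - 2"
    and T': "valid T'" "shape T' = shape T" "length T' = k - 2"
  shows "\<exists>u w. {u, w} \<in> edges G k \<and> conn k x u \<and> conn k y w \<and> g u = xs @ T' \<and> g w = ys @ T'"
proof (rule chains_connected[of T T'])
  note V = edge_verts[OF e k]
  show "valid T" using labelling_vertD(1)[OF L V(1)] x valid_appendD by auto
  show "\<exists>u w. {u, w} \<in> edges G k \<and> conn k x u \<and> conn k y w \<and> g u = xs @ T \<and> g w = ys @ T"
    using e x y conn_refl V by blast
  fix S i assume S: "length S = length T" "2 \<le> i" "i < length T" "alternating i S"
    and "\<exists>u w. {u, w} \<in> edges G k \<and> conn k x u \<and> conn k y w \<and> g u = xs @ S \<and> g w = ys @ S"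
  then obtain u w where uw: "{u, w} \<in> edges G k" "conn k x u" "conn k y w" "g u = xs @ S" "g w = ys @ S"
    by blast
  have i': "1 < i" "i < Suc k" "i < n" "i < k" "i + 3 \<le> k" using S T k by auto
  have U: "u \<in> verts G" using edge_verts[OF uw(1) k] by simp
  have "alternating i (g u)" using S uw(4) by (simp add: alternating_append)
  then obtain z where z: "{u, z} \<in> edges G i" "g z = dual i (g u)"
    using labelling_neighbour[OF L U i'(1-4)] by blast
  obtain v where v: "{z, v} \<in> edges G k" "{v, w} \<in> edges G i"
    using edge_commute[of z u i w k] z(1) uw(1) i' k by (metis insert_commute)
  have wv: "{w, v} \<in> edges G i" using v(2) by (simp add: insert_commute)
  have "g v = ys @ dual i S"
    using labelling_edgeD[OF L wv] uw(5) S i' by (simp add: dual_append)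
  moreover have "g z = xs @ dual i S" using z(2) uw(4) S by (simp add: dual_append)
  moreover have "conn k x z" using conn_trans[OF uw(2) conn_edge[OF z(1)]] i' k by simp
  moreover have "conn k y v" using conn_trans[OF uw(3) conn_edge[OF wv]] i' k by simp
  ultimately show "\<exists>u w. {u, w} \<in> edges G k \<and> conn k x u \<and> conn k y w \<and>
      g u = xs @ dual i S \<and> g w = ys @ dual i S"
    using v(1) by blast
qed (use T T' in auto)

lemma sig_tops:
  assumes L: "labelling (Suc k) k g" and k: "1 < k" "k < n" and v: "v \<in> verts G"
    and g: "g v = r # q # p # T"
  shows "sig G v k = (if q < r then 1 else - 1)" "sig G v (k - 1) = (if p < q then 1 else - 1)"
proof -
  have len: "length (g v) = Suc k" using labelling_vertD(2)[OF L v] .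
  show "sig G v k = (if q < r then 1 else - 1)"
    using labelling_vertD(3)[OF L v, of k] chain_sig_nth[of 0 "g v"] k len by (simp add: g)
  show "sig G v (k - 1) = (if p < q then 1 else - 1)"
    using labelling_vertD(3)[OF L v, of "k - 1"] chain_sig_nth[of 1 "g v"] k len by (simp add: g)
qed

text \<open>Here \<open>k + 1\<close> is the middle letter, so \<open>q\<close> and \<open>p\<close>
  are not neighbours and both are addable to the shape of \<open>T\<close>. With a removable
  \<open>c\<close> between them as the next box, the edge of color \<open>k - 1\<close> exchanges
  \<open>q\<close> and \<open>p\<close>. Its other end again has an edge of color \<open>k\<close>,
  since \<open>r\<close> is in the middle there too, so by \<open>double_edge_or_path\<close> the
  edges of both colors coincide.\<close>

lemma edge_top_between:
  assumes L: "labelling (Suc k) k g" and k: "1 < k" "k < n" and e: "{x, y} \<in> edges G k"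
    and x: "g x = r # q # p # T" and y: "g y = r' # q' # p' # T" and T: "length T = k - 2"
    and bt: "between r q p"
  shows "g y = r # p # q # T" "conn k x y"
proof -
  note V = edge_verts[OF e k]
  have val: "valid (r # q # p # T)" using labelling_vertD(1)[OF L V(1)] x by simp
  have "addable q (shape T)" "addable p (shape T)"
    using val addable_far[of q p "shape T"] between_far[OF bt] by auto
  then obtain c where c: "removable c (shape T)" "between c p q"
    using removable_between[of p "shape T" q] val by (metis valid_top_distinct(2))
  moreover have "valid T" using val by simp
  ultimately obtain S where S: "valid (c # S)" "shape (c # S) = shape T" "length T = Suc (length S)"
    using removable_unfold by metis
  obtain u w where uw: "{u, w} \<in> edges G k" "conn k x u" "conn k y w"
    "g u = [r, q, p] @ (c # S)" "g w = [r', q', p'] @ (c # S)"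
    using edge_lift[OF L k e, of "[r, q, p]" T "[r', q', p']" "c # S"] x y T S by auto
  note V' = edge_verts[OF uw(1) k]
  have k3: "k = Suc (Suc (Suc (length S)))" using S T k by simp
  have alt: "alternating (k - 1) (g u)"
    using c(2) k3 by (auto simp: uw(4) alternating_top between_def)
  obtain z where z: "{u, z} \<in> edges G (k - 1)" "g z = dual (k - 1) (g u)" "z \<in> verts G"
    using labelling_neighbour[OF L V'(1) _ _ _ _ alt] k k3 by auto
  have "\<not> between q p c" using c(2) by (auto simp: between_def)
  then have gz: "g z = r # p # q # c # S"
    using z(2) k3 by (simp add: uw(4))
  have "sig G u k = (if q < r then 1 else - 1)" using sig_tops[OF L k V'(1)] uw(4) by simp
  moreover have "sig G z k = (if p < r then 1 else - 1)" "sig G z (k - 1) = (if q < p then 1 else - 1)"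
    using sig_tops[OF L k z(3)] gz by auto
  ultimately have "sig G z (k - 1) \<noteq> sig G z k" using bt by (auto simp: between_def)
  then obtain t where "{z, t} \<in> edges G k" using edge_exists_iff[OF z(3) k] by blast
  then have "w = z" using double_edge_or_path[OF _ k(2) z(1) uw(1)] k3 by auto
  then have "r' = r" "q' = p" "p' = q" using gz uw(5) by auto
  then show "g y = r # p # q # T" using y by simp
  have "conn k u w" using conn_edge[OF z(1), of k] k k3 \<open>w = z\<close> by simp
  then show "conn k x y"
    using conn_trans[OF uw(2)] conn_trans conn_sym[OF uw(3)] k by (meson less_imp_le)
qed

text \<open>A removable \<open>c\<close> between \<open>p\<close> and \<open>p'\<close>, placed next
  below them, makes the signs in place \<open>k - 2\<close> differ along the edge. By
  \<open>ax3\<close> both ends then have an edge of color \<open>k - 1\<close>, so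
  \<open>ax4\<close> leaves only a double edge. But color \<open>k - 1\<close> keeps the head
  \<open>r\<close>, and neither outcome of its dual equivalence fits the sign flip in place
  \<open>k\<close> and \<open>p'\<close> in the middle.\<close>

lemma edge_third_eq:
  assumes L: "labelling (Suc k) k g" and k: "1 < k" "k < n" and e: "{x, y} \<in> edges G k"
    and x: "g x = r # q # p # T" and y: "g y = r' # q' # p' # T" and T: "length T = k - 2"
    and bt: "between p q r" "between p' q' r'"
  shows "p = p'"
proof (rule ccontr)
  assume ne: "p \<noteq> p'"
  note V = edge_verts[OF e k]
  have val: "valid (r # q # p # T)" "valid (r' # q' # p' # T)"
    using labelling_vertD(1)[OF L V(1)] labelling_vertD(1)[OF L V(2)] x y by auto
  obtain c where c: "removable c (shape T)" "between c p p'"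
    using removable_between[OF _ _ ne, of "shape T"] val by auto
  moreover have "valid T" using val by simp
  ultimately obtain S where S: "valid (c # S)" "shape (c # S) = shape T" "length T = Suc (length S)"
    using removable_unfold by metis
  obtain u w where uw: "{u, w} \<in> edges G k" "g u = r # q # p # c # S" "g w = r' # q' # p' # c # S"
    using edge_lift[OF L k e, of "[r, q, p]" T "[r', q', p']" "c # S"] x y T S by auto
  note V' = edge_verts[OF uw(1) k]
  have k3: "k = Suc (Suc (Suc (length S)))" "2 < k" using S T k by auto
  have wu: "{w, u} \<in> edges G k" using uw(1) by (simp add: insert_commute)
  note su = sig_tops[OF L k V'(1) uw(2)] and sw = sig_tops[OF L k V'(2) uw(3)]
  have low: "sig G v (k - 2) = (if c < b then 1 else - 1)" if "v \<in> verts G" "g v = s # t # b # c # S" for v s t b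
    using labelling_vertD(3)[OF L that(1), of "k - 2"] chain_sig_nth[of 2 "g v"] k3
      labelling_vertD(2)[OF L that(1)] that(2) by (simp add: numeral_2_eq_2 numeral_3_eq_3)
  note lu = low[OF V'(1) uw(2)] and lw = low[OF V'(2) uw(3)]
  have "sig G u (k - 2) \<noteq> sig G w (k - 2)" using lu lw c(2) by (auto simp: between_def)
  then have fu: "sig G u (k - 2) = - sig G u (k - 1)" and fw: "sig G w (k - 2) = - sig G w (k - 1)"
    using edge_sig_lower[OF uw(1) k3(2) k(2)] edge_sig_lower[OF wu k3(2) k(2)] by auto
  have k2: "k - 1 - 1 = k - 2" by simp
  have "\<exists>t. {u, t} \<in> edges G (k - 1)" "\<exists>t. {w, t} \<in> edges G (k - 1)"
    using edge_exists_iff[OF V'(1), of "k - 1"] edge_exists_iff[OF V'(2), of "k - 1"] k3 k fu fw su sw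
    unfolding k2 by auto
  then obtain t t' where t: "{u, t} \<in> edges G (k - 1)" "{w, t'} \<in> edges G (k - 1)" by blast
  have "w = t" using double_edge_or_path[OF k3(2) k(2) t(1) uw(1)] t(2) by blast
  then have gw: "g w = dual (k - 1) (g u)" using labelling_edgeD[OF L t(1)] k3 by simp
  have "q \<noteq> r" "r' \<noteq> q'" using valid_top_distinct[OF val(1)] valid_top_distinct[OF val(2)] by auto
  moreover have "sig G w k = - sig G u k" "sig G w (k - 1) = - sig G u (k - 1)"
    using edge_sig_flip[OF uw(1) k] by auto
  ultimately show False using gw k3 uw(2,3) su sw bt c(2) by (auto simp: between_def split: if_splits)
qed

text \<open>Below \<open>p\<close> come \<open>c\<close> and then some \<open>d\<close> between
  \<open>c\<close> and \<open>p\<close>. At the end of \<open>x\<close>, the edges of colors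
  \<open>k - 2\<close> and \<open>k - 1\<close> coincide iff \<open>q\<close> lies between
  \<open>p\<close> and \<open>c\<close>. At the end of \<open>y\<close>, after one step of color
  \<open>k - 2\<close>, the edges of colors \<open>k - 1\<close> and \<open>k\<close> coincide iff
  \<open>r'\<close> lies between \<open>c\<close> and \<open>q'\<close>.
  \<open>double_edge_transfer\<close> equates the two conditions.\<close>

lemma edge_locate:
  assumes L: "labelling (Suc k) k g" and k: "1 < k" "k < n" and e: "{x, y} \<in> edges G k"
    and x: "g x = r # q # p # T" and y: "g y = r' # q' # p # T" and T: "length T = k - 2"
    and bt: "between p q r" "between p q' r'"
    and c: "removable c (shape (p # T))" "c \<noteq> p" "c < p \<longleftrightarrow> q < p" "c < p \<longleftrightarrow> r' < p"
  shows "between c q p \<longleftrightarrow> between c r' p"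
proof -
  note V = edge_verts[OF e k]
  have val: "valid (r # q # p # T)" "valid (r' # q' # p # T)"
    using labelling_vertD(1)[OF L V(1)] labelling_vertD(1)[OF L V(2)] x y by auto
  then have "valid (p # T)" "valid T" by simp_all
  have far: "c \<noteq> p + 1" "c \<noteq> p - 1" and cT: "removable c (shape T)"
    using c(1,2) \<open>valid (p # T)\<close> by (auto simp: removable_def add_box_def addable_def)
  have "c \<noteq> q"
    using val(1) c(1) unfolding valid.simps(2)[of _ "q # p # T"] valid.simps(2)[of q] addable_def removable_def
    by blast
  have "c \<noteq> r'"
  proof
    assume "c = r'"
    have "r' \<notin> add_box q' (shape (p # T))" using val(2) by (simp add: addable_def)
    moreover have "c \<in> shape (p # T)" using c(1) by (simp add: removable_def)
    ultimately have "c = q' - 1" unfolding add_box_def \<open>c = r'\<close> by blast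
    with \<open>c = r'\<close> bt(2) show False by (auto simp: between_def)
  qed
  obtain S where S: "valid (c # S)" "shape (c # S) = shape T" "length T = Suc (length S)"
    by (rule removable_unfold[OF \<open>valid T\<close> cT])
  have "valid (p # c # S)" "valid S" using S \<open>valid (p # T)\<close> by simp_all
  moreover have "p \<noteq> c + 1" "p \<noteq> c - 1" using far by auto
  ultimately have "addable p (shape S)" "addable c (shape S)"
    using addable_far[of p c "shape S"] by auto
  then obtain d where d: "removable d (shape S)" "between d c p"
    using removable_between[of c "shape S" p] c(2) by metis
  obtain U where U: "valid (d # U)" "shape (d # U) = shape S" "length S = Suc (length U)"
    by (rule removable_unfold[OF \<open>valid S\<close> d(1)])
  have k4: "k = Suc (Suc (Suc (Suc (length U))))" "3 < k" using U S T k by auto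
  obtain u w where uw: "{u, w} \<in> edges G k" "g u = r # q # p # c # d # U" "g w = r' # q' # p # c # d # U"
    using edge_lift[OF L k e, of "[r, q, p]" T "[r', q', p]" "c # d # U"] x y T S U by auto
  note V' = edge_verts[OF uw(1) k]
  \<comment> \<open>Two mirror images: \<open>c\<close>, \<open>d\<close>, \<open>q\<close>,
    \<open>r'\<close> on one side of \<open>p\<close>, and \<open>r\<close>, \<open>q'\<close> on
    the other. How \<open>q\<close> and \<open>r'\<close> compare with \<open>c\<close> is what the
    axioms have to decide.\<close>
  have ineq: "c < p \<and> d < p \<and> c < d \<and> q < p \<and> p < r \<and> r' < p \<and> p < q' \<or>
      p < c \<and> p < d \<and> d < c \<and> p < q \<and> r < p \<and> p < r' \<and> q' < p"
    using c(2-4) d(2) bt by (auto simp: between_def)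
  have nb: "\<exists>t. {v, t} \<in> edges G i \<and> g t = dual i (g v) \<and> t \<in> verts G"
    if "v \<in> verts G" "1 < i" "i < k" "alternating i (g v)" for v i
    using labelling_neighbour[OF L that(1,2) _ _ that(3,4)] k that by (metis less_SucI less_trans)
  have "alternating (k - 2) (g u)" "alternating (k - 2) (g w)" "alternating (k - 1) (g u)"
    "\<not> alternating (k - 1) (g w)"
    using ineq k4 by (auto simp: uw alternating_top)
  note alt = this
  obtain u2 where u2: "{u, u2} \<in> edges G (k - 2)" "g u2 = dual (k - 2) (g u)" "u2 \<in> verts G"
    using nb[OF V'(1) _ _ alt(1)] k4 by auto
  obtain u1 where u1: "{u, u1} \<in> edges G (k - 1)" "g u1 = dual (k - 1) (g u)" "u1 \<in> verts G"
    using nb[OF V'(1) _ _ alt(3)] k4 by auto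
  obtain z where z: "{w, z} \<in> edges G (k - 2)" "g z = dual (k - 2) (g w)" "z \<in> verts G"
    using nb[OF V'(2) _ _ alt(2)] k4 by auto
  have ndpc: "\<not> between p c d" using ineq by (auto simp: between_def)
  have gu2: "g u2 = r # q # c # p # d # U" using u2(2) ndpc k4 by (simp add: uw)
  have gu1: "g u1 = r # (if between q p c then q # c # p # d # U else p # q # c # d # U)"
    using u1(2) k4 by (simp add: uw)
  have gz: "g z = r' # q' # c # p # d # U" using z(2) ndpc k4 by (simp add: uw)
  have "alternating (k - 1) (g z)" using ineq k4 by (auto simp: gz alternating_top)
  then obtain z1 where z1: "{z, z1} \<in> edges G (k - 1)" "g z1 = dual (k - 1) (g z)" "z1 \<in> verts G"
    using nb[OF z(3)] k4 by auto
  have "\<not> between q' c p" using ineq by (auto simp: between_def)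
  then have gz1: "g z1 = r' # c # q' # p # d # U" using z1(2) k4 by (simp add: gz)
  note sz = sig_tops[OF L k z(3) gz] and sz1 = sig_tops[OF L k z1(3) gz1]
  have "sig G z (k - 1) \<noteq> sig G z k" using sz ineq by auto
  then obtain z0 where z0: "{z, z0} \<in> edges G k" using edge_exists_iff[OF z(3) k] by blast
  have "\<nexists>t. {w, t} \<in> edges G (k - 1)"
    using alt(4) labelling_alternating[OF L V'(2), of "k - 1"] k k4 by auto
  then have "u2 = u1 \<longleftrightarrow> z1 = z0"
    using double_edge_transfer[OF k4(2) k(2) uw(1) u2(1) u1(1) z(1) _ z1(1) z0] by blast
  moreover have "u2 = u1 \<longleftrightarrow> between q p c"
  proof
    assume "u2 = u1"
    then have eq: "hd (tl (g u2)) = hd (tl (g u1))" by simp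
    show "between q p c"
    proof (rule ccontr)
      assume "\<not> between q p c"
      then have "q = p" using eq by (simp add: gu1 gu2)
      then show False using bt(1) by (simp add: between_def)
    qed
  next
    assume "between q p c"
    then have "g u1 = g u2" by (simp only: gu1 gu2 if_True)
    moreover have "conn k u2 u1"
    proof (rule conn_trans)
      show "conn k u2 u" using conn_edge[of u2 u "k - 2" k] u2(1) k k4(2) by (simp add: insert_commute)
      show "conn k u u1" using conn_edge[OF u1(1)] k k4(2) by simp
    qed
    ultimately show "u2 = u1" using labelling_injD[OF L] by metis
  qed
  \<comment> \<open>Along an edge of color \<open>k\<close> the sign in place \<open>k\<close>
    flips. Conversely, the signs give \<open>z1\<close> an edge of color \<open>k\<close>, which
    rules out the path.\<close>
  moreover have "z1 = z0 \<longleftrightarrow> (c < r' \<longleftrightarrow> \<not> q' < r')"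
  proof
    assume "z1 = z0"
    then have "sig G z1 k = - sig G z k" using edge_sig_flip[OF z0 k] by simp
    then show "c < r' \<longleftrightarrow> \<not> q' < r'" using sz sz1 by (auto split: if_splits)
  next
    assume *: "c < r' \<longleftrightarrow> \<not> q' < r'"
    have "sig G z1 (k - 1) \<noteq> sig G z1 k" using * sz1 ineq by (auto split: if_splits)
    then obtain t where "{z1, t} \<in> edges G k" using edge_exists_iff[OF z1(3) k] by blast
    then show "z1 = z0" using double_edge_or_path[OF _ k(2) z1(1) z0] k4 by auto
  qed
  ultimately have "between q p c \<longleftrightarrow> (c < r' \<longleftrightarrow> \<not> q' < r')" by simp
  then show ?thesis using ineq \<open>c \<noteq> q\<close> \<open>c \<noteq> r'\<close> by (auto simp: between_def)
qed

text \<open>Both are addable to the shape of \<open>p # T\<close> and lie on the same side of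
  \<open>p\<close>. A removable box between them would lie between \<open>p\<close> and exactly one
  of them, against \<open>edge_locate\<close>.\<close>

lemma edge_second_eq:
  assumes L: "labelling (Suc k) k g" and k: "1 < k" "k < n" and e: "{x, y} \<in> edges G k"
    and x: "g x = r # q # p # T" and y: "g y = r' # q' # p # T" and T: "length T = k - 2"
    and bt: "between p q r" "between p q' r'" "q < p \<longleftrightarrow> r' < p"
  shows "q = r'"
proof (rule ccontr)
  assume ne: "q \<noteq> r'"
  note V = edge_verts[OF e k]
  have val: "valid (r # q # p # T)" "valid (r' # q' # p # T)"
    using labelling_vertD(1)[OF L V(1)] labelling_vertD(1)[OF L V(2)] x y by auto
  have "addable q (shape (p # T))" "addable r' (shape (p # T))"
    using val addable_far[of r' q' "shape (p # T)"] addable_far[of q' r' "shape (p # T)"] bt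
    by (auto simp: between_def)
  then obtain c where c: "removable c (shape (p # T))" "between c q r'"
    using removable_between[OF _ _ ne] by metis
  have "c \<noteq> p" "c < p \<longleftrightarrow> q < p" "c < p \<longleftrightarrow> r' < p" using c(2) bt by (auto simp: between_def)
  from edge_locate[OF L k e x y T bt(1,2) c(1) this] show False
    using c(2) bt by (auto simp: between_def)
qed

text \<open>The clause on heads serves injectivity: if \<open>r\<close> is not the middle letter,
  the dual equivalence replaces the head by \<open>q\<close>, so equal heads put the edge into the
  case where it doubles an edge of color \<open>k - 1\<close>.\<close>

lemma edge_dual:
  assumes L: "labelling (Suc k) k g" and k: "1 < k" "k < n" and e: "{x, y} \<in> edges G k"
  shows "g y = dual k (g x) \<and> (hd (g x) = hd (g y) \<longrightarrow> conn k x y)"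
proof -
  obtain r q p r' q' p' T where x: "g x = r # q # p # T" and y: "g y = r' # q' # p' # T"
    and T: "length T = k - 2"
    using edge_tops[OF L k e] .
  note V = edge_verts[OF e k]
  have e': "{y, x} \<in> edges G k" using e by (simp add: insert_commute)
  have kT: "k = length T + 2" using T k by simp
  show ?thesis
  proof (cases "between r q p")
    case True
    with edge_top_between[OF L k e x y T] kT show ?thesis by (simp add: x)
  next
    case False
    have nb: "\<not> between r' q' p'"
      using edge_top_between(1)[OF L k e' y x T] False x y by (auto simp: between_commute)
    have dist: "r \<noteq> q" "q \<noteq> p" "r \<noteq> p" "r' \<noteq> q'" "q' \<noteq> p'" "r' \<noteq> p'"
      using valid_top_distinct[of r q p T] valid_top_distinct[of r' q' p' T]
        labelling_vertD(1)[OF L V(1)] labelling_vertD(1)[OF L V(2)] x y by auto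
    note sx = sig_tops[OF L k V(1) x] and sy = sig_tops[OF L k V(2) y]
    have "sig G x (k - 1) \<noteq> sig G x k" using edge_exists_iff[OF V(1) k] e by blast
    then have bx: "between p q r" using sx False dist by (auto simp: between_def split: if_splits)
    have "sig G y (k - 1) \<noteq> sig G y k" using edge_exists_iff[OF V(2) k] e' by blast
    then have by': "between p' q' r'" using sy nb dist by (auto simp: between_def split: if_splits)
    have p: "p' = p" using edge_third_eq[OF L k e x y T bx by'] by simp
    \<comment> \<open>The sign in place \<open>k - 1\<close> flips along the edge, so
      \<open>q\<close> and \<open>q'\<close> are on opposite sides of \<open>p\<close>, and
      \<open>r\<close>, \<open>r'\<close> are opposite to them.\<close>
    have side: "q < p \<longleftrightarrow> r' < p" "q' < p \<longleftrightarrow> r < p"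
      using edge_sig_flip[OF e k] sx sy p bx by' by (auto simp: between_def split: if_splits)
    have "q = r'" using edge_second_eq[OF L k e x _ T bx _ side(1), of q'] y by' p by simp
    moreover have "q' = r" using edge_second_eq[OF L k e' _ x T _ bx side(2), of r'] y by' p by simp
    ultimately show ?thesis using p False kT dist by (simp add: x y)
  qed
qed

section \<open>Injectivity and the induction over the entries\<close>

lemma conn_Suc_split:
  assumes "walk G v cs w" "set cs \<subseteq> {2..k}" "count_list cs k \<le> 1" "k < n"
  shows "conn k v w \<or> (\<exists>a b. conn k v a \<and> {a, b} \<in> edges G k \<and> conn k b w)"
  using assms
proof (induction rule: walk.induct)
  case (walk_Nil v)
  then show ?case using conn_refl by blast
next
  case (walk_Cons u v c cs w)
  note V = edge_verts[OF walk_Cons.hyps(1)]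
  show ?case
  proof (cases "c = k")
    case True
    then have "k \<notin> set cs" using walk_Cons.prems by (auto simp: count_list_0_iff)
    then have "conn k v w" using walk_Cons unfolding conn_def
      by (intro exI[of _ cs]) (auto simp: le_less)
    then show ?thesis using walk_Cons True V conn_refl[of u k] by fastforce
  next
    case False
    then have "conn k u v" using walk_Cons conn_edge[of u v c k] by auto
    moreover have "conn k v w \<or> (\<exists>a b. conn k v a \<and> {a, b} \<in> edges G k \<and> conn k b w)"
      using walk_Cons False by auto
    ultimately show ?thesis using conn_trans by meson
  qed
qed

lemma conn_hd:
  assumes L: "labelling (Suc k) k g" and k: "k < n" and c: "conn k v w"
  shows "hd (g w) = hd (g v)"
proof (rule conn_invariant[OF c])
  fix i u w assume e: "{u, w} \<in> edges G i" "1 < i" "i < k" and h: "hd (g u) = hd (g v)"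
  then have "u \<in> verts G" using edge_verts(1) k by fastforce
  then obtain a l where "g u = a # l" "length l = k"
    using labelling_vertD(2)[OF L] by (metis length_Suc_conv)
  then show "hd (g w) = hd (g v)" using labelling_edgeD[OF L e] e h by simp
qed (use k in auto)

text \<open>For injectivity, \<open>ax6\<close> joins \<open>v\<close> and \<open>w\<close> by a
  walk with at most one edge \<open>{a, b}\<close> of color \<open>k\<close>. Lower colors keep the
  head, so equal labels of \<open>v\<close> and \<open>w\<close> give \<open>a\<close> and
  \<open>b\<close> equal heads, and by \<open>edge_dual\<close> that edge can be bypassed by lower
  colors.\<close>

lemma labelling_step:
  assumes L: "labelling (Suc k) k g" and k: "1 < k" "k < n"
  shows "labelling (Suc k) (Suc k) g"
proof (rule labellingI)
  note D = labelling_vertD[OF L]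
  show "valid (g v)" "length (g v) = Suc k" if "v \<in> verts G" for v using D that by auto
  show "sig G v i = chain_sig i (g v)" if "v \<in> verts G" "1 \<le> i" "i < Suc k" for v i
    using D that by auto
  show "g w = dual i (g v)" if "{v, w} \<in> edges G i" "1 < i" "i < Suc k" for v w i
    using that labelling_edgeD[OF L, of v w i] edge_dual[OF L k, of v w] by (cases "i = k") auto
  fix v w assume c: "conn (Suc k) v w" and eq: "g v = g w"
  have vV: "v \<in> verts G" using conn_verts[OF c] k by simp
  define C where "C = {w. \<exists>cs. set cs \<subseteq> {2..k} \<and> walk G v cs w}"
  have "C \<in> components G {2..k}" using vV by (auto simp: components_def C_def)
  moreover have "v \<in> C" using vV by (auto simp: C_def intro!: exI[of _ "[]"] walk.intros)
  moreover have "w \<in> C" using c by (auto simp: C_def conn_def atLeastLessThanSuc_atLeastAtMost)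
  ultimately obtain cs where "set cs \<subseteq> {2..k}" "walk G v cs w" "count_list cs k \<le> 1"
    using axioms(7) k unfolding ax6_def by meson
  then consider "conn k v w" | a b where "conn k v a" "{a, b} \<in> edges G k" "conn k b w"
    using conn_Suc_split k by blast
  then have "conn k v w"
  proof cases
    case 2
    have "hd (g a) = hd (g b)" using conn_hd[OF L k(2)] 2 eq by metis
    then have "conn k a b" using edge_dual[OF L k 2(2)] by simp
    then show ?thesis using 2 conn_trans by meson
  qed
  then show "v = w" using labelling_injD[OF L] eq by simp
qed

theorem labelling_exists:
  assumes "m \<le> n"
  obtains g where "labelling m m g"
proof -
  have "\<exists>g. labelling m m g" using assms
  proof (induction m)
    case 0
    have "conn 0 v w \<Longrightarrow> v = w" for v w by (auto simp: conn_def elim: walk.cases)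
    then have "labelling 0 0 (\<lambda>_. [])" by (auto simp: labelling_def)
    then show ?case by blast
  next
    case (Suc k)
    show ?case
    proof (cases "k = 0")
      case True
      have "conn 1 v w \<Longrightarrow> v = w" for v w by (auto simp: conn_def elim: walk.cases)
      then have "labelling (Suc k) (Suc k) (\<lambda>_. [0])"
        using True by (auto simp: labelling_def addable_def)
      then show ?thesis by blast
    next
      case False
      obtain g where "labelling k k g" using Suc by auto
      then obtain A where A: "labelling (Suc k) k (\<lambda>v. A v # g v)"
        using labelling_extend False Suc.prems by (metis One_nat_def Suc_le_eq neq0_conv)
      show ?thesis
      proof (cases "k = 1")
        case True
        \<comment> \<open>There is no color \<open>1\<close>, so the extended labelling has no
          further edges to respect.\<close>
        have "{2..<Suc k} = {2..<k}" using True by auto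
        then have "labelling (Suc k) (Suc k) (\<lambda>v. A v # g v)"
          using A True by (auto simp: labelling_def conn_def)
        then show ?thesis by blast
      next
        case 1: False
        then show ?thesis using labelling_step[OF A] False Suc.prems by auto
      qed
    qed
  qed
  then show thesis using that by blast
qed

end

section \<open>Tableaux as chains of contents\<close>

text \<open>Shapes as functions giving the row lengths, padded by zeros, so that adding a box is a
  function update.\<close>

definition rows :: "(nat \<Rightarrow> nat) \<Rightarrow> bool" where
  "rows r \<longleftrightarrow> (\<forall>j j'. 1 \<le> j \<longrightarrow> j \<le> j' \<longrightarrow> r j' \<le> r j)"

text \<open>The beta-set, or Maya diagram, of the shape. Row \<open>j\<close> is the particle at
  \<open>r j - j\<close>; a new box in that row has content \<open>r j + 1 - j\<close>, the place to
  which the particle moves.\<close>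

definition boundary :: "(nat \<Rightarrow> nat) \<Rightarrow> int set" where
  "boundary r = {int (r j) - int j |j. 1 \<le> j}"

lemma rowsD: "rows r \<Longrightarrow> 1 \<le> j \<Longrightarrow> j \<le> j' \<Longrightarrow> r j' \<le> r j"
  by (simp add: rows_def)

lemma rows_strict: "rows r \<Longrightarrow> 1 \<le> j \<Longrightarrow> j < j' \<Longrightarrow> int (r j') - int j' < int (r j) - int j"
  using rowsD[of r j j'] by simp

lemma rows_inject:
  "rows r \<Longrightarrow> 1 \<le> j \<Longrightarrow> 1 \<le> j' \<Longrightarrow> int (r j) - int j = int (r j') - int j' \<Longrightarrow> j = j'"
  using rows_strict[of r j j'] rows_strict[of r j' j] by (cases j j' rule: linorder_cases) auto

lemma boundary_0: "boundary (\<lambda>_. 0) = {..<0}"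
proof -
  have "x \<in> boundary (\<lambda>_. 0)" if "x < 0" for x
    using that by (auto simp: boundary_def intro!: exI[of _ "nat (- x)"])
  then show ?thesis by (auto simp: boundary_def)
qed

lemma boundary_add_box:
  assumes r: "rows r" and j: "1 \<le> j"
  shows "boundary (r(j := Suc (r j))) = add_box (int (r j) + 1 - int j) (boundary r)"
proof (intro set_eqI iffI)
  fix x assume "x \<in> boundary (r(j := Suc (r j)))"
  then obtain k where k: "1 \<le> k" "x = int ((r(j := Suc (r j))) k) - int k" by (auto simp: boundary_def)
  show "x \<in> add_box (int (r j) + 1 - int j) (boundary r)"
  proof (cases "k = j")
    case True
    then show ?thesis using k by (simp add: add_box_def)
  next
    case False
    then have "x \<noteq> int (r j) - int j" using rows_inject[OF r k(1) j] k by auto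
    then show ?thesis using False k by (auto simp: add_box_def boundary_def)
  qed
next
  fix x assume "x \<in> add_box (int (r j) + 1 - int j) (boundary r)"
  then consider "x = int (r j) + 1 - int j" | "x \<in> boundary r" "x \<noteq> int (r j) - int j"
    by (auto simp: add_box_def)
  then show "x \<in> boundary (r(j := Suc (r j)))"
  proof cases
    case 1
    then show ?thesis using j by (auto simp: boundary_def intro!: exI[of _ j])
  next
    case 2
    then obtain k where "1 \<le> k" "x = int (r k) - int k" "k \<noteq> j" by (auto simp: boundary_def)
    then show ?thesis by (auto simp: boundary_def intro!: exI[of _ k])
  qed
qed

lemma addable_boundary:
  assumes r: "rows r" and j: "1 \<le> j" and r': "rows (r(j := Suc (r j)))"
  shows "addable (int (r j) + 1 - int j) (boundary r)"
proof -
  have "int (r j) + 1 - int j \<noteq> int (r k) - int k" if "1 \<le> k" for k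
    using rows_inject[OF r' j that] by (cases "k = j") auto
  then show ?thesis using j by (auto simp: addable_def boundary_def)
qed

text \<open>If the row before \<open>j\<close> were no longer than row \<open>j\<close>, its
  particle would occupy the place \<open>a\<close>.\<close>

lemma addable_boundaryD:
  assumes r: "rows r" and a: "addable a (boundary r)"
  obtains j where "1 \<le> j" "a = int (r j) + 1 - int j" "rows (r(j := Suc (r j)))"
proof -
  obtain j where j: "1 \<le> j" "a = int (r j) + 1 - int j"
    using a by (auto simp: addable_def boundary_def)
  have "Suc (r j) \<le> r k" if k: "1 \<le> k" "k < j" for k
  proof -
    have "r j \<le> r (j - 1)" "r (j - 1) \<le> r k" using r k by (auto simp: rows_def)
    moreover have "int (r (j - 1)) - int (j - 1) \<in> boundary r"
      unfolding boundary_def using k by (intro CollectI exI[of _ "j - 1"]) auto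
    then have "int (r (j - 1)) - int (j - 1) \<noteq> a" using a by (auto simp: addable_def)
    ultimately show ?thesis using j k by auto
  qed
  then have "rows (r(j := Suc (r j)))" using r by (fastforce simp: rows_def)
  then show thesis using that j by blast
qed

text \<open>The positions decrease strictly with the row. As the first \<open>k - 1\<close> of them
  agree, the \<open>k\<close>-th particle of \<open>r\<close> appears in \<open>s\<close> at row
  \<open>k\<close> or later.\<close>

lemma boundary_inject_le:
  assumes r: "rows r" "rows s" and eq: "boundary r = boundary s" and k: "1 \<le> k"
    and less: "\<And>j. 1 \<le> j \<Longrightarrow> j < k \<Longrightarrow> r j = s j"
  shows "r k \<le> s k"
proof -
  have "int (r k) - int k \<in> boundary r" using k by (auto simp: boundary_def)
  then have "int (r k) - int k \<in> boundary s" unfolding eq .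
  then obtain j where j: "1 \<le> j" "int (s j) - int j = int (r k) - int k"
    by (auto simp: boundary_def)
  have "k \<le> j"
  proof (rule ccontr)
    assume "\<not> k \<le> j"
    then have "int (r j) - int j = int (r k) - int k" using less j by simp
    then show False using rows_inject[OF r(1) j(1) k] \<open>\<not> k \<le> j\<close> by simp
  qed
  then show ?thesis using rows_strict[OF r(2) k, of j] j by (cases "k = j") auto
qed

lemma boundary_inject:
  assumes "rows r" "rows s" "boundary r = boundary s" "1 \<le> k"
  shows "r k = s k"
  using assms(4)
proof (induction k rule: less_induct)
  case (less k)
  then show ?case
    using boundary_inject_le[OF assms(1-3)] boundary_inject_le[OF assms(2,1)] assms(3)
    by (metis order_antisym)
qed

definition cells :: "(nat \<Rightarrow> nat) \<Rightarrow> (nat \<times> nat) set" where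
  "cells r = {(i, j). 1 \<le> i \<and> 1 \<le> j \<and> i \<le> r j}"

definition row :: "nat list \<Rightarrow> nat \<Rightarrow> nat" where
  "row lam j = (if 1 \<le> j \<and> j \<le> length lam then lam ! (j - 1) else 0)"

lemma diagram_eq_cells: "diagram lam = cells (row lam)"
  by (auto simp: diagram_def cells_def row_def)

lemma rows_row: "lam \<in> partitions n \<Longrightarrow> rows (row lam)"
  by (auto simp: rows_def row_def partitions_def sorted_wrt_iff_nth_less le_less)

lemma card_cells_row: "card (diagram lam) = sum_list lam"
proof -
  have "diagram lam = (\<lambda>(j, i). (i, j)) ` (SIGMA j:{1..length lam}. {1..lam ! (j - 1)})"
    by (auto simp: diagram_def)
  then have "card (diagram lam) = card (SIGMA j:{1..length lam}. {1..lam ! (j - 1)})"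
    by (simp add: card_image inj_on_def)
  also have "\<dots> = (\<Sum>j\<in>{1..length lam}. lam ! (j - 1))" by simp
  also have "\<dots> = (\<Sum>j<length lam. lam ! j)"
    by (rule sum.reindex_bij_witness[of _ Suc "\<lambda>j. j - 1"]) auto
  finally show ?thesis by (simp add: sum_list_sum_nth atLeast0LessThan)
qed

lemma finite_diagram: "finite (diagram lam)"
proof -
  have "diagram lam = (\<lambda>(j, i). (i, j)) ` (SIGMA j:{1..length lam}. {1..lam ! (j - 1)})"
    by (auto simp: diagram_def)
  then show ?thesis by simp
qed

lemma row_inject:
  assumes "lam \<in> partitions n" "mu \<in> partitions m" "\<And>j. 1 \<le> j \<Longrightarrow> row lam j = row mu j"
  shows "lam = mu"
proof (rule nth_equalityI)
  have pos: "0 < row nu j \<longleftrightarrow> 1 \<le> j \<and> j \<le> length nu" if "nu \<in> partitions k" for nu k j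
    using that by (auto simp: partitions_def row_def)
  show len: "length lam = length mu"
    using pos[OF assms(1), of "length lam"] pos[OF assms(2), of "length lam"] assms(3)[of "length lam"]
      pos[OF assms(1), of "length mu"] pos[OF assms(2), of "length mu"] assms(3)[of "length mu"]
    by (cases "length lam = 0"; cases "length mu = 0") auto
  fix i assume "i < length lam"
  then show "lam ! i = mu ! i" using assms(3)[of "Suc i"] len by (simp add: row_def)
qed

section \<open>Standard fillings and their chains\<close>

definition standard :: "(nat \<times> nat) set \<Rightarrow> tableau \<Rightarrow> bool" where
  "standard D T \<longleftrightarrow> T \<in> extensional D \<and> bij_betw T D {1..card D} \<and>
     (\<forall>i j. (i, j) \<in> D \<and> (i + 1, j) \<in> D \<longrightarrow> T (i, j) < T (i + 1, j)) \<and>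
     (\<forall>i j. (i, j) \<in> D \<and> (i, j + 1) \<in> D \<longrightarrow> T (i, j) < T (i, j + 1))"

lemma SYT_standard: "SYT lam = {T. standard (diagram lam) T}"
  by (auto simp: SYT_def standard_def card_cells_row)

fun content :: "nat \<times> nat \<Rightarrow> int" where
  "content (i, j) = int i - int j"

fun chain_upto :: "(nat \<times> nat) set \<Rightarrow> tableau \<Rightarrow> nat \<Rightarrow> int list" where
  "chain_upto D T 0 = []"
| "chain_upto D T (Suc k) = content (inv_into D T (Suc k)) # chain_upto D T k"

definition chain :: "(nat \<times> nat) set \<Rightarrow> tableau \<Rightarrow> int list" where
  "chain D T = chain_upto D T (card D)"

lemma length_chain_upto [simp]: "length (chain_upto D T k) = k"
  by (induction k) auto

lemma length_chain [simp]: "length (chain D T) = card D"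
  by (simp add: chain_def)

lemma chain_upto_nth:
  "1 \<le> k \<Longrightarrow> k \<le> m \<Longrightarrow> chain_upto D T m ! (m - k) = content (inv_into D T k)"
proof (induction m)
  case (Suc m)
  then show ?case by (cases "k = Suc m") (auto simp: Suc_diff_le)
qed simp

lemma standard_inv:
  assumes "standard D T" "1 \<le> k" "k \<le> card D"
  shows "inv_into D T k \<in> D" "T (inv_into D T k) = k"
  using assms inv_into_into[of k T D] f_inv_into_f[of k T D]
  by (auto simp: standard_def bij_betw_def)

lemma standard_inv_eq:
  assumes "standard D T" "c \<in> D"
  shows "inv_into D T (T c) = c"
  using assms by (auto simp: standard_def bij_betw_def)

lemma standard_range:
  assumes "standard D T" "c \<in> D"
  shows "1 \<le> T c" "T c \<le> card D"
  using assms by (auto simp: standard_def bij_betw_def)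

lemma cells_down:
  "rows r \<Longrightarrow> (i, j) \<in> cells r \<Longrightarrow> 1 \<le> i' \<Longrightarrow> 1 \<le> j' \<Longrightarrow> i' \<le> i \<Longrightarrow> j' \<le> j \<Longrightarrow> (i', j') \<in> cells r"
  using rowsD[of r j' j] by (auto simp: cells_def)

lemma filling_mono:
  fixes T :: tableau
  assumes r: "rows r"
    and row: "\<And>i j. (i, j) \<in> cells r \<Longrightarrow> (i + 1, j) \<in> cells r \<Longrightarrow> T (i, j) \<le> T (i + 1, j)"
    and col: "\<And>i j. (i, j) \<in> cells r \<Longrightarrow> (i, j + 1) \<in> cells r \<Longrightarrow> T (i, j) \<le> T (i, j + 1)"
    and ij: "(i', j') \<in> cells r" "1 \<le> i" "i \<le> i'" "1 \<le> j" "j \<le> j'"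
  shows "T (i, j) \<le> T (i', j')"
proof -
  have "T (i, j) \<le> T (i', j)"
    using ij(3) cells_down[OF r ij(1) _ ij(4) order_refl ij(5)] ij(2)
  proof (induction i' rule: dec_induct)
    case (step m)
    then have "(Suc m, j) \<in> cells r" "(m, j) \<in> cells r" by (auto simp: cells_def)
    with step row[of m j] show ?case by (auto simp: cells_def)
  qed simp
  also have "T (i', j) \<le> T (i', j')"
    using ij(5) ij(1)
  proof (induction j' rule: dec_induct)
    case (step m)
    then have "(i', m) \<in> cells r" using cells_down[OF r step(4), of i' m] ij by auto
    with step col[of i' m] show ?case by auto
  qed simp
  finally show ?thesis .
qed

lemma standard_mono:
  assumes "rows r" "standard (cells r) T" "(i', j') \<in> cells r" "1 \<le> i" "i \<le> i'" "1 \<le> j" "j \<le> j'"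
  shows "T (i, j) \<le> T (i', j')"
  by (rule filling_mono[OF assms(1) _ _ assms(3-7)])
    (use assms(2) in \<open>auto simp: standard_def intro: less_imp_le\<close>)

lemma SSYT_mono:
  assumes "lam \<in> partitions n" "T \<in> SSYT lam"
    and "(i', j') \<in> diagram lam" "1 \<le> i" "i \<le> i'" "1 \<le> j" "j \<le> j'"
  shows "T (i, j) \<le> T (i', j')"
  using assms(3) unfolding diagram_eq_cells
  by (rule filling_mono[OF rows_row[OF assms(1)] _ _ _ assms(4-7), rotated 2])
    (use assms(2) in \<open>auto simp: SSYT_def diagram_eq_cells intro: less_imp_le\<close>)

lemma down_closed_interval:
  assumes "finite S" "\<And>i i'. i \<in> S \<Longrightarrow> 1 \<le> i' \<Longrightarrow> i' \<le> i \<Longrightarrow> i' \<in> S" "\<And>i. i \<in> S \<Longrightarrow> 1 \<le> i"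
  shows "S = {1..card S}"
proof (cases "S = {}")
  case False
  have eq: "S = {1..Max S}"
  proof (intro set_eqI iffI)
    fix x assume "x \<in> {1..Max S}"
    then show "x \<in> S" using assms(2)[OF Max_in[OF assms(1) False], of x] by simp
  next
    fix x assume "x \<in> S"
    then show "x \<in> {1..Max S}" using assms(1,3) by simp
  qed
  have "card S = Max S" by (subst eq) simp
  show ?thesis unfolding \<open>card S = Max S\<close> by (rule eq)
qed simp

text \<open>\<open>rk k\<close> is the shape filled by the entries up to \<open>k\<close>.
  Monotonicity puts entry \<open>k + 1\<close> right after the filled part of its row, so passing
  from \<open>rk k\<close> to \<open>rk (Suc k)\<close> adds a box of the content recorded in the
  chain.\<close>

lemma shape_chain_upto:
  assumes r: "rows r" and fin: "finite (cells r)" and T: "standard (cells r) T" and k: "k \<le> card (cells r)"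
  defines "rk \<equiv> \<lambda>k j. card {i. (i, j) \<in> cells r \<and> T (i, j) \<le> k}"
  shows "valid (chain_upto (cells r) T k) \<and> rows (rk k) \<and> shape (chain_upto (cells r) T k) = boundary (rk k)"
proof -
  let ?D = "cells r"
  have finS: "finite {i. (i, j) \<in> ?D \<and> T (i, j) \<le> k}" for j k
    by (rule finite_subset[of _ "fst ` ?D"]) (use fin in force)+
  have S: "(i, j) \<in> ?D \<and> T (i, j) \<le> k \<longleftrightarrow> 1 \<le> i \<and> i \<le> rk k j" if "1 \<le> j" for i j k
  proof -
    have "{i. (i, j) \<in> ?D \<and> T (i, j) \<le> k} = {1..rk k j}"
      unfolding rk_def
    proof (rule down_closed_interval)
      fix i i' assume "i \<in> {i. (i, j) \<in> ?D \<and> T (i, j) \<le> k}" "1 \<le> i'" "i' \<le> i"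
      then show "i' \<in> {i. (i, j) \<in> ?D \<and> T (i, j) \<le> k}"
        using cells_down[OF r, of i j i' j] standard_mono[OF r T, of i j i' j] that by auto
    qed (use finS in \<open>auto simp: cells_def\<close>)
    then show ?thesis by (auto simp: set_eq_iff)
  qed
  have rows: "rows (rk k)" for k unfolding rows_def
  proof (intro allI impI)
    fix j j' :: nat assume j: "1 \<le> j" "j \<le> j'"
    show "rk k j' \<le> rk k j" unfolding rk_def
    proof (rule card_mono[OF finS], safe)
      fix i assume "(i, j') \<in> ?D" "T (i, j') \<le> k"
      then show "(i, j) \<in> ?D" "T (i, j) \<le> k"
        using cells_down[OF r, of i j' i j] standard_mono[OF r T, of i j' i j] j by (auto simp: cells_def)
    qed
  qed
  have "valid (chain_upto ?D T k) \<and> shape (chain_upto ?D T k) = boundary (rk k)"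
    using k
  proof (induction k)
    case 0
    have "rk 0 = (\<lambda>_. 0)"
    proof
      fix j
      have "{i. (i, j) \<in> ?D \<and> T (i, j) \<le> 0} = {}" using standard_range(1)[OF T] by force
      then show "rk 0 j = 0" unfolding rk_def by (simp only: card.empty)
    qed
    then show ?case using boundary_0 by simp
  next
    case (Suc k)
    obtain i j where ij: "inv_into ?D T (Suc k) = (i, j)" by fastforce
    then have D: "(i, j) \<in> ?D" "T (i, j) = Suc k"
      using standard_inv[OF T, of "Suc k"] Suc.prems by auto
    have j: "1 \<le> j" using D by (auto simp: cells_def)
    have uniq: "T c = Suc k \<longleftrightarrow> c = (i, j)" if "c \<in> ?D" for c
      using standard_inv_eq[OF T that] ij D by auto
    have i: "i = Suc (rk k j)"
    proof -
      have "i \<le> rk (Suc k) j" "\<not> i \<le> rk k j" using S[OF j, of i "Suc k"] S[OF j, of i k] D by (auto simp: cells_def)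
      moreover have "i - 1 \<le> rk k j"
      proof (cases "i = 1")
        case False
        then have "(i - 1, j) \<in> ?D" using D by (auto simp: cells_def)
        moreover have "T (i - 1, j) \<le> T (i, j)"
          using standard_mono[OF r T D(1), of "i - 1" j] False D j by (auto simp: cells_def)
        moreover have "T (i - 1, j) \<noteq> Suc k" using uniq[OF calculation(1)] False D by (auto simp: cells_def)
        ultimately show ?thesis using S[OF j, of "i - 1" k] D by auto
      qed simp
      ultimately show ?thesis by simp
    qed
    have rk: "rk (Suc k) = (rk k)(j := Suc (rk k j))"
    proof
      fix j'
      show "rk (Suc k) j' = ((rk k)(j := Suc (rk k j))) j'"
      proof (cases "j' = j")
        case True
        have "{i. (i, j) \<in> ?D \<and> T (i, j) \<le> Suc k} = insert i {i. (i, j) \<in> ?D \<and> T (i, j) \<le> k}"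
          using D uniq by (auto simp: le_Suc_eq)
        moreover have "i \<notin> {i. (i, j) \<in> ?D \<and> T (i, j) \<le> k}" using D by simp
        ultimately show ?thesis using True finS by (simp add: rk_def)
      next
        case False
        then have "{i. (i, j') \<in> ?D \<and> T (i, j') \<le> Suc k} = {i. (i, j') \<in> ?D \<and> T (i, j') \<le> k}"
          using uniq by (auto simp: le_Suc_eq)
        then show ?thesis using False by (simp add: rk_def)
      qed
    qed
    have c: "content (inv_into ?D T (Suc k)) = int (rk k j) + 1 - int j" using ij i by simp
    have "rows ((rk k)(j := Suc (rk k j)))" using rows[of "Suc k"] rk by simp
    then have "addable (int (rk k j) + 1 - int j) (boundary (rk k))"
      using addable_boundary[OF rows j] by blast
    then show ?case unfolding rk boundary_add_box[OF rows j]
      using Suc by (simp add: c)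
  qed
  then show ?thesis using rows by blast
qed

lemma shape_chain:
  assumes r: "rows r" and fin: "finite (cells r)" and T: "standard (cells r) T"
  shows "valid (chain (cells r) T)" "shape (chain (cells r) T) = boundary r"
proof -
  let ?rk = "\<lambda>j. card {i. (i, j) \<in> cells r \<and> T (i, j) \<le> card (cells r)}"
  have "?rk j = r j" if "1 \<le> j" for j
  proof -
    have "{i. (i, j) \<in> cells r \<and> T (i, j) \<le> card (cells r)} = {1..r j}"
      using that standard_range(2)[OF T] by (fastforce simp: cells_def)
    then show ?thesis by simp
  qed
  then have "boundary ?rk = boundary r" by (force simp: boundary_def)
  then show "valid (chain (cells r) T)" "shape (chain (cells r) T) = boundary r"
    using shape_chain_upto[OF r fin T order_refl] by (auto simp: chain_def)
qed

text \<open>On each diagonal a standard filling increases from southwest to northeast, so the contents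
  of the entries determine their cells.\<close>

lemma chain_inject_cell:
  assumes r: "rows r" and T: "standard (cells r) T" and U: "standard (cells r) U"
    and eq: "content (inv_into (cells r) T k) = content (inv_into (cells r) U k)"
    and k: "1 \<le> k" "k \<le> card (cells r)"
    and less: "\<And>m. 1 \<le> m \<Longrightarrow> m < k \<Longrightarrow> inv_into (cells r) T m = inv_into (cells r) U m"
  shows "fst (inv_into (cells r) U k) \<le> fst (inv_into (cells r) T k)"
proof (rule ccontr)
  let ?D = "cells r"
  obtain i j i' j' where ij: "inv_into ?D T k = (i, j)" "inv_into ?D U k = (i', j')" by fastforce
  have D: "(i, j) \<in> ?D" "T (i, j) = k" "(i', j') \<in> ?D" "U (i', j') = k"
    using standard_inv[OF T k] standard_inv[OF U k] ij by auto
  assume "\<not> fst (inv_into ?D U k) \<le> fst (inv_into ?D T k)"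
  then have lt: "i < i'" "j < j'" using ij eq by auto
  have "U (i, j) \<le> k" using standard_mono[OF r U D(3), of i j] lt D by (auto simp: cells_def)
  moreover have "U (i, j) \<noteq> k" using standard_inv_eq[OF U D(1)] ij lt by auto
  ultimately have "inv_into ?D T (U (i, j)) = (i, j)"
    using less[of "U (i, j)"] standard_range(1)[OF U D(1)] standard_inv_eq[OF U D(1)] by simp
  then have "T (i, j) = U (i, j)"
    using standard_inv(2)[OF T, of "U (i, j)"] standard_range[OF U D(1)] by simp
  then show False using D \<open>U (i, j) \<noteq> k\<close> by simp
qed

lemma chain_inject:
  assumes r: "rows r" and T: "standard (cells r) T" and U: "standard (cells r) U"
    and eq: "chain (cells r) T = chain (cells r) U"
  shows "T = U"
proof -
  let ?D = "cells r"
  have ceq: "content (inv_into ?D T k) = content (inv_into ?D U k)" if "1 \<le> k" "k \<le> card ?D" for k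
    using eq chain_upto_nth[OF that, of ?D] unfolding chain_def by metis
  have inv: "inv_into ?D T k = inv_into ?D U k" if "1 \<le> k" "k \<le> card ?D" for k
    using that
  proof (induction k rule: less_induct)
    case (less k)
    have IH: "inv_into ?D T m = inv_into ?D U m" if "1 \<le> m" "m < k" for m
      using less.IH[OF that(2,1)] less.prems that by simp
    have "fst (inv_into ?D U k) = fst (inv_into ?D T k)"
      using chain_inject_cell[OF r T U ceq[OF less.prems] less.prems IH]
        chain_inject_cell[OF r U T ceq[OF less.prems, symmetric] less.prems IH[symmetric]]
      by simp
    then show ?case using ceq[OF less.prems]
      by (cases "inv_into ?D U k"; cases "inv_into ?D T k") auto
  qed
  show ?thesis
  proof (rule extensionalityI[of _ ?D])
    fix c assume c: "c \<in> ?D"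
    have "inv_into ?D U (T c) = c"
      using inv[OF standard_range[OF T c]] standard_inv_eq[OF T c] by simp
    then show "T c = U c" using standard_inv(2)[OF U standard_range[OF T c]] by simp
  qed (use T U in \<open>auto simp: standard_def\<close>)
qed

lemma chain_upto_cong:
  "(\<And>k. 1 \<le> k \<Longrightarrow> k \<le> m \<Longrightarrow> inv_into D T k = inv_into D' T' k) \<Longrightarrow> chain_upto D T m = chain_upto D' T' m"
  by (induction m) auto

text \<open>The head is an addable content, hence belongs to a unique row, and the largest entry
  goes to the end of that row. \<open>rows_partition\<close> converts the row lengths into a
  partition afterwards.\<close>

lemma chain_surj_rows:
  "valid l \<Longrightarrow> \<exists>r T. rows r \<and> finite (cells r) \<and> standard (cells r) T \<and> chain (cells r) T = l"
proof (induction l)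
  case Nil
  have "cells (\<lambda>_. 0) = {}" by (auto simp: cells_def)
  then show ?case
    by (intro exI[of _ "\<lambda>_. 0"] exI[of _ "\<lambda>_. undefined"])
      (auto simp: rows_def standard_def chain_def bij_betw_def)
next
  case (Cons a l)
  then obtain r T where r: "rows r" "finite (cells r)" and T: "standard (cells r) T"
    and l: "chain (cells r) T = l" by auto
  have "addable a (boundary r)" using Cons.prems shape_chain(2)[OF r T] l by simp
  then obtain j where j: "1 \<le> j" "a = int (r j) + 1 - int j" "rows (r(j := Suc (r j)))"
    using addable_boundaryD r(1) by blast
  let ?D = "cells r" and ?c = "(Suc (r j), j)"
  let ?D' = "cells (r(j := Suc (r j)))" and ?T = "T(?c := Suc (card ?D))"
  have D': "?D' = insert ?c ?D" using j by (auto simp: cells_def)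
  have c: "?c \<notin> ?D" by (auto simp: cells_def)
  have card: "card ?D' = Suc (card ?D)" using D' c r by simp
  have bij: "bij_betw T ?D {1..card ?D}" using T by (simp add: standard_def)
  have bij': "bij_betw ?T ?D' {1..card ?D'}"
  proof -
    have "bij_betw ?T ?D {1..card ?D}" using bij c by (subst bij_betw_cong[of _ _ T]) auto
    moreover have "bij_betw ?T {?c} {Suc (card ?D)}" by simp
    ultimately have "bij_betw ?T (?D \<union> {?c}) ({1..card ?D} \<union> {Suc (card ?D)})"
      by (rule bij_betw_combine) simp
    then show ?thesis using D' card by (simp add: atLeastAtMostSuc_conv)
  qed
  have T': "standard ?D' ?T" unfolding standard_def
  proof (intro conjI allI impI)
    show "?T \<in> extensional ?D'" using T D' by (auto simp: standard_def extensional_def)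
    have less: "T c' < Suc (card ?D)" if "c' \<in> ?D" for c' using standard_range(2)[OF T that] by simp
    fix i k
    {
      assume A: "(i, k) \<in> ?D' \<and> (i + 1, k) \<in> ?D'"
      then have "(i, k) \<noteq> ?c" by (auto simp: cells_def)
      then have "(i, k) \<in> ?D" using A D' by blast
      then show "?T (i, k) < ?T (i + 1, k)"
        using A D' T less[of "(i, k)"] \<open>(i, k) \<noteq> ?c\<close> unfolding standard_def by auto
    next
      assume A: "(i, k) \<in> ?D' \<and> (i, k + 1) \<in> ?D'"
      have "r (Suc j) \<le> r j" using r j by (simp add: rows_def)
      then have "(i, k) \<noteq> ?c" using A by (auto simp: cells_def)
      then have "(i, k) \<in> ?D" using A D' by blast
      then show "?T (i, k) < ?T (i, k + 1)"
        using A D' T less[of "(i, k)"] \<open>(i, k) \<noteq> ?c\<close> unfolding standard_def by auto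
    }
  qed (rule bij')
  have inv: "inv_into ?D' ?T k = inv_into ?D T k" if "1 \<le> k" "k \<le> card ?D" for k
  proof -
    note c' = standard_inv[OF T that]
    have "inv_into ?D T k \<noteq> ?c" using c' c by metis
    then show ?thesis
      using standard_inv_eq[OF T', of "inv_into ?D T k"] c' D' by simp
  qed
  have "inv_into ?D' ?T (Suc (card ?D)) = ?c"
    using standard_inv_eq[OF T', of ?c] D' by simp
  then have "chain ?D' ?T = a # l"
    using chain_upto_cong[of "card ?D" ?D' ?T ?D T] inv card j(2) l by (simp add: chain_def)
  moreover have "finite ?D'" using D' r by simp
  ultimately show ?case using j(3) T' by blast
qed

lemma rows_partition:
  assumes r: "rows r" and fin: "finite (cells r)"
  obtains lam where "lam \<in> partitions (card (cells r))" "diagram lam = cells r" "\<And>j. 1 \<le> j \<Longrightarrow> row lam j = r j"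
proof -
  define S where "S = {j. 1 \<le> j \<and> 0 < r j}"
  have "S \<subseteq> snd ` cells r" by (force simp: S_def cells_def image_iff)
  then have "finite S" using fin finite_surj by blast
  then have S: "S = {1..card S}"
    by (rule down_closed_interval) (use r in \<open>auto simp: S_def rows_def intro: less_le_trans\<close>)
  define lam where "lam = map r [1..<Suc (card S)]"
  have row: "row lam j = r j" if "1 \<le> j" for j
  proof (cases "j \<le> card S")
    case True
    then show ?thesis using that by (simp add: row_def lam_def del: upt_Suc)
  next
    case False
    then have "j \<notin> S" by (subst S) simp
    then show ?thesis using that False by (auto simp: row_def lam_def S_def)
  qed
  have D: "diagram lam = cells r" unfolding diagram_eq_cells by (auto simp: cells_def row)
  have "sorted_wrt (\<ge>) lam" unfolding lam_def sorted_wrt_map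
    using r by (auto simp: rows_def sorted_wrt_iff_nth_less simp del: upt_Suc)
  moreover have "\<forall>p\<in>set lam. 0 < p"
  proof
    fix p assume "p \<in> set lam"
    then obtain j where "p = r j" "j \<in> {1..card S}" by (auto simp: lam_def simp del: upt_Suc)
    moreover from this(2) have "j \<in> S" by (subst S)
    ultimately show "0 < p" by (simp add: S_def)
  qed
  moreover have "sum_list lam = card (cells r)" using card_cells_row[of lam] unfolding D by simp
  ultimately have "lam \<in> partitions (card (cells r))" by (simp add: partitions_def)
  then show thesis using that D row by blast
qed

definition tab_chain :: "nat list \<Rightarrow> tableau \<Rightarrow> int list" where
  "tab_chain lam = chain (diagram lam)"

lemma valid_partition:
  assumes "valid l" "length l = n"
  obtains lam T where "lam \<in> partitions n" "T \<in> SYT lam" "tab_chain lam T = l"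
proof -
  obtain r T where r: "rows r" "finite (cells r)" "standard (cells r) T" "chain (cells r) T = l"
    using chain_surj_rows[OF assms(1)] by blast
  obtain lam where lam: "lam \<in> partitions (card (cells r))" "diagram lam = cells r"
    using rows_partition[OF r(1,2)] by metis
  have "card (cells r) = n" using r(4) assms(2) length_chain by metis
  then show thesis using that[of lam T] r lam by (simp add: SYT_standard tab_chain_def)
qed

lemma tab_chain_valid:
  assumes "lam \<in> partitions n" "T \<in> SYT lam"
  shows "valid (tab_chain lam T)" "length (tab_chain lam T) = n"
    "shape (tab_chain lam T) = boundary (row lam)"
proof -
  have T: "standard (cells (row lam)) T" "finite (cells (row lam))" "card (cells (row lam)) = n"
    using assms finite_diagram[of lam] card_cells_row[of lam]
    by (simp_all add: SYT_standard diagram_eq_cells partitions_def)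
  show "valid (tab_chain lam T)" "shape (tab_chain lam T) = boundary (row lam)"
    unfolding tab_chain_def diagram_eq_cells
    using shape_chain[OF rows_row[OF assms(1)] T(2,1)] by auto
  show "length (tab_chain lam T) = n" using T(3) by (simp add: tab_chain_def diagram_eq_cells)
qed

lemma tab_chain_inject:
  assumes "lam \<in> partitions n" "T \<in> SYT lam" "U \<in> SYT lam" "tab_chain lam T = tab_chain lam U"
  shows "T = U"
  using chain_inject[OF rows_row[OF assms(1)], of T U] assms
  by (simp add: SYT_standard tab_chain_def diagram_eq_cells)

lemma partition_boundary_inject:
  assumes "lam \<in> partitions n" "mu \<in> partitions m" "boundary (row lam) = boundary (row mu)"
  shows "lam = mu"
  using row_inject[OF assms(1,2)] boundary_inject[OF rows_row[OF assms(1)] rows_row[OF assms(2)] assms(3)]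
  by blast

lemma tab_chain_surj:
  assumes lam: "lam \<in> partitions n" and l: "valid l" "length l = n" "shape l = boundary (row lam)"
  obtains T where "T \<in> SYT lam" "tab_chain lam T = l"
proof -
  obtain mu T where T: "mu \<in> partitions n" "T \<in> SYT mu" "tab_chain mu T = l"
    using valid_partition[OF l(1,2)] .
  then have "mu = lam"
    using partition_boundary_inject[OF T(1) lam] tab_chain_valid(3)[OF T(1,2)] l(3) by simp
  then show thesis using that T by blast
qed

section \<open>Content reading words and their signs\<close>

lemma in_set_concat_map: "x \<in> set (concat (map f ys)) \<Longrightarrow> \<exists>y\<in>set ys. x \<in> set (f y)"
  by auto

lemma in_set_concat_mapI: "y \<in> set ys \<Longrightarrow> x \<in> set (f y) \<Longrightarrow> x \<in> set (concat (map f ys))"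
  by auto

lemma sorted_wrt_concat_map:
  assumes "sorted_wrt (<) (xs :: 'a :: linorder list)"
    and "\<And>x. x \<in> set xs \<Longrightarrow> sorted_wrt P (f x)"
    and "\<And>x y a b. x \<in> set xs \<Longrightarrow> y \<in> set xs \<Longrightarrow> x < y \<Longrightarrow> a \<in> set (f x) \<Longrightarrow> b \<in> set (f y) \<Longrightarrow> P a b"
  shows "sorted_wrt P (concat (map f xs))"
  using assms
proof (induction xs)
  case (Cons x xs)
  have "sorted_wrt P (concat (map f xs))"
  proof (rule Cons.IH)
    show "sorted_wrt (<) xs" using Cons.prems(1) by simp
    show "sorted_wrt P (f y)" if "y \<in> set xs" for y using Cons.prems(2) that by simp
    show "P a b" if "y \<in> set xs" "z \<in> set xs" "y < z" "a \<in> set (f y)" "b \<in> set (f z)" for y z a b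
      by (rule Cons.prems(3)[of y z]) (use that in auto)
  qed
  moreover have "P a b" if ab: "a \<in> set (f x)" "b \<in> set (concat (map f xs))" for a b
  proof -
    obtain y where "y \<in> set xs" "b \<in> set (f y)" using ab(2) by auto
    then show ?thesis using ab(1) Cons.prems(1) by (intro Cons.prems(3)[of x y]) auto
  qed
  ultimately show ?case using Cons.prems(2)[of x] by (simp add: sorted_wrt_append)
qed simp

definition precedes :: "nat \<times> nat \<Rightarrow> nat \<times> nat \<Rightarrow> bool" where
  "precedes c d \<longleftrightarrow> content c < content d \<or> content c = content d \<and> fst c < fst d"

lemma precedes_asym: "precedes c d \<Longrightarrow> \<not> precedes d c"
  by (auto simp: precedes_def)

text \<open>The comprehension of \<open>content_word\<close> with cells in place of entries, which
  separates the reading order from the filling.\<close>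

definition reading_cells :: "nat list \<Rightarrow> (nat \<times> nat) list" where
  "reading_cells lam =
     (let n = sum_list lam in
      [(i, j). c \<leftarrow> [- int n..int n], i \<leftarrow> [1..<n + 1], j \<leftarrow> [1..<n + 1],
               (i, j) \<in> diagram lam \<and> int i - int j = c])"

lemma content_word_map: "content_word lam T = map T (reading_cells lam)"
  by (simp add: content_word_def reading_cells_def Let_def map_concat o_def if_distrib[of "map T"]
      del: upt_Suc cong: if_cong)

lemma sorted_reading_cells: "sorted_wrt precedes (reading_cells lam)"
proof -
  let ?n = "sum_list lam"
  let ?f = "\<lambda>c i j. if (i, j) \<in> diagram lam \<and> int i - int j = c then [(i, j)] else []"
  let ?g = "\<lambda>c i. concat (map (?f c i) [1..<?n + 1])"
  have g: "content d = c \<and> fst d = i" if d: "d \<in> set (?g c i)" for c d i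
  proof -
    obtain j where "d \<in> set (?f c i j)" using in_set_concat_map[OF d] by blast
    then show ?thesis by (simp split: if_splits)
  qed
  let ?h = "\<lambda>c. concat (map (?g c) [1..<?n + 1])"
  have h: "content d = c" if d: "d \<in> set (?h c)" for c d
  proof -
    obtain i where "d \<in> set (?g c i)" using in_set_concat_map[OF d] by blast
    then show ?thesis using g by blast
  qed
  have sg: "sorted_wrt precedes (?g c i)" for c i
  proof (rule sorted_wrt_concat_map)
    fix j j' d e assume "j < j'" "d \<in> set (?f c i j)" "e \<in> set (?f c i j')"
    then show "precedes d e" by (simp split: if_splits)
  qed (simp_all del: upt_Suc)
  have sh: "sorted_wrt precedes (?h c)" for c
  proof (rule sorted_wrt_concat_map)
    fix i i' d e assume "i < i'" and d: "d \<in> set (?g c i)" and e: "e \<in> set (?g c i')"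
    then show "precedes d e" using g[OF d] g[OF e] unfolding precedes_def by simp
  qed (rule sorted_wrt_upt, rule sg)
  have "sorted_wrt precedes (concat (map ?h [- int ?n..int ?n]))"
  proof (rule sorted_wrt_concat_map)
    fix c c' d e assume "c < c'" and d: "d \<in> set (?h c)" and e: "e \<in> set (?h c')"
    then show "precedes d e" using h[OF d] h[OF e] unfolding precedes_def by simp
  qed (rule sorted_wrt_upto, rule sh)
  then show ?thesis unfolding reading_cells_def Let_def by simp
qed

lemma set_reading_cells:
  assumes "lam \<in> partitions n"
  shows "set (reading_cells lam) = diagram lam"
proof -
  \<comment> \<open>The comprehension visits columns and rows up to the size of the shape only. This
    loses nothing, since a cell \<open>(i, j)\<close> forces \<open>i\<close> cells in row
    \<open>1\<close> and \<open>j\<close> cells in column \<open>1\<close>.\<close>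
  have B: "1 \<le> i \<and> 1 \<le> j \<and> i \<le> sum_list lam \<and> j \<le> sum_list lam" if "(i, j) \<in> diagram lam" for i j
  proof -
    have ij: "1 \<le> i" "1 \<le> j" using that by (auto simp: diagram_def)
    have "(\<lambda>i. (i, 1)) ` {1..i} \<subseteq> diagram lam" "Pair 1 ` {1..j} \<subseteq> diagram lam"
      using that ij cells_down[OF rows_row[OF assms], of i j] unfolding diagram_eq_cells by auto
    then have "card ((\<lambda>i. (i, 1 :: nat)) ` {1..i}) \<le> sum_list lam" "card (Pair (1 :: nat) ` {1..j}) \<le> sum_list lam"
      using card_mono[OF finite_diagram] card_cells_row by metis+
    then show ?thesis using ij by (simp add: card_image inj_on_def)
  qed
  show ?thesis
  proof (intro set_eqI iffI)
    fix d assume "d \<in> set (reading_cells lam)"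
    from in_set_concat_map[OF this[unfolded reading_cells_def Let_def]] obtain c where
      "d \<in> set (concat (map (\<lambda>i. concat (map (\<lambda>j. if (i, j) \<in> diagram lam \<and> int i - int j = c
        then [(i, j)] else []) [1..<sum_list lam + 1])) [1..<sum_list lam + 1]))" by blast
    from in_set_concat_map[OF this] obtain i where
      "d \<in> set (concat (map (\<lambda>j. if (i, j) \<in> diagram lam \<and> int i - int j = c
        then [(i, j)] else []) [1..<sum_list lam + 1]))" by blast
    from in_set_concat_map[OF this] obtain j where
      "d \<in> set (if (i, j) \<in> diagram lam \<and> int i - int j = c then [(i, j)] else [])" by blast
    then show "d \<in> diagram lam" by (simp split: if_splits)
  next
    fix d assume d: "d \<in> diagram lam"
    obtain i j where ij: "d = (i, j)" by fastforce
    note b = B[of i j] d ij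
    let ?f = "\<lambda>c i j. if (i, j) \<in> diagram lam \<and> int i - int j = c then [(i, j)] else []"
    let ?n = "sum_list lam" and ?c = "int i - int j"
    have "d \<in> set (?f ?c i j)" using b by simp
    moreover have "j \<in> set [1..<?n + 1]" "i \<in> set [1..<?n + 1]" "?c \<in> set [- int ?n..int ?n]"
      using b by auto
    ultimately show "d \<in> set (reading_cells lam)" unfolding reading_cells_def Let_def
      using in_set_concat_mapI[of j _ d "?f ?c i"]
        in_set_concat_mapI[of i _ d "\<lambda>i. concat (map (?f ?c i) [1..<?n + 1])"]
        in_set_concat_mapI[of ?c _ d "\<lambda>c. concat (map (\<lambda>i. concat (map (?f c i) [1..<?n + 1])) [1..<?n + 1])"]
      by blast
  qed
qed

lemma left_of_map:
  assumes "sorted_wrt precedes cs" "inj_on T (set cs)" "c \<in> set cs" "d \<in> set cs"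
  shows "left_of (map T cs) (T c) (T d) \<longleftrightarrow> precedes c d"
proof
  assume "left_of (map T cs) (T c) (T d)"
  then obtain k l where kl: "k < l" "l < length cs" "T (cs ! k) = T c" "T (cs ! l) = T d"
    by (auto simp: left_of_def)
  then have "k < length cs" by simp
  have "cs ! k = c" by (rule inj_onD[OF assms(2) kl(3) nth_mem assms(3)]) fact
  moreover have "cs ! l = d" by (rule inj_onD[OF assms(2) kl(4) nth_mem[OF kl(2)] assms(4)])
  ultimately show "precedes c d" using sorted_wrt_nth_less[OF assms(1) kl(1,2)] by simp
next
  assume P: "precedes c d"
  obtain k l where kl: "k < length cs" "cs ! k = c" "l < length cs" "cs ! l = d"
    using assms(3,4) unfolding in_set_conv_nth by blast
  have "k < l"
  proof (rule ccontr)
    assume "\<not> k < l"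
    then consider "k = l" | "l < k" by linarith
    then have "c = d \<or> precedes d c"
      by cases (use kl sorted_wrt_nth_less[OF assms(1), of l k] in simp_all)
    then show False using P precedes_asym by blast
  qed
  then show "left_of (map T cs) (T c) (T d)" unfolding left_of_def
    using kl by (intro exI[of _ k] exI[of _ l]) simp
qed

lemma tab_chain_nth:
  assumes "lam \<in> partitions n" "1 \<le> k" "k \<le> n"
  shows "tab_chain lam T ! (n - k) = content (inv_into (diagram lam) T k)"
proof -
  have "card (diagram lam) = n" using assms(1) card_cells_row[of lam] by (simp add: partitions_def)
  then show ?thesis using chain_upto_nth[OF assms(2,3)] by (simp add: tab_chain_def chain_def)
qed

lemma left_of_content_word:
  assumes lam: "lam \<in> partitions n" and T: "T \<in> SYT lam" and k: "1 \<le> k" "k \<le> n" "1 \<le> m" "m \<le> n"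
  shows "left_of (content_word lam T) k m \<longleftrightarrow>
    precedes (inv_into (diagram lam) T k) (inv_into (diagram lam) T m)"
proof -
  have st: "standard (diagram lam) T" "card (diagram lam) = n"
    using T lam card_cells_row[of lam] by (auto simp: SYT_standard partitions_def)
  have "inj_on T (set (reading_cells lam))"
    using st(1) set_reading_cells[OF lam] by (simp add: standard_def bij_betw_def)
  from left_of_map[OF sorted_reading_cells this] show ?thesis
    using standard_inv[OF st(1)] st(2) k set_reading_cells[OF lam] unfolding content_word_map
    by metis
qed

text \<open>Guarantees that the reading order of two consecutive entries is decided by their
  contents alone, without the tie-break on a diagonal.\<close>

lemma adjacent_contents:
  assumes l: "valid l" and k: "1 \<le> k" "Suc k \<le> length l"
  shows "l ! (length l - Suc k) \<noteq> l ! (length l - k)"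
proof -
  obtain xs a b r where l': "l = xs @ a # b # r" "length r = k - 1"
  proof
    let ?d = "length l - Suc k"
    have "Suc ?d < length l" using k by auto
    then show "l = take ?d l @ l ! ?d # l ! Suc ?d # drop (Suc (Suc ?d)) l"
      by (metis Cons_nth_drop_Suc Suc_lessD id_take_nth_drop)
    show "length (drop (Suc (Suc ?d)) l) = k - 1" using k by simp
  qed
  then have "valid (a # b # r)" using l valid_appendD by blast
  then have "a \<noteq> b" by (auto simp: addable_def add_box_def)
  moreover have "length l - Suc k = length xs" "length l - k = Suc (length xs)" using l' k by auto
  ultimately show ?thesis using l' by (simp add: nth_append)
qed

lemma tableau_sig_chain_sig:
  assumes lam: "lam \<in> partitions n" and T: "T \<in> SYT lam" and i: "1 \<le> i" "i < n"
  shows "tableau_sig lam T i = chain_sig i (tab_chain lam T)"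
proof -
  have n: "sum_list lam = n" using lam by (simp add: partitions_def)
  note v = tab_chain_valid[OF lam T]
  note c = tab_chain_nth[OF lam, of i T] tab_chain_nth[OF lam, of "Suc i" T]
  have "content (inv_into (diagram lam) T (Suc i)) \<noteq> content (inv_into (diagram lam) T i)"
    using adjacent_contents[OF v(1) i(1)] v(2) c i by auto
  then show ?thesis
    using left_of_content_word[OF lam T, of i "Suc i"] i c v(2)
    by (auto simp: tableau_sig_def n chain_sig_def precedes_def)
qed

section \<open>Elementary dual equivalences on tableaux\<close>

lemma swap_update:
  assumes "distinct w" "p < length w" "r < length w" "w ! p = a" "w ! r = b"
  shows "w[p := b, r := a] = map (transpose a b) w"
proof (rule nth_equalityI)
  fix k assume "k < length (w[p := b, r := a])"
  then show "w[p := b, r := a] ! k = map (transpose a b) w ! k"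
    using assms by (auto simp: nth_list_update transpose_def nth_eq_iff_index_eq)
qed simp

text \<open>Switching the outermost two of three positions amounts to transposing the two values
  found there. The letters \<open>a\<close> and \<open>b\<close> are at the ends, and
  \<open>i = a \<or> i = b\<close> is the condition under which the dual equivalence is
  defined.\<close>

lemma elem_dual_equiv_swap:
  assumes w: "distinct w" "{i - 1, i, i + 1} \<subseteq> set w" and i: "1 < i"
    and ends: "\<And>k. k \<in> {i - 1, i, i + 1} \<Longrightarrow> k \<noteq> a \<Longrightarrow> k \<noteq> b \<Longrightarrow> left_of w a k \<and> left_of w k b \<or> left_of w b k \<and> left_of w k a"
    and ab: "a \<in> {i - 1, i, i + 1}" "b \<in> {i - 1, i, i + 1}" "a \<noteq> b" "i = a \<or> i = b"
  shows "elem_dual_equiv i w (map (transpose a b) w)"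
proof -
  define q where "q k = (THE p. p < length w \<and> w ! p = k)" for k
  have q: "q k < length w" "w ! q k = k" if "k \<in> set w" for k
  proof -
    have "\<exists>!p. p < length w \<and> w ! p = k" by (rule distinct_Ex1[OF w(1) that])
    then have "q k < length w \<and> w ! q k = k" unfolding q_def by (rule theI')
    then show "q k < length w" "w ! q k = k" by auto
  qed
  have q_eq: "q (w ! p) = p" if "p < length w" for p
    using q[OF nth_mem[OF that]] that nth_eq_iff_index_eq[OF w(1)] by blast
  have lo: "left_of w k m \<longleftrightarrow> q k < q m" if "k \<in> set w" "m \<in> set w" for k m
    using q[OF that(1)] q[OF that(2)] q_eq unfolding left_of_def by (metis less_trans)
  define P where "P = {k. k < length w \<and> w ! k \<in> {i - 1, i, i + 1}}"
  have P: "P = q ` {i - 1, i, i + 1}"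
  proof (intro set_eqI iffI)
    fix p assume "p \<in> P"
    then have "p = q (w ! p)" "w ! p \<in> {i - 1, i, i + 1}" using q_eq unfolding P_def by auto
    then show "p \<in> q ` {i - 1, i, i + 1}" by (rule image_eqI)
  next
    fix p assume "p \<in> q ` {i - 1, i, i + 1}"
    then obtain k where "p = q k" "k \<in> {i - 1, i, i + 1}" by blast
    then show "p \<in> P" using q[of k] w(2) unfolding P_def by auto
  qed
  have abw: "a \<in> set w" "b \<in> set w" using ab w by auto
  have btw: "q a < q k \<and> q k < q b \<or> q b < q k \<and> q k < q a" if "k \<in> {i - 1, i, i + 1}" "k \<noteq> a" "k \<noteq> b" for k
    using ends[OF that] lo abw w(2) that(1) by blast
  obtain e where e: "e \<in> {i - 1, i, i + 1}" "e \<noteq> a" "e \<noteq> b" "{i - 1, i, i + 1} = {a, b, e}"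
  proof -
    consider "a = i" "b = i - 1" | "a = i" "b = i + 1" | "b = i" "a = i - 1" | "b = i" "a = i + 1"
      using ab unfolding insert_iff empty_iff by metis
    then show thesis
    proof cases
      case 1
      show thesis by (rule that[of "i + 1"]) (use 1 i in auto)
    next
      case 2
      show thesis by (rule that[of "i - 1"]) (use 2 i in auto)
    next
      case 3
      show thesis by (rule that[of "i + 1"]) (use 3 i in auto)
    next
      case 4
      show thesis by (rule that[of "i - 1"]) (use 4 i in auto)
    qed
  qed
  have Pe: "P = {q a, q b, q e}" unfolding P e(4) by simp
  have "Min P = min (q a) (q b)" "Max P = max (q a) (q b)"
    using btw[OF e(1-3)] unfolding Pe by auto
  then have "w[Min P := w ! Max P, Max P := w ! Min P] = map (transpose a b) w"
    using swap_update[OF w(1) q(1)[OF abw(1)] q(1)[OF abw(2)]]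
      swap_update[OF w(1) q(1)[OF abw(2)] q(1)[OF abw(1)]] q(2)[OF abw(1)] q(2)[OF abw(2)]
    by (auto simp: min_def max_def transpose_commute)
  moreover have "\<not> (left_of w (i - 1) i \<and> left_of w i (i + 1))" "\<not> (left_of w (i + 1) i \<and> left_of w i (i - 1))"
    using lo[of "i - 1" i] lo[of i "i + 1"] lo[of "i + 1" i] lo[of i "i - 1"] w(2) btw[OF e(1-3)] ab e(1-3) i
    by auto
  ultimately show ?thesis unfolding elem_dual_equiv_def Let_def P_def[symmetric] by simp
qed

text \<open>Neighbouring cells have contents that differ by one, so \<open>m\<close> and
  \<open>m + 1\<close> are not in neighbouring cells, and transposing them reverses no inequality
  between neighbours.\<close>

lemma SYT_swap:
  assumes lam: "lam \<in> partitions n" and T: "T \<in> SYT lam" and m: "1 \<le> m" "m < n"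
    and far: "content (inv_into (diagram lam) T m) \<noteq> content (inv_into (diagram lam) T (Suc m)) + 1"
      "content (inv_into (diagram lam) T m) \<noteq> content (inv_into (diagram lam) T (Suc m)) - 1"
  defines "U \<equiv> restrict (transpose m (Suc m) \<circ> T) (diagram lam)"
  shows "U \<in> SYT lam"
    and "1 \<le> k \<Longrightarrow> k \<le> n \<Longrightarrow>
      inv_into (diagram lam) U k = inv_into (diagram lam) T (transpose m (Suc m) k)"
proof -
  let ?D = "diagram lam" and ?s = "transpose m (Suc m)"
  have st: "standard ?D T" and card: "card ?D = n"
    using T lam card_cells_row[of lam] by (auto simp: SYT_standard partitions_def)
  have bij: "bij_betw T ?D {1..n}" using st card by (simp add: standard_def)
  have s: "bij_betw ?s {1..n} {1..n}"
  proof (rule bij_betw_byWitness[of _ ?s])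
    show "?s ` {1..n} \<subseteq> {1..n}" using m by (auto simp: transpose_def)
    then show "?s ` {1..n} \<subseteq> {1..n}" .
  qed auto
  have "bij_betw (?s \<circ> T) ?D {1..n}" using bij_betw_trans[OF bij s] .
  then have bijU: "bij_betw U ?D {1..n}" unfolding U_def by (subst bij_betw_restrict_eq) 
  have keep: "?s (T c) < ?s (T d)" if "c \<in> ?D" "d \<in> ?D" "T c < T d"
    "content c = content d + 1 \<or> content c = content d - 1" for c d
  proof -
    have "\<not> (T c = m \<and> T d = Suc m)"
      using far standard_inv_eq[OF st that(1)] standard_inv_eq[OF st that(2)] that(4) by auto
    then show ?thesis using that(3) by (auto simp: transpose_def)
  qed
  have "standard ?D U" unfolding standard_def
  proof (intro conjI allI impI)
    show "U \<in> extensional ?D" by (simp add: U_def)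
    show "bij_betw U ?D {1..card ?D}" using bijU card by simp
    fix i j
    show "U (i, j) < U (i + 1, j)" if "(i, j) \<in> ?D \<and> (i + 1, j) \<in> ?D"
      using that st keep[of "(i, j)" "(i + 1, j)"] by (auto simp: U_def standard_def)
    show "U (i, j) < U (i, j + 1)" if "(i, j) \<in> ?D \<and> (i, j + 1) \<in> ?D"
      using that st keep[of "(i, j)" "(i, j + 1)"] by (auto simp: U_def standard_def)
  qed
  then show "U \<in> SYT lam" by (simp add: SYT_standard)
  assume k: "1 \<le> k" "k \<le> n"
  then have sk: "1 \<le> ?s k" "?s k \<le> card ?D" using m card by (auto simp: transpose_def)
  have "U (inv_into ?D T (?s k)) = k"
    using standard_inv[OF st sk] by (simp add: U_def)
  then show "inv_into ?D U k = inv_into ?D T (?s k)"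
    using standard_inv_eq[OF \<open>standard ?D U\<close> standard_inv(1)[OF st sk]] by simp
qed

lemma dual_update:
  assumes "l = xs @ z # y # x # r" "i = length r + 2"
  shows "dual i l = (if between z y x then l[Suc (length xs) := x, Suc (Suc (length xs)) := y]
    else l[length xs := y, Suc (length xs) := z])"
  using assms by (simp add: dual_append list_update_append)

lemma sorted_wrt_irrefl_distinct: "sorted_wrt P xs \<Longrightarrow> (\<And>x. \<not> P x x) \<Longrightarrow> distinct xs"
  by (induction xs) auto

lemma reading_distinct:
  assumes "lam \<in> partitions n" "T \<in> SYT lam"
  shows "distinct (content_word lam T)" "set (content_word lam T) = {1..n}"
proof -
  have st: "standard (diagram lam) T" and card: "card (diagram lam) = n"
    using assms card_cells_row[of lam] by (auto simp: SYT_standard partitions_def)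
  have bij: "bij_betw T (diagram lam) {1..n}" using st card by (simp add: standard_def)
  have "distinct (reading_cells lam)"
    by (rule sorted_wrt_irrefl_distinct[OF sorted_reading_cells]) (simp add: precedes_def)
  then show "distinct (content_word lam T)" "set (content_word lam T) = {1..n}"
    using bij set_reading_cells[OF assms(1)]
    by (simp_all add: content_word_map distinct_map bij_betw_def)
qed

context
  fixes lam n T i
  assumes lam: "lam \<in> partitions n" and T: "T \<in> SYT lam" and i: "1 < i" "i < n"
begin

abbreviation "entry_content k \<equiv> content (inv_into (diagram lam) T k)"

lemma tab_chain_split:
  obtains xs r where "tab_chain lam T = xs @ entry_content (i + 1) # entry_content i # entry_content (i - 1) # r"
    "length xs = n - (i + 1)" "i = length r + 2"
proof -
  let ?l = "tab_chain lam T" and ?d = "n - (i + 1)"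
  have len: "length ?l = n" using tab_chain_valid[OF lam T] by simp
  have nth: "?l ! ?d = entry_content (i + 1)" "?l ! Suc ?d = entry_content i"
    "?l ! Suc (Suc ?d) = entry_content (i - 1)"
  proof -
    have "Suc ?d = n - i" "Suc (Suc ?d) = n - (i - 1)" using i by auto
    then show "?l ! ?d = entry_content (i + 1)" "?l ! Suc ?d = entry_content i"
      "?l ! Suc (Suc ?d) = entry_content (i - 1)"
      using tab_chain_nth[OF lam, of "i + 1" T] tab_chain_nth[OF lam, of i T]
        tab_chain_nth[OF lam, of "i - 1" T] i by auto
  qed
  have drop: "drop ?d ?l = ?l ! ?d # drop (Suc ?d) ?l"
    "drop (Suc ?d) ?l = ?l ! Suc ?d # drop (Suc (Suc ?d)) ?l"
    "drop (Suc (Suc ?d)) ?l = ?l ! Suc (Suc ?d) # drop (Suc (Suc (Suc ?d))) ?l"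
    using i len by (simp_all add: Cons_nth_drop_Suc)
  have "?l = take ?d ?l @ drop ?d ?l" by simp
  also have "\<dots> = take ?d ?l @ entry_content (i + 1) # entry_content i # entry_content (i - 1) #
      drop (Suc (Suc (Suc ?d))) ?l"
    by (simp only: drop nth)
  finally show thesis by (rule that) (use len i in auto)
qed

lemma entry_contents_distinct:
  "entry_content i \<noteq> entry_content (i + 1)" "entry_content (i - 1) \<noteq> entry_content i"
  "entry_content (i - 1) \<noteq> entry_content (i + 1)"
proof -
  obtain xs r where l: "tab_chain lam T = xs @ entry_content (i + 1) # entry_content i # entry_content (i - 1) # r"
    by (rule tab_chain_split)
  then have "valid (entry_content (i + 1) # entry_content i # entry_content (i - 1) # r)"
    using tab_chain_valid(1)[OF lam T] valid_appendD by metis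
  from valid_top_distinct[OF this] show
    "entry_content i \<noteq> entry_content (i + 1)" "entry_content (i - 1) \<noteq> entry_content i"
    "entry_content (i - 1) \<noteq> entry_content (i + 1)" by auto
qed

lemma left_of_entries:
  assumes "k \<in> {i - 1, i, i + 1}" "m \<in> {i - 1, i, i + 1}"
  shows "left_of (content_word lam T) k m \<longleftrightarrow> entry_content k < entry_content m"
proof -
  have "1 \<le> k" "k \<le> n" "1 \<le> m" "m \<le> n" using assms i by auto
  then have "left_of (content_word lam T) k m \<longleftrightarrow>
      precedes (inv_into (diagram lam) T k) (inv_into (diagram lam) T m)"
    by (rule left_of_content_word[OF lam T])
  then show ?thesis
    using assms entry_contents_distinct by (auto simp: precedes_def)
qed

lemma alternating_entries:
  "alternating i (tab_chain lam T) \<longleftrightarrow> (entry_content (i - 1) < entry_content i \<longleftrightarrow> entry_content (i + 1) < entry_content i)"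
proof -
  obtain xs r where l: "tab_chain lam T = xs @ entry_content (i + 1) # entry_content i # entry_content (i - 1) # r"
    and r: "i = length r + 2"
    by (rule tab_chain_split)
  show ?thesis using entry_contents_distinct(1) unfolding l
    by (subst alternating_append, simp add: r, subst alternating_top[OF r]) auto
qed

text \<open>On tableaux, \<open>dual\<close> transposes two consecutive entries \<open>m\<close> and
  \<open>m + 1\<close>. The tableau obtained in this way has the chain of \<open>U\<close>, so it is
  \<open>U\<close>, and its word is that of \<open>T\<close> with these two letters
  transposed.\<close>

lemma dual_elem_dual_equiv:
  assumes U: "U \<in> SYT lam" and alt: "alternating i (tab_chain lam T)"
    and eq: "tab_chain lam U = dual i (tab_chain lam T)"
  shows "elem_dual_equiv i (content_word lam T) (content_word lam U)"
proof -
  let ?x = "entry_content (i - 1)" and ?y = "entry_content i" and ?z = "entry_content (i + 1)"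
  let ?w = "content_word lam T"
  obtain xs r where l: "tab_chain lam T = xs @ ?z # ?y # ?x # r"
    and xs: "length xs = n - (i + 1)" and r: "i = length r + 2"
    by (rule tab_chain_split)
  have len: "length (tab_chain lam T) = n" "length (tab_chain lam U) = n"
    using tab_chain_valid lam T U by auto
  have w: "distinct ?w" "{i - 1, i, i + 1} \<subseteq> set ?w"
    using reading_distinct[OF lam T] i by auto
  define m where "m = (if between ?z ?y ?x then i - 1 else i)"
  have m: "1 \<le> m" "m < n" using i by (auto simp: m_def)
  have m_cases: "m = i - 1 \<and> between ?z ?y ?x \<or> m = i \<and> between ?x ?y ?z"
    using alternating_entries alt entry_contents_distinct by (auto simp: m_def between_def)
  have far: "entry_content m \<noteq> entry_content (Suc m) + 1" "entry_content m \<noteq> entry_content (Suc m) - 1"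
    using m_cases between_far[of ?z ?y ?x] between_far[of ?x ?y ?z] i by auto
  let ?s = "transpose m (Suc m)"
  let ?U = "restrict (?s \<circ> T) (diagram lam)"
  note U' = SYT_swap[OF lam T m far]
  have "tab_chain lam ?U = tab_chain lam U"
  proof (rule nth_equalityI)
    fix p assume "p < length (tab_chain lam ?U)"
    then have p: "p < n" using tab_chain_valid(2)[OF lam U'(1)] by simp
    define k where "k = n - p"
    have k: "1 \<le> k" "k \<le> n" "p = n - k" using p by (auto simp: k_def)
    have sk: "1 \<le> ?s k" "?s k \<le> n" using k m by (auto simp: transpose_def)
    have "tab_chain lam ?U ! p = tab_chain lam T ! (n - ?s k)"
      using tab_chain_nth[OF lam k(1,2), of ?U] tab_chain_nth[OF lam sk, of T] U'(2)[OF k(1,2)] k(3) by simp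
    moreover have "tab_chain lam U ! p = tab_chain lam T ! (n - ?s k)"
    proof -
      \<comment> \<open>The indices in the chain of the entries \<open>i + 1\<close>,
        \<open>i\<close> and \<open>i - 1\<close>.\<close>
      define j0 j1 j2 where j: "j0 = n - (i + 1)" "j1 = n - i" "j2 = n - (i - 1)"
      have nth: "tab_chain lam T ! j0 = ?z" "tab_chain lam T ! j1 = ?y" "tab_chain lam T ! j2 = ?x"
        using tab_chain_nth[OF lam, of "i + 1" T] tab_chain_nth[OF lam, of i T]
          tab_chain_nth[OF lam, of "i - 1" T] i by (auto simp: j)
      have idx: "length xs = j0" "Suc j0 = j1" "Suc j1 = j2" using xs i by (auto simp: j)
      have ne: "j1 \<noteq> j2" "j0 \<noteq> j1" using i by (auto simp: j)
      have lt: "j0 < n" "j1 < n" "j2 < n" using i by (auto simp: j)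
      have p_eq: "j0 = p \<longleftrightarrow> k = i + 1" "j1 = p \<longleftrightarrow> k = i" "j2 = p \<longleftrightarrow> k = i - 1"
        using k i by (auto simp: j)
      from m_cases show ?thesis
      proof (elim disjE conjE)
        assume m: "m = i - 1" and bt: "between ?z ?y ?x"
        have "n - ?s k = (if j1 = p then j2 else if j2 = p then j1 else p)"
          unfolding p_eq using m i k by (auto simp: transpose_def j)
        then show ?thesis
          unfolding eq dual_update[OF l r] idx using bt ne
          by (simp only: if_True nth_list_update length_list_update len lt nth split: if_split) auto
      next
        assume m: "m = i" and bt: "between ?x ?y ?z"
        have "n - ?s k = (if j1 = p then j0 else if j0 = p then j1 else p)"
          unfolding p_eq using m i k by (auto simp: transpose_def j)
        moreover have "\<not> between ?z ?y ?x" using bt by (auto simp: between_def)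
        ultimately show ?thesis
          unfolding eq dual_update[OF l r] idx using ne
          by (simp only: if_False nth_list_update length_list_update len lt nth split: if_split) auto
      qed
    qed
    ultimately show "tab_chain lam ?U ! p = tab_chain lam U ! p" by simp
  qed (use tab_chain_valid(2)[OF lam U'(1)] len in simp)
  then have "?U = U" using tab_chain_inject[OF lam U'(1) U] by simp
  then have "content_word lam U = map ?s ?w"
    using set_reading_cells[OF lam] by (auto simp: content_word_map)
  moreover have "elem_dual_equiv i ?w (map ?s ?w)"
  proof (rule elem_dual_equiv_swap[OF w i(1)])
    show "m \<in> {i - 1, i, i + 1}" "Suc m \<in> {i - 1, i, i + 1}" "m \<noteq> Suc m" "i = m \<or> i = Suc m"
      using m_cases i by auto
    fix k assume "k \<in> {i - 1, i, i + 1}" "k \<noteq> m" "k \<noteq> Suc m"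
    then have "m = i - 1 \<and> k = i + 1 \<and> between ?z ?y ?x \<or> m = i \<and> k = i - 1 \<and> between ?x ?y ?z"
      using m_cases i by auto
    then show "left_of ?w m k \<and> left_of ?w k (Suc m) \<or> left_of ?w (Suc m) k \<and> left_of ?w k m"
      using left_of_entries i by (auto simp: between_def)
  qed
  ultimately show ?thesis by simp
qed

text \<open>Reduced to the other direction: \<open>dual\<close> preserves the shape, so some tableau
  \<open>U'\<close> has the dual chain, and since \<open>elem_dual_equiv\<close> determines the
  second word, \<open>U'\<close> has the word of \<open>U\<close>.\<close>

lemma elem_dual_equiv_dual:
  assumes U: "U \<in> SYT lam" and e: "elem_dual_equiv i (content_word lam T) (content_word lam U)"
  shows "alternating i (tab_chain lam T)" "tab_chain lam U = dual i (tab_chain lam T)"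
proof -
  have nb: "\<not> (left_of (content_word lam T) (i - 1) i \<and> left_of (content_word lam T) i (i + 1))"
    "\<not> (left_of (content_word lam T) (i + 1) i \<and> left_of (content_word lam T) i (i - 1))"
    using e unfolding elem_dual_equiv_def by auto
  have "entry_content (i - 1) < entry_content i \<longleftrightarrow> entry_content (i + 1) < entry_content i"
    using nb left_of_entries entry_contents_distinct by auto
  then show alt: "alternating i (tab_chain lam T)" using alternating_entries by simp
  note v = tab_chain_valid[OF lam T]
  have "valid (dual i (tab_chain lam T)) \<and> shape (dual i (tab_chain lam T)) = boundary (row lam)"
    using dual_valid_shape[OF v(1) _ _ alt] v i by simp
  then obtain U' where U': "U' \<in> SYT lam" "tab_chain lam U' = dual i (tab_chain lam T)"
    using tab_chain_surj[OF lam, of "dual i (tab_chain lam T)"] v(2) by auto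
  have "elem_dual_equiv i (content_word lam T) (content_word lam U')"
    by (rule dual_elem_dual_equiv[OF U'(1) alt U'(2)])
  then have "content_word lam U = content_word lam U'"
    using e unfolding elem_dual_equiv_def Let_def by simp
  then have "\<forall>c\<in>diagram lam. U c = U' c"
    using set_reading_cells[OF lam] by (simp add: content_word_map)
  then have "U = U'" using U U'(1) unfolding SYT_standard standard_def
    by (auto intro: extensionalityI)
  then show "tab_chain lam U = dual i (tab_chain lam T)" using U'(2) by simp
qed

end

text \<open>Edges are unordered while \<open>elem_dual_equiv\<close> has a direction;
  \<open>dual\<close> being an involution settles the reversed case.\<close>

lemma standard_graph_edge:
  assumes lam: "lam \<in> partitions n" and i: "1 < i" "i < n"
    and TU: "{T, U} \<in> edges (standard_graph lam) i"
  shows "T \<in> SYT lam" "U \<in> SYT lam" "alternating i (tab_chain lam T)"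
    "tab_chain lam U = dual i (tab_chain lam T)"
proof -
  have "\<exists>T' U'. {T, U} = {T', U'} \<and> T' \<in> SYT lam \<and> U' \<in> SYT lam \<and>
      elem_dual_equiv i (content_word lam T') (content_word lam U')"
    using TU unfolding standard_graph_def by auto
  then obtain T' U' where e: "{T, U} = {T', U'}" "T' \<in> SYT lam" "U' \<in> SYT lam"
      "elem_dual_equiv i (content_word lam T') (content_word lam U')" by blast
  note d = elem_dual_equiv_dual[OF lam e(2) i e(3,4)]
  note v = tab_chain_valid[OF lam e(2)]
  note dd = dual_dual[OF v(1) _ _ d(1)]
  have "T = T' \<and> U = U' \<or> T = U' \<and> U = T'" using e(1) by (auto simp: doubleton_eq_iff)
  then show "T \<in> SYT lam" "U \<in> SYT lam" "alternating i (tab_chain lam T)"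
    "tab_chain lam U = dual i (tab_chain lam T)"
    using e(2,3) d dd v(2) i by auto
qed

section \<open>Components are standard graphs\<close>

context deg
begin

text \<open>The isomorphism matches vertices and tableaux that have the same chain. It is onto by
  \<open>labelling_lift\<close> and one-to-one by the injectivity of the labelling.\<close>

lemma labelling_component_iso:
  assumes L: "labelling n n g" and v: "v \<in> verts G" and lam: "lam \<in> partitions n"
    and sh: "shape (g v) = boundary (row lam)"
  shows "scgraph_isomorphic n (induced G {w. conn n v w}) (standard_graph lam)"
proof -
  let ?C = "{w. conn n v w}"
  have sum: "sum_list lam = n" using lam by (simp add: partitions_def)
  have CV: "w \<in> verts G" if "w \<in> ?C" for w using that conn_verts by auto
  have gC: "valid (g w)" "length (g w) = n" "shape (g w) = boundary (row lam)" if "w \<in> ?C" for w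
    using labelling_vertD[OF L CV[OF that]] labelling_shape[OF L, of v w] that sh by auto
  have ex: "\<exists>T. T \<in> SYT lam \<and> tab_chain lam T = g w" if "w \<in> ?C" for w
    using tab_chain_surj[OF lam gC[OF that]] by blast
  define f where "f w = (SOME T. T \<in> SYT lam \<and> tab_chain lam T = g w)" for w
  have f: "f w \<in> SYT lam" "tab_chain lam (f w) = g w" if "w \<in> ?C" for w
    using someI_ex[OF ex[OF that]] by (auto simp: f_def)
  have "inj_on f ?C"
  proof (rule inj_onI)
    fix u w assume uw: "u \<in> ?C" "w \<in> ?C" "f u = f w"
    then have "g u = g w" using f(2)[OF uw(1)] f(2)[OF uw(2)] by simp
    moreover have "conn n u w"
      by (rule conn_trans[of n u v w]) (use uw(1,2) conn_sym in auto)
    ultimately show "u = w" by (rule labelling_injD[OF L, rotated])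
  qed
  moreover have "f ` ?C = SYT lam"
  proof (intro set_eqI iffI)
    fix T assume T: "T \<in> SYT lam"
    note t = tab_chain_valid[OF lam T]
    obtain w where w: "conn n v w" "g w = tab_chain lam T"
      using labelling_lift[OF L _ v, of "[]" "g v" n "tab_chain lam T"] t sh
        labelling_vertD(2)[OF L v] by auto
    then have "f w = T" using tab_chain_inject[OF lam f(1)[of w] T] f(2)[of w] by simp
    then show "T \<in> f ` ?C" using w by blast
  qed (use f in auto)
  ultimately have bij: "bij_betw f ?C (SYT lam)" by (simp add: bij_betw_def)
  have sg: "tableau_sig lam (f w) = sig G w" if w: "w \<in> ?C" for w
  proof (rule extensionalityI[of _ "{1..<n}"])
    show "tableau_sig lam (f w) \<in> extensional {1..<n}" by (simp add: tableau_sig_def sum)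
    show "sig G w \<in> extensional {1..<n}"
      using axioms(1) CV[OF w] unfolding signed_colored_graph_def by (auto simp: PiE_def)
    fix i assume "i \<in> {1..<n}"
    then show "tableau_sig lam (f w) i = sig G w i"
      using tableau_sig_chain_sig[OF lam f(1)[OF w]] f(2)[OF w] labelling_vertD(3)[OF L CV[OF w]] by simp
  qed
  have ed: "f ` e \<in> edges (standard_graph lam) i" if i: "1 < i" "i < n" and e: "e \<in> edges G i" "e \<subseteq> ?C" for i e
  proof -
    obtain a b where ab: "e = {a, b}"
      using e(1) i axioms(1) unfolding signed_colored_graph_def by blast
    have C: "a \<in> ?C" "b \<in> ?C" and E: "{a, b} \<in> edges G i" using e ab by auto
    have "alternating i (g a)" using labelling_alternating[OF L CV[OF C(1)]] i E by auto
    moreover have "g b = dual i (g a)" using labelling_edgeD[OF L E] i by simp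
    ultimately have "elem_dual_equiv i (content_word lam (f a)) (content_word lam (f b))"
      using dual_elem_dual_equiv[OF lam f(1)[OF C(1)] i f(1)[OF C(2)]] f(2)[OF C(1)] f(2)[OF C(2)] by simp
    then show ?thesis using f(1)[OF C(1)] f(1)[OF C(2)] i unfolding ab standard_graph_def sum
      by auto
  qed
  have "scgraph_iso n (induced G ?C) (standard_graph lam) f"
    unfolding scgraph_iso_def
    using bij sg ed by (simp add: induced_def standard_graph_def)
  then show ?thesis unfolding scgraph_isomorphic_def by blast
qed

text \<open>Makes the partition of a component unique. Whatever the isomorphism \<open>f\<close>,
  the chains \<open>g w\<close> and \<open>tab_chain lam (f w)\<close> are bisimilar, hence equal by
  rigidity.\<close>

lemma component_iso_shape:
  assumes L: "labelling n n g" and v: "v \<in> verts G" and lam: "lam \<in> partitions n"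
    and iso: "scgraph_isomorphic n (induced G {w. conn n v w}) (standard_graph lam)"
  shows "shape (g v) = boundary (row lam)"
proof -
  let ?C = "{w. conn n v w}"
  have CV: "w \<in> verts G" if "w \<in> ?C" for w using that conn_verts by auto
  obtain f where f: "scgraph_iso n (induced G ?C) (standard_graph lam) f"
    using iso unfolding scgraph_isomorphic_def by blast
  have fS: "f w \<in> SYT lam" if "w \<in> ?C" for w
    using f that unfolding scgraph_iso_def induced_def standard_graph_def by (auto dest: bij_betwE)
  have fs: "tableau_sig lam (f w) = sig G w" if "w \<in> ?C" for w
    using f that unfolding scgraph_iso_def induced_def standard_graph_def by simp
  have fe: "f ` e \<in> edges (standard_graph lam) i" if "1 < i" "i < n" "e \<in> edges G i" "e \<subseteq> ?C" for i e
    using f that unfolding scgraph_iso_def induced_def by simp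
  have vC: "v \<in> ?C" using v conn_refl by simp
  have "g v = tab_chain lam (f v)"
  proof (rule chains_rigid[where n = n and R = "\<lambda>l l'. \<exists>w\<in>?C. l = g w \<and> l' = tab_chain lam (f w)"])
    fix l l' assume "\<exists>w\<in>?C. l = g w \<and> l' = tab_chain lam (f w)"
    then obtain w where w: "w \<in> ?C" "l = g w" "l' = tab_chain lam (f w)" by blast
    show "valid l \<and> valid l' \<and> length l = n \<and> length l' = n"
      using w labelling_vertD[OF L CV[OF w(1)]] tab_chain_valid[OF lam fS[OF w(1)]] by simp
    fix i
    show "chain_sig i l = chain_sig i l'" if "1 \<le> i" "i < n"
      using labelling_vertD(3)[OF L CV[OF w(1)] that] tableau_sig_chain_sig[OF lam fS[OF w(1)] that]
        fs[OF w(1)] w(2,3) by simp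
    assume i: "2 \<le> i" "i < n" and alt: "alternating i l"
    have i1: "1 < i" using i by simp
    obtain u where u: "{w, u} \<in> edges G i" "g u = dual i (g w)"
      using labelling_neighbour[OF L CV[OF w(1)] i1 i(2,2,2)] alt w(2) by blast
    have uC: "u \<in> ?C" using conn_trans conn_edge[OF u(1) i1 i(2) order_refl] w(1) by blast
    have "{f w, f u} \<in> edges (standard_graph lam) i" using fe[OF i1 i(2) u(1)] w(1) uC by simp
    from standard_graph_edge(4)[OF lam i1 i(2) this]
    show "\<exists>w\<in>?C. dual i l = g w \<and> dual i l' = tab_chain lam (f w)"
      using u(2) uC w(2,3) by auto
  qed (use vC in blast)
  then show ?thesis using tab_chain_valid(3)[OF lam fS[OF vC]] by simp
qed

end

section \<open>Schur functions and quasisymmetric functions\<close>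

lemma rank_bij:
  fixes D :: "'c set"
  assumes fin: "finite D"
    and trans: "\<And>c d e. c \<in> D \<Longrightarrow> d \<in> D \<Longrightarrow> e \<in> D \<Longrightarrow> R c d \<Longrightarrow> R d e \<Longrightarrow> R c e"
    and irrefl: "\<And>c. \<not> R c c"
    and total: "\<And>c d. c \<in> D \<Longrightarrow> d \<in> D \<Longrightarrow> c \<noteq> d \<Longrightarrow> R c d \<or> R d c"
  defines "U \<equiv> \<lambda>c. Suc (card {d \<in> D. R d c})"
  shows "bij_betw U D {1..card D}"
    and "c \<in> D \<Longrightarrow> d \<in> D \<Longrightarrow> U c < U d \<longleftrightarrow> R c d"
proof -
  have less: "U c < U d" if "c \<in> D" "d \<in> D" "R c d" for c d
  proof -
    have "{e \<in> D. R e c} \<subset> {e \<in> D. R e d}" using that trans irrefl by blast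
    then show ?thesis unfolding U_def using fin by (simp add: psubset_card_mono)
  qed
  show iff: "U c < U d \<longleftrightarrow> R c d" if "c \<in> D" "d \<in> D" for c d
    using less[of c d] less[of d c] total[of c d] that by (metis less_asym less_irrefl)
  have inj: "inj_on U D" using less total by (metis inj_onI less_irrefl)
  have "U ` D \<subseteq> {1..card D}"
  proof
    fix k assume "k \<in> U ` D"
    then obtain c where c: "c \<in> D" "k = U c" by blast
    have "{d \<in> D. R d c} \<subset> D" using c irrefl by blast
    then have "card {d \<in> D. R d c} < card D" using fin by (simp add: psubset_card_mono)
    then show "k \<in> {1..card D}" by (simp add: c(2) U_def)
  qed
  then have "U ` D = {1..card D}"
    by (intro card_subset_eq) (simp_all add: card_image[OF inj])
  then show "bij_betw U D {1..card D}" using inj by (simp add: bij_betw_def)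
qed

text \<open>A numbering can be read off from the order that it induces; \<open>fill_inj\<close>
  recovers the tableau in this way.\<close>

lemma bij_betw_initial_card:
  assumes bij: "bij_betw U D {1..n}" and c: "c \<in> D"
  shows "card {d \<in> D. U d < (U c :: nat)} = U c - 1"
proof -
  have "U c \<in> {1..n}" using bij_betwE[OF bij] c by blast
  then have im: "U ` {d \<in> D. U d < U c} = {1..<U c}"
    using bij_betw_imp_surj_on[OF bij] by (auto simp: image_iff set_eq_iff)
      (metis atLeastAtMost_iff imageE le_trans less_imp_le)
  have "inj_on U {d \<in> D. U d < U c}"
    by (rule inj_on_subset[OF bij_betw_imp_inj_on[OF bij]]) auto
  then show ?thesis using card_image im by fastforce
qed

lemma increasing_interval:
  fixes f :: "nat \<Rightarrow> int"
  assumes "a < b" "\<And>j. a \<le> j \<Longrightarrow> j < b \<Longrightarrow> f j < f (Suc j)"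
  shows "f a < f b"
  using assms
proof (induction b)
  case (Suc b)
  show ?case
  proof (cases "a = b")
    case False
    then have "f a < f b" using Suc by simp
    also have "f b < f (Suc b)" using Suc.prems by simp
    finally show ?thesis .
  qed (use Suc.prems in simp)
qed simp

section \<open>Schur functions as sums over standard tableaux, by standardization\<close>

context
  fixes lam n
  assumes lam: "lam \<in> partitions n"
begin

abbreviation "Dg \<equiv> diagram lam"

lemma SYT_facts:
  assumes "U \<in> SYT lam"
  shows "standard Dg U" "bij_betw U Dg {1..n}" "card Dg = n"
  using assms lam card_cells_row[of lam] by (auto simp: SYT_standard standard_def partitions_def)

text \<open>The index words that the coefficient of the fundamental quasisymmetric function of
  \<open>U\<close> at \<open>m\<close> counts.\<close>

definition fillings :: "nat multiset \<Rightarrow> tableau \<Rightarrow> nat list set" where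
  "fillings m U = {xs. length xs = n \<and> sorted xs \<and>
     (\<forall>j. 1 \<le> j \<and> j < n \<and> xs ! (j - 1) = xs ! j \<longrightarrow> tableau_sig lam U j = 1) \<and> mset xs = m}"

lemma tableau_sig_content:
  assumes U: "U \<in> SYT lam" and j: "1 \<le> j" "j < n"
  shows "tableau_sig lam U j = 1 \<longleftrightarrow> content (inv_into Dg U j) < content (inv_into Dg U (Suc j))"
proof -
  have v: "length (tab_chain lam U) = n" using tab_chain_valid[OF lam U] by simp
  have "tab_chain lam U ! (n - j) = content (inv_into Dg U j)"
    "tab_chain lam U ! (n - Suc j) = content (inv_into Dg U (Suc j))"
    using tab_chain_nth[OF lam, of j U] tab_chain_nth[OF lam, of "Suc j" U] j by auto
  then show ?thesis using tableau_sig_chain_sig[OF lam U j] v by (simp add: chain_sig_def)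
qed

text \<open>All letters between two equal ones are equal too, so the signs in between are all
  \<open>1\<close> and the contents of the entries increase throughout. Thus \<open>U\<close>
  numbers the cells by letter first and by content second.\<close>

lemma fillings_order:
  assumes U: "U \<in> SYT lam" and xs: "xs \<in> fillings m U" and c: "c \<in> Dg" "d \<in> Dg" "U c < U d"
  shows "xs ! (U c - 1) < xs ! (U d - 1) \<or> xs ! (U c - 1) = xs ! (U d - 1) \<and> content c < content d"
proof -
  note st = SYT_facts[OF U]
  have r: "1 \<le> U c" "U c \<le> n" "1 \<le> U d" "U d \<le> n"
    using standard_range[OF st(1)] c st(3) by auto
  have len: "length xs = n" and sorted: "sorted xs"
    and desc: "\<And>j. 1 \<le> j \<Longrightarrow> j < n \<Longrightarrow> xs ! (j - 1) = xs ! j \<Longrightarrow> tableau_sig lam U j = 1"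
    using xs by (auto simp: fillings_def)
  have mono: "xs ! a \<le> xs ! b" if "a \<le> b" "b < n" for a b
    using sorted_nth_mono[OF sorted that(1)] that(2) len by simp
  have "content c < content d" if eq: "xs ! (U c - 1) = xs ! (U d - 1)"
  proof -
    have "content (inv_into Dg U (U c)) < content (inv_into Dg U (U d))"
    proof (rule increasing_interval[OF c(3)])
      fix j assume j: "U c \<le> j" "j < U d"
      have "xs ! (U c - 1) \<le> xs ! (j - 1)" "xs ! (j - 1) \<le> xs ! j" "xs ! j \<le> xs ! (U d - 1)"
        using mono[of "U c - 1" "j - 1"] mono[of "j - 1" j] mono[of j "U d - 1"] j r by auto
      then have "tableau_sig lam U j = 1" using desc[of j] j r eq by simp
      then show "content (inv_into Dg U j) < content (inv_into Dg U (Suc j))"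
        using tableau_sig_content[OF U, of j] j r by simp
    qed
    then show ?thesis using standard_inv_eq[OF st(1)] c by simp
  qed
  moreover have "xs ! (U c - 1) \<le> xs ! (U d - 1)" using mono[of "U c - 1" "U d - 1"] c(3) r by simp
  ultimately show ?thesis by linarith
qed

text \<open>Undoes standardization: entry \<open>k\<close> becomes the \<open>k\<close>-th letter,
  found at index \<open>k - 1\<close>.\<close>

definition fill :: "tableau \<Rightarrow> nat list \<Rightarrow> tableau" where
  "fill U xs = restrict (\<lambda>c. xs ! (U c - 1)) Dg"

lemma fill_SSYT:
  assumes U: "U \<in> SYT lam" and xs: "xs \<in> fillings m U"
  shows "fill U xs \<in> SSYT lam" "image_mset (fill U xs) (mset_set Dg) = m"
proof -
  note st = SYT_facts[OF U]
  show "fill U xs \<in> SSYT lam" unfolding SSYT_def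
  proof (intro CollectI conjI allI impI)
    fix i j
    show "fill U xs (i, j) \<le> fill U xs (i + 1, j)" if "(i, j) \<in> Dg \<and> (i + 1, j) \<in> Dg"
      using that fillings_order[OF U xs, of "(i, j)" "(i + 1, j)"] st(1) by (auto simp: fill_def standard_def)
    show "fill U xs (i, j) < fill U xs (i, j + 1)" if "(i, j) \<in> Dg \<and> (i, j + 1) \<in> Dg"
      using that fillings_order[OF U xs, of "(i, j)" "(i, j + 1)"] st(1) by (auto simp: fill_def standard_def)
  qed (simp add: fill_def)
  have len: "length xs = n" and m: "mset xs = m" using xs by (auto simp: fillings_def)
  have "image_mset (fill U xs) (mset_set Dg) = image_mset (\<lambda>c. xs ! (U c - 1)) (mset_set Dg)"
    by (rule image_mset_cong) (simp add: fill_def finite_diagram)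
  also have "\<dots> = image_mset (\<lambda>k. xs ! (k - 1)) (image_mset U (mset_set Dg))"
    by (simp add: multiset.map_comp o_def)
  also have "image_mset U (mset_set Dg) = mset_set {1..n}"
    using st(2) by (simp add: image_mset_mset_set bij_betw_def)
  also have "mset_set {1..n} = image_mset Suc (mset_set {..<n})"
    by (subst image_mset_mset_set) (auto simp: image_Suc_lessThan)
  also have "image_mset (\<lambda>k. xs ! (k - 1)) \<dots> = image_mset (nth xs) (mset_set {..<n})"
    by (simp add: multiset.map_comp o_def)
  also have "\<dots> = mset (map (nth xs) [0..<n])" by (simp add: lessThan_atLeast0)
  also have "map (nth xs) [0..<n] = xs" using len map_nth by blast
  finally show "image_mset (fill U xs) (mset_set Dg) = m" using m by simp
qed

text \<open>Both words are the sorted list of \<open>m\<close>, and by \<open>fillings_order\<close>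
  both tableaux number the cells along the same total order.\<close>

lemma fill_inj: "inj_on (\<lambda>(U, xs). fill U xs) (SIGMA U:SYT lam. fillings m U)"
proof (rule inj_onI, clarify)
  fix U xs V ys
  assume U: "U \<in> SYT lam" and xs: "xs \<in> fillings m U" and V: "V \<in> SYT lam" and ys: "ys \<in> fillings m V"
    and eq: "fill U xs = fill V ys"
  have "xs = ys" using xs ys properties_for_sort[of xs ys] properties_for_sort[of ys ys]
    by (simp add: fillings_def)
  have val: "xs ! (U c - 1) = ys ! (V c - 1)" if "c \<in> Dg" for c
    using fun_cong[OF eq, of c] that by (simp add: fill_def)
  note stU = SYT_facts[OF U] and stV = SYT_facts[OF V]
  have ne: "U c \<noteq> U d" "V c \<noteq> V d" if "c \<in> Dg" "d \<in> Dg" "c \<noteq> d" for c d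
    using that stU(2) stV(2) by (auto simp: bij_betw_def inj_on_def)
  have iff: "U c < U d \<longleftrightarrow> V c < V d" if "c \<in> Dg" "d \<in> Dg" for c d
  proof (cases "c = d")
    case False
    define R where "R c d \<longleftrightarrow> xs ! (U c - 1) < xs ! (U d - 1) \<or>
      xs ! (U c - 1) = xs ! (U d - 1) \<and> content c < content d" for c d
    have "\<not> (R c d \<and> R d c)" by (auto simp: R_def)
    moreover have "U c < U d \<Longrightarrow> R c d" "U d < U c \<Longrightarrow> R d c"
      unfolding R_def using fillings_order[OF U xs] that by blast+
    moreover have "V c < V d \<Longrightarrow> R c d" "V d < V c \<Longrightarrow> R d c"
      unfolding R_def val[OF that(1)] val[OF that(2)] using fillings_order[OF V ys] that by blast+
    moreover have "U c < U d \<or> U d < U c" "V c < V d \<or> V d < V c"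
      using ne[OF that False] by auto
    ultimately show ?thesis by blast
  qed simp
  have "U c = V c" if c: "c \<in> Dg" for c
  proof -
    have "{d \<in> Dg. U d < U c} = {d \<in> Dg. V d < V c}" using iff[OF _ c] by blast
    then have "U c - 1 = V c - 1"
      using bij_betw_initial_card[OF stU(2) c] bij_betw_initial_card[OF stV(2) c] by simp
    then show ?thesis using standard_range(1)[OF stU(1) c] standard_range(1)[OF stV(1) c] by simp
  qed
  then have "U = V" using stU(1) stV(1) by (auto simp: standard_def intro: extensionalityI)
  with \<open>xs = ys\<close> show "U = V \<and> xs = ys" by simp
qed

text \<open>Moving northeast on a diagonal includes a step up a column, where entries grow strictly.
  Hence entry and content together order the cells totally.\<close>

lemma SSYT_diagonal:
  assumes T: "T \<in> SSYT lam" and c: "c \<in> Dg" "d \<in> Dg" "T c = T d" "content c = content d"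
  shows "c = d"
proof -
  have r: "rows (row lam)" using rows_row[OF lam] .
  have less: "T (i, j) < T (i', j')" if ij: "(i, j) \<in> Dg" "(i', j') \<in> Dg" "i < i'" "j < j'" for i j i' j'
  proof -
    have pos: "1 \<le> i" "1 \<le> j" using ij(1) by (auto simp: diagram_def)
    have D: "(i, j + 1) \<in> Dg" using cells_down[OF r, of i' j' i "j + 1"] ij pos
      unfolding diagram_eq_cells by simp
    then have "T (i, j) < T (i, j + 1)" using T ij(1) by (simp add: SSYT_def)
    also have "T (i, j + 1) \<le> T (i', j')" using SSYT_mono[OF lam T ij(2)] ij pos by simp
    finally show ?thesis .
  qed
  obtain i j i' j' where ij: "c = (i, j)" "d = (i', j')" by fastforce
  then consider "i = i'" "j = j'" | "i < i'" "j < j'" | "i' < i" "j' < j" using c(4) by fastforce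
  then show ?thesis using less[of i j i' j'] less[of i' j' i j] c ij by cases auto
qed

text \<open>\<open>U\<close> is the standardization of \<open>T\<close>: cells are numbered by
  entry, and by content among equal entries. The sign in a place where the word stays constant is
  then \<open>1\<close>.\<close>

lemma fill_surj:
  assumes T: "T \<in> SSYT lam" and m: "image_mset T (mset_set Dg) = m"
  obtains U xs where "U \<in> SYT lam" "xs \<in> fillings m U" "fill U xs = T"
proof -
  define R where "R c d \<longleftrightarrow> T c < T d \<or> T c = T d \<and> content c < content d" for c d
  define U0 where "U0 c = Suc (card {d \<in> Dg. R d c})" for c
  have card: "card Dg = n" using lam card_cells_row[of lam] by (simp add: partitions_def)
  have total: "R c d \<or> R d c" if "c \<in> Dg" "d \<in> Dg" "c \<noteq> d" for c d
    using SSYT_diagonal[OF T that(1,2)] that(3) unfolding R_def by linarith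
  have rank: "bij_betw U0 Dg {1..card Dg}"
    and U0: "\<And>c d. c \<in> Dg \<Longrightarrow> d \<in> Dg \<Longrightarrow> U0 c < U0 d \<longleftrightarrow> R c d"
    unfolding U0_def using finite_diagram total
    by (intro rank_bij; auto simp: R_def)+
  define U where "U = restrict U0 Dg"
  have bij: "bij_betw U Dg {1..card Dg}" unfolding U_def using rank by (simp add: bij_betw_restrict_eq)
  have UR: "U c < U d \<longleftrightarrow> R c d" if "c \<in> Dg" "d \<in> Dg" for c d
    using U0[OF that] that by (simp add: U_def)
  have st: "standard Dg U" unfolding standard_def
  proof (intro conjI allI impI)
    show "U \<in> extensional Dg" by (simp add: U_def)
    fix i j
    show "U (i, j) < U (i + 1, j)" if "(i, j) \<in> Dg \<and> (i + 1, j) \<in> Dg"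
      using that T UR[of "(i, j)" "(i + 1, j)"] by (fastforce simp: SSYT_def R_def le_less)
    show "U (i, j) < U (i, j + 1)" if "(i, j) \<in> Dg \<and> (i, j + 1) \<in> Dg"
      using that T UR[of "(i, j)" "(i, j + 1)"] by (simp add: SSYT_def R_def)
  qed (rule bij)
  then have U: "U \<in> SYT lam" by (simp add: SYT_standard)
  define xs where "xs = map (\<lambda>k. T (inv_into Dg U (Suc k))) [0..<n]"
  have nth0: "xs ! a = T (inv_into Dg U (Suc a))" if "a < n" for a
    using that by (simp add: xs_def)
  have nth: "xs ! (k - 1) = T (inv_into Dg U k)" if "1 \<le> k" "k \<le> n" for k
    using nth0[of "k - 1"] that by simp
  have cell: "inv_into Dg U k \<in> Dg" "U (inv_into Dg U k) = k" if "1 \<le> k" "k \<le> n" for k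
    using standard_inv[OF st] that card by auto
  have "sorted xs" unfolding sorted_iff_nth_mono
  proof (intro allI impI)
    fix a b assume ab: "a \<le> b" "b < length xs"
    show "xs ! a \<le> xs ! b"
    proof (cases "a = b")
      case False
      then have k: "1 \<le> Suc a" "Suc a \<le> n" "1 \<le> Suc b" "Suc b \<le> n" "a < b" using ab by (auto simp: xs_def)
      then have "R (inv_into Dg U (Suc a)) (inv_into Dg U (Suc b))"
        using UR[OF cell(1)[OF k(1,2)] cell(1)[OF k(3,4)]] cell(2)[OF k(1,2)] cell(2)[OF k(3,4)] by simp
      then show ?thesis using nth[OF k(1,2)] nth[OF k(3,4)] by (auto simp: R_def)
    qed simp
  qed
  moreover have "tableau_sig lam U j = 1" if j: "1 \<le> j" "j < n" "xs ! (j - 1) = xs ! j" for j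
  proof -
    have k: "1 \<le> j" "j \<le> n" "1 \<le> Suc j" "Suc j \<le> n" using j by auto
    have "R (inv_into Dg U j) (inv_into Dg U (Suc j))"
      using UR[OF cell(1)[OF k(1,2)] cell(1)[OF k(3,4)]] cell(2)[OF k(1,2)] cell(2)[OF k(3,4)] by simp
    then show ?thesis
      using tableau_sig_content[OF U j(1,2)] nth[OF k(1,2)] nth[OF k(3,4)] j(3) by (simp add: R_def)
  qed
  moreover have "mset xs = m"
  proof -
    have "inj_on (\<lambda>k. inv_into Dg U (Suc k)) {..<n}"
    proof (rule inj_onI)
      fix a b assume ab: "a \<in> {..<n}" "b \<in> {..<n}" "inv_into Dg U (Suc a) = inv_into Dg U (Suc b)"
      then have "U (inv_into Dg U (Suc a)) = U (inv_into Dg U (Suc b))" by simp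
      then show "a = b" using cell(2)[of "Suc a"] cell(2)[of "Suc b"] ab(1,2) by simp
    qed
    moreover have "(\<lambda>k. inv_into Dg U (Suc k)) ` {..<n} = Dg"
    proof (intro set_eqI iffI)
      fix c assume c: "c \<in> Dg"
      have "c = inv_into Dg U (Suc (U c - 1))" "U c - 1 \<in> {..<n}"
        using standard_inv_eq[OF st c] standard_range[OF st c] card by simp_all
      then show "c \<in> (\<lambda>k. inv_into Dg U (Suc k)) ` {..<n}" by (rule image_eqI)
    next
      fix c assume "c \<in> (\<lambda>k. inv_into Dg U (Suc k)) ` {..<n}"
      then show "c \<in> Dg" using cell(1) by auto
    qed
    ultimately have "image_mset (\<lambda>k. inv_into Dg U (Suc k)) (mset_set {..<n}) = mset_set Dg"
      by (simp add: image_mset_mset_set)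
    then have "image_mset T (mset_set Dg) =
        image_mset T (image_mset (\<lambda>k. inv_into Dg U (Suc k)) (mset_set {..<n}))" by (simp only:)
    also have "\<dots> = image_mset (\<lambda>k. T (inv_into Dg U (Suc k))) (mset_set {..<n})"
      by (simp add: multiset.map_comp o_def)
    finally have "image_mset T (mset_set Dg) = image_mset (\<lambda>k. T (inv_into Dg U (Suc k))) (mset_set {..<n})" .
    then show ?thesis using m by (simp add: xs_def lessThan_atLeast0)
  qed
  moreover have "length xs = n" by (simp add: xs_def)
  ultimately have xs: "xs \<in> fillings m U" unfolding fillings_def by blast
  have "fill U xs = T"
  proof (rule extensionalityI[of _ Dg])
    show "T \<in> extensional Dg" using T by (simp add: SSYT_def)
    fix c assume c: "c \<in> Dg"
    then show "fill U xs c = T c"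
      using nth[of "U c"] standard_range[OF st c] standard_inv_eq[OF st c] card by (simp add: fill_def)
  qed (simp add: fill_def)
  then show thesis using that U xs by blast
qed

lemma finite_SYT: "finite (SYT lam)"
proof (rule finite_subset)
  show "SYT lam \<subseteq> Dg \<rightarrow>\<^sub>E {1..n}"
  proof
    fix U assume U: "U \<in> SYT lam"
    show "U \<in> Dg \<rightarrow>\<^sub>E {1..n}"
      using SYT_facts(1)[OF U] bij_betwE[OF SYT_facts(2)[OF U]] by (simp add: PiE_iff standard_def)
  qed
  show "finite (Dg \<rightarrow>\<^sub>E {1..n})" using finite_diagram by (simp add: finite_PiE)
qed

theorem schur_eq_sum_Qsym:
  "schur lam m = (\<Sum>U\<in>SYT lam. Qsym n (tableau_sig lam U) m :: 'a :: semiring_1)"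
proof -
  have "bij_betw (\<lambda>(U, xs). fill U xs) (SIGMA U:SYT lam. fillings m U)
      {T \<in> SSYT lam. image_mset T (mset_set Dg) = m}"
    unfolding bij_betw_def
  proof (intro conjI set_eqI iffI)
    show "inj_on (\<lambda>(U, xs). fill U xs) (SIGMA U:SYT lam. fillings m U)" by (rule fill_inj)
    fix T
    show "T \<in> (\<lambda>(U, xs). fill U xs) ` (SIGMA U:SYT lam. fillings m U)"
      if "T \<in> {T \<in> SSYT lam. image_mset T (mset_set Dg) = m}"
    proof -
      have T: "T \<in> SSYT lam" "image_mset T (mset_set Dg) = m" using that by auto
      obtain U xs where "U \<in> SYT lam" "xs \<in> fillings m U" "fill U xs = T"
        by (rule fill_surj[OF T])
      then show ?thesis by force
    qed
    show "T \<in> {T \<in> SSYT lam. image_mset T (mset_set Dg) = m}"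
      if "T \<in> (\<lambda>(U, xs). fill U xs) ` (SIGMA U:SYT lam. fillings m U)"
      using that fill_SSYT by auto
  qed
  then have "card {T \<in> SSYT lam. image_mset T (mset_set Dg) = m} = card (SIGMA U:SYT lam. fillings m U)"
    by (rule bij_betw_same_card[symmetric])
  also have "\<dots> = (\<Sum>U\<in>SYT lam. card (fillings m U))"
  proof (rule card_SigmaI[OF finite_SYT], rule ballI)
    fix U
    have "fillings m U \<subseteq> {xs. set xs \<subseteq> set_mset m \<and> length xs = n}" by (auto simp: fillings_def)
    then show "finite (fillings m U)" by (rule finite_subset) (rule finite_lists_length_eq[OF finite_set_mset])
  qed
  finally show ?thesis by (simp add: schur_def Qsym_def fillings_def)
qed

end

section \<open>Symmetry of Schur functions\<close>

context
  fixes lam n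
  assumes lam: "lam \<in> partitions n"
begin

text \<open>For varying \<open>v\<close> these counts form the Gelfand-Tsetlin pattern of
  \<open>T\<close>. Entries start at \<open>0\<close>, and the strict inequality makes the pattern
  start with the empty shape at \<open>v = 0\<close>.\<close>

definition row_count :: "tableau \<Rightarrow> nat \<Rightarrow> nat \<Rightarrow> nat" where
  "row_count T v j = card {i. (i, j) \<in> diagram lam \<and> T (i, j) < v}"

lemma diagram_down:
  "(i, j) \<in> diagram lam \<Longrightarrow> 1 \<le> i' \<Longrightarrow> 1 \<le> j' \<Longrightarrow> i' \<le> i \<Longrightarrow> j' \<le> j \<Longrightarrow> (i', j') \<in> diagram lam"
  using cells_down[OF rows_row[OF lam]] unfolding diagram_eq_cells by blast

lemma diagram_ge: "(i, j) \<in> diagram lam \<Longrightarrow> 1 \<le> i \<and> 1 \<le> j"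
  by (simp add: diagram_def)

lemma finite_diagram_row: "finite {i. (i, j) \<in> diagram lam \<and> P i}"
  by (rule finite_subset[of _ "fst ` diagram lam"]) (use finite_diagram in force)+

lemma SSYT_row_mono:
  assumes T: "T \<in> SSYT lam" and D: "(i, j) \<in> diagram lam" "1 \<le> i'" "i' \<le> i"
  shows "T (i', j) \<le> T (i, j)"
  using SSYT_mono[OF lam T D(1)] D diagram_ge[OF D(1)] by simp

lemma row_count_iff:
  assumes T: "T \<in> SSYT lam"
  shows "(i, j) \<in> diagram lam \<and> T (i, j) < v \<longleftrightarrow> 1 \<le> i \<and> 1 \<le> j \<and> i \<le> row_count T v j"
proof -
  have "{i. (i, j) \<in> diagram lam \<and> T (i, j) < v} = {1..row_count T v j}"
    unfolding row_count_def
  proof (rule down_closed_interval[OF finite_diagram_row])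
    fix i i' assume i: "i \<in> {i. (i, j) \<in> diagram lam \<and> T (i, j) < v}" "1 \<le> i'" "i' \<le> i"
    have "1 \<le> j" using i diagram_ge by blast
    then show "i' \<in> {i. (i, j) \<in> diagram lam \<and> T (i, j) < v}"
      using i diagram_down[of i j i' j] SSYT_row_mono[OF T, of i j i'] by auto
  qed (use diagram_ge in blast)
  then have "(i, j) \<in> diagram lam \<and> T (i, j) < v \<longleftrightarrow> 1 \<le> i \<and> i \<le> row_count T v j"
    by (auto simp: set_eq_iff)
  then show ?thesis using diagram_ge by blast
qed

lemma row_count_mono: "v \<le> w \<Longrightarrow> row_count T v j \<le> row_count T w j"
  unfolding row_count_def by (rule card_mono[OF finite_diagram_row]) auto

text \<open>The interlacing condition of the pattern; it encodes that columns are strict.\<close>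

lemma row_count_column:
  assumes T: "T \<in> SSYT lam" and j: "1 \<le> j"
  shows "row_count T (Suc v) (Suc j) \<le> row_count T v j"
proof (cases "row_count T (Suc v) (Suc j)")
  case (Suc i)
  then have D: "(Suc i, Suc j) \<in> diagram lam" "T (Suc i, Suc j) < Suc v"
    using row_count_iff[OF T, of "Suc i" "Suc j" "Suc v"] by auto
  have "(Suc i, j) \<in> diagram lam" using diagram_down[OF D(1), of "Suc i" j] j by simp
  moreover have "T (Suc i, j) < T (Suc i, Suc j)" using T D(1) calculation by (simp add: SSYT_def)
  ultimately show ?thesis using row_count_iff[OF T, of "Suc i" j v] D(2) Suc by simp
qed simp

lemma SSYT_by_counts:
  assumes "T \<in> extensional (diagram lam)"
    and iff: "\<And>i j v. (i, j) \<in> diagram lam \<Longrightarrow> T (i, j) < v \<longleftrightarrow> i \<le> f v j"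
    and col: "\<And>j v. 1 \<le> j \<Longrightarrow> f (Suc v) (Suc j) \<le> f v j"
  shows "T \<in> SSYT lam"
  unfolding SSYT_def
proof (intro CollectI conjI allI impI)
  fix i j
  show "T (i, j) \<le> T (i + 1, j)" if "(i, j) \<in> diagram lam \<and> (i + 1, j) \<in> diagram lam"
  proof -
    have "T (i + 1, j) < Suc (T (i + 1, j))" by simp
    then have "T (i, j) < Suc (T (i + 1, j))" using iff that by (metis add_leD1)
    then show ?thesis by simp
  qed
  show "T (i, j) < T (i, j + 1)" if "(i, j) \<in> diagram lam \<and> (i, j + 1) \<in> diagram lam"
  proof -
    have "i \<le> f (Suc (T (i, j + 1))) (j + 1)" using iff[of i "j + 1"] that by blast
    then have "i \<le> f (T (i, j + 1)) j" using col[of j "T (i, j + 1)"] that diagram_ge by fastforce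
    then show ?thesis using iff that by blast
  qed
qed (fact assms(1))

text \<open>The lower bound that monotonicity and interlacing put on the count at
  \<open>k + 1\<close>, given the counts at \<open>k\<close> and \<open>k + 2\<close>.\<close>

definition low :: "tableau \<Rightarrow> nat \<Rightarrow> nat \<Rightarrow> nat" where
  "low T k j = max (row_count T k j) (row_count T (k + 2) (Suc j))"

text \<open>The matching upper bound; row \<open>1\<close> has no row below it to interlace
  with.\<close>

definition high :: "tableau \<Rightarrow> nat \<Rightarrow> nat \<Rightarrow> nat" where
  "high T k j = (if j = 1 then row_count T (k + 2) j
     else min (row_count T (k + 2) j) (row_count T k (j - 1)))"

definition flipped :: "tableau \<Rightarrow> nat \<Rightarrow> nat \<Rightarrow> nat" where
  "flipped T k j = low T k j + high T k j - row_count T (k + 1) j"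

text \<open>The Bender--Knuth involution. With the entries other than \<open>k\<close> and \<open>k + 1\<close> fixed, the number
  of entries at most \<open>k\<close> in row \<open>j\<close> ranges over the interval from \<open>low\<close> to \<open>high\<close>, independently
  for each row; the involution reflects these intervals.\<close>

definition bender_knuth :: "nat \<Rightarrow> tableau \<Rightarrow> tableau" where
  "bender_knuth k T = restrict (\<lambda>(i, j).
     if T (i, j) = k \<or> T (i, j) = k + 1 then (if i \<le> flipped T k j then k else k + 1)
     else T (i, j)) (diagram lam)"

lemma low_le_high:
  assumes T: "T \<in> SSYT lam" and j: "1 \<le> j"
  shows "low T k j \<le> row_count T (k + 1) j" "row_count T (k + 1) j \<le> high T k j"
  using row_count_mono[of k "k + 1" T j] row_count_mono[of "k + 1" "k + 2" T j]
    row_count_column[OF T j, of "k + 1"] row_count_column[OF T, of "j - 1" k] j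
  by (auto simp: low_def high_def)

lemma flipped_bounds:
  assumes "T \<in> SSYT lam" "1 \<le> j"
  shows "low T k j \<le> flipped T k j" "flipped T k j \<le> high T k j"
  using low_le_high[OF assms, of k] by (auto simp: flipped_def)

text \<open>In row \<open>j\<close> the entries \<open>k\<close> and \<open>k + 1\<close> fill the
  columns after the count at \<open>k\<close> up to the count at \<open>k + 2\<close>, and
  \<open>flipped\<close> stays in this range. So the pattern changes at \<open>v = k + 1\<close>
  only.\<close>

lemma bender_knuth_less:
  assumes T: "T \<in> SSYT lam" and D: "(i, j) \<in> diagram lam"
  shows "bender_knuth k T (i, j) < v \<longleftrightarrow> i \<le> (if v = k + 1 then flipped T k j else row_count T v j)"
proof -
  have ij: "1 \<le> i" "1 \<le> j" using diagram_ge[OF D] by auto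
  have iff: "T (i, j) < w \<longleftrightarrow> i \<le> row_count T w j" for w
    using row_count_iff[OF T, of i j w] D ij by simp
  show ?thesis
  proof (cases "T (i, j) = k \<or> T (i, j) = k + 1")
    case True
    then have "bender_knuth k T (i, j) = (if i \<le> flipped T k j then k else k + 1)"
      using D by (simp add: bender_knuth_def)
    then show ?thesis using True iff[of v] by auto
  next
    case False
    then have "bender_knuth k T (i, j) = T (i, j)" using D by (auto simp: bender_knuth_def)
    moreover have "T (i, j) < k + 1 \<longleftrightarrow> i \<le> flipped T k j"
    proof (cases "T (i, j) < k")
      case True
      then show ?thesis using iff[of k] flipped_bounds(1)[OF T ij(2), of k] by (simp add: low_def)
    next
      case 1: False
      then have "\<not> T (i, j) < k + 2" using False by auto
      then have "\<not> i \<le> high T k j" using iff[of "k + 2"] by (auto simp: high_def)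
      then show ?thesis using 1 False flipped_bounds(2)[OF T ij(2), of k] by auto
    qed
    ultimately show ?thesis using iff[of v] by auto
  qed
qed

lemma bender_knuth_SSYT:
  assumes T: "T \<in> SSYT lam"
  shows "bender_knuth k T \<in> SSYT lam"
proof (rule SSYT_by_counts)
  show "bender_knuth k T \<in> extensional (diagram lam)" by (simp add: bender_knuth_def)
  show "bender_knuth k T (i, j) < v \<longleftrightarrow> i \<le> (if v = k + 1 then flipped T k j else row_count T v j)"
    if "(i, j) \<in> diagram lam" for i j v
    by (rule bender_knuth_less[OF T that])
  fix j v :: nat assume j: "1 \<le> j"
  show "(if Suc v = k + 1 then flipped T k (Suc j) else row_count T (Suc v) (Suc j))
      \<le> (if v = k + 1 then flipped T k j else row_count T v j)"
    using row_count_column[OF T j, of v] flipped_bounds[OF T j, of k] flipped_bounds[OF T, of "Suc j" k] j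
    by (auto simp: low_def high_def)
qed

lemma row_count_bender_knuth:
  assumes T: "T \<in> SSYT lam" and j: "1 \<le> j"
  shows "row_count (bender_knuth k T) v j = (if v = k + 1 then flipped T k j else row_count T v j)"
proof -
  let ?r = "if v = k + 1 then flipped T k j else row_count T v j"
  have "?r \<le> row_count T (max v (k + 2)) j"
    using flipped_bounds(2)[OF T j, of k] row_count_mono[of v "max v (k + 2)" T j]
    by (auto simp: high_def split: if_splits)
  then have D: "(i, j) \<in> diagram lam" if "1 \<le> i" "i \<le> ?r" for i
    using row_count_iff[OF T, of i j "max v (k + 2)"] that j by simp
  have "{i. (i, j) \<in> diagram lam \<and> bender_knuth k T (i, j) < v} = {1..?r}"
  proof (intro set_eqI iffI)
    fix i assume "i \<in> {i. (i, j) \<in> diagram lam \<and> bender_knuth k T (i, j) < v}"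
    then have i: "(i, j) \<in> diagram lam" "bender_knuth k T (i, j) < v" by auto
    then show "i \<in> {1..?r}" using bender_knuth_less[OF T i(1), of k v] diagram_ge[OF i(1)] by simp
  next
    fix i assume "i \<in> {1..?r}"
    then have i: "1 \<le> i" "i \<le> ?r" by auto
    show "i \<in> {i. (i, j) \<in> diagram lam \<and> bender_knuth k T (i, j) < v}"
      using D[OF i] bender_knuth_less[OF T D[OF i], of k v] i(2) by blast
  qed
  then show ?thesis by (simp only: row_count_def[of "bender_knuth k T"] card_atLeastAtMost diff_Suc_1)
qed

text \<open>\<open>low\<close> and \<open>high\<close> depend only on the counts at \<open>k\<close>
  and \<open>k + 2\<close>, which do not change, so the second reflection is in the same
  interval.\<close>

lemma bender_knuth_involution:
  assumes T: "T \<in> SSYT lam"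
  shows "bender_knuth k (bender_knuth k T) = T"
proof (rule extensionalityI[of _ "diagram lam"])
  show "T \<in> extensional (diagram lam)" using T by (simp add: SSYT_def)
  fix c assume c: "c \<in> diagram lam"
  obtain i j where ij: "c = (i, j)" by fastforce
  then have D: "(i, j) \<in> diagram lam" using c by simp
  then have ge: "1 \<le> i" "1 \<le> j" using diagram_ge by auto
  let ?T = "bender_knuth k T"
  have "low ?T k j = low T k j" "high ?T k j = high T k j"
    using row_count_bender_knuth[OF T, of _ k] ge(2) by (auto simp: low_def high_def)
  then have "flipped ?T k j = row_count T (k + 1) j"
    using row_count_bender_knuth[OF T ge(2), of k "k + 1"] low_le_high[OF T ge(2), of k]
    by (simp add: flipped_def)
  then have "bender_knuth k ?T (i, j) < v \<longleftrightarrow> T (i, j) < v" for v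
    using bender_knuth_less[OF bender_knuth_SSYT[OF T] D, of k k v] row_count_bender_knuth[OF T ge(2), of k v]
      row_count_iff[OF T, of i j v] D ge by auto
  then have "bender_knuth k ?T (i, j) = T (i, j)" by (metis linorder_neqE_nat less_irrefl)
  then show "bender_knuth k ?T c = T c" using ij by simp
qed (simp add: bender_knuth_def)

lemma card_less_eq_sum: "card {c \<in> diagram lam. T c < v} = (\<Sum>j=1..length lam. row_count T v j)"
proof -
  have "{c \<in> diagram lam. T c < v} =
      (\<lambda>(j, i). (i, j)) ` (SIGMA j:{1..length lam}. {i. (i, j) \<in> diagram lam \<and> T (i, j) < v})"
    by (auto simp: diagram_def image_iff)
  then have "card {c \<in> diagram lam. T c < v} =
      card (SIGMA j:{1..length lam}. {i. (i, j) \<in> diagram lam \<and> T (i, j) < v})"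
    by (simp add: card_image inj_on_def)
  then show ?thesis by (simp add: row_count_def finite_diagram_row)
qed

text \<open>\<open>low\<close> in row \<open>j\<close> and \<open>high\<close> in row
  \<open>j + 1\<close> are the maximum and the minimum of the same two counts, so pairing them
  across rows removes both operations.\<close>

lemma sum_low_high:
  "(\<Sum>j=1..L. low T k j + high T k j) + high T k (Suc L) =
    (\<Sum>j=1..L. row_count T k j) + (\<Sum>j=1..Suc L. row_count T (k + 2) j)"
proof (induction L)
  case 0
  then show ?case by (simp add: high_def)
next
  case (Suc L)
  have "low T k (Suc L) + high T k (Suc (Suc L)) = row_count T k (Suc L) + row_count T (k + 2) (Suc (Suc L))"
    by (simp add: low_def high_def)
  with Suc show ?case by simp
qed

lemma sum_flipped:
  assumes T: "T \<in> SSYT lam"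
  shows "(\<Sum>j=1..length lam. flipped T k j) + (\<Sum>j=1..length lam. row_count T (k + 1) j) =
    (\<Sum>j=1..length lam. row_count T k j) + (\<Sum>j=1..length lam. row_count T (k + 2) j)"
proof -
  \<comment> \<open>The row above the diagram is empty, so the term left unpaired in
    \<open>sum_low_high\<close> vanishes.\<close>
  have "(i, Suc (length lam)) \<notin> diagram lam" for i by (simp add: diagram_def)
  then have z: "row_count T (k + 2) (Suc (length lam)) = 0" by (simp add: row_count_def)
  then have "high T k (Suc (length lam)) = 0" by (simp only: high_def min_0L if_cancel)
  moreover have "flipped T k j + row_count T (k + 1) j = low T k j + high T k j" if "j \<in> {1..length lam}" for j
    using low_le_high[OF T, of j k] that by (simp add: flipped_def)
  then have "(\<Sum>j=1..length lam. flipped T k j) + (\<Sum>j=1..length lam. row_count T (k + 1) j) =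
      (\<Sum>j=1..length lam. low T k j + high T k j)"
    unfolding sum.distrib[symmetric] by (intro sum.cong) auto
  ultimately show ?thesis using sum_low_high[of T k "length lam"] z by simp
qed

lemma count_weight_card:
  "count (image_mset T (mset_set (diagram lam))) v = card {c \<in> diagram lam. T c = v}"
  using finite_diagram[of lam] by (simp add: count_image_mset Int_def vimage_def conj_commute)

lemma count_weight: "count (image_mset T (mset_set (diagram lam))) v =
    card {c \<in> diagram lam. T c < Suc v} - card {c \<in> diagram lam. T c < v}"
proof -
  have "count (image_mset T (mset_set (diagram lam))) v = card {c \<in> diagram lam. T c = v}"
    by (rule count_weight_card)
  also have "{c \<in> diagram lam. T c = v} = {c \<in> diagram lam. T c < Suc v} - {c \<in> diagram lam. T c < v}"
    by auto
  also have "card \<dots> = card {c \<in> diagram lam. T c < Suc v} - card {c \<in> diagram lam. T c < v}"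
    by (rule card_Diff_subset) (auto simp: finite_diagram)
  finally show ?thesis .
qed

text \<open>Among the cumulative counts only the one at \<open>k + 1\<close> changes, and it is
  reflected between those at \<open>k\<close> and \<open>k + 2\<close>. Taking differences, the
  multiplicities of \<open>k\<close> and \<open>k + 1\<close> are exchanged.\<close>

lemma bender_knuth_weight:
  assumes T: "T \<in> SSYT lam"
  shows "image_mset (bender_knuth k T) (mset_set (diagram lam)) =
    image_mset (transpose k (Suc k)) (image_mset T (mset_set (diagram lam)))"
proof (rule multiset_eqI)
  fix v
  let ?N = "\<lambda>T v. card {c \<in> diagram lam. T c < v}"
  let ?s = "transpose k (Suc k)"
  have other: "?N (bender_knuth k T) w = ?N T w" if "w \<noteq> k + 1" for w
    unfolding card_less_eq_sum using row_count_bender_knuth[OF T, of _ k w] that by simp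
  have mid: "?N (bender_knuth k T) (k + 1) + ?N T (k + 1) = ?N T k + ?N T (k + 2)"
    unfolding card_less_eq_sum using sum_flipped[OF T, of k] row_count_bender_knuth[OF T, of _ k "k + 1"]
    by simp
  have mono: "?N T' w \<le> ?N T' w'" if "w \<le> w'" for w w' and T' :: tableau
    by (rule card_mono) (use that finite_diagram in auto)
  have "?s x = v \<longleftrightarrow> x = ?s v" for x using transpose_involutory[of k "Suc k"] by metis
  then have "{c \<in> diagram lam. ?s (T c) = v} = {c \<in> diagram lam. T c = ?s v}" by simp
  then have "count (image_mset ?s (image_mset T (mset_set (diagram lam)))) v =
      count (image_mset T (mset_set (diagram lam))) (?s v)"
    using count_weight_card[of "?s \<circ> T" v] count_weight_card[of T "?s v"]
    by (simp add: multiset.map_comp)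
  then have *: "count (image_mset ?s (image_mset T (mset_set (diagram lam)))) v =
      ?N T (Suc (?s v)) - ?N T (?s v)" by (simp only: count_weight)
  consider "v = k" | "v = k + 1" | "v \<noteq> k" "v \<noteq> k + 1" by blast
  then show "count (image_mset (bender_knuth k T) (mset_set (diagram lam))) v =
      count (image_mset ?s (image_mset T (mset_set (diagram lam)))) v"
    unfolding * count_weight
  proof cases
    case 1
    then show "?N (bender_knuth k T) (Suc v) - ?N (bender_knuth k T) v = ?N T (Suc (?s v)) - ?N T (?s v)"
      using mid other[of k] mono[of k "k + 1" T] mono[of "k + 1" "k + 2" T] by simp
  next
    case 2
    then show "?N (bender_knuth k T) (Suc v) - ?N (bender_knuth k T) v = ?N T (Suc (?s v)) - ?N T (?s v)"
      using mid other[of "k + 2"] mono[of k "k + 1" T] mono[of "k + 1" "k + 2" T] by simp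
  next
    case 3
    then show "?N (bender_knuth k T) (Suc v) - ?N (bender_knuth k T) v = ?N T (Suc (?s v)) - ?N T (?s v)"
      using other[of v] other[of "Suc v"] by simp
  qed
qed

lemma schur_transpose_adjacent: "schur lam (image_mset (transpose k (Suc k)) m) = (schur lam m :: 'a :: semiring_1)"
proof -
  let ?B = "\<lambda>m. {T \<in> SSYT lam. image_mset T (mset_set (diagram lam)) = m}"
  let ?s = "transpose k (Suc k)"
  have ss: "image_mset ?s (image_mset ?s m) = m" for m :: "nat multiset"
    by (simp add: multiset.map_comp)
  have into: "bender_knuth k T \<in> ?B (image_mset ?s m)" if "T \<in> ?B m" for T m
    using that bender_knuth_SSYT bender_knuth_weight by auto
  have "bij_betw (bender_knuth k) (?B m) (?B (image_mset ?s m))"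
  proof (rule bij_betw_byWitness[of _ "bender_knuth k"])
    show "bender_knuth k ` ?B (image_mset ?s m) \<subseteq> ?B m"
      using into[of _ "image_mset ?s m"] unfolding ss by blast
  qed (use bender_knuth_involution into in auto)
  then show ?thesis unfolding schur_def by (simp add: bij_betw_same_card)
qed

end

section \<open>From adjacent transpositions to all permutations\<close>

lemma finite_permutation_extends:
  assumes p: "inj_on p A" and fin: "finite A"
  obtains q S where "finite S" "q permutes S" "\<And>x. x \<in> A \<Longrightarrow> q x = p x"
proof -
  let ?S = "A \<union> p ` A"
  \<comment> \<open>As many points are missing from \<open>A\<close> as from its image, so matching
    them by \<open>h\<close> closes \<open>p\<close> up to a permutation of
    \<open>?S\<close>.\<close>
  have "card (?S - A) = card (?S - p ` A)"
    using fin card_image[OF p] by (simp add: card_Diff_subset)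
  then obtain h where h: "bij_betw h (?S - A) (?S - p ` A)"
    using fin by (metis finite_Diff finite_Un finite_imageI finite_same_card_bij)
  define q where "q x = (if x \<in> A then p x else if x \<in> ?S then h x else x)" for x
  have "bij_betw q A (p ` A)"
    using p by (subst bij_betw_cong[of _ _ p]) (auto simp: q_def bij_betw_def)
  moreover have "bij_betw q (?S - A) (?S - p ` A)"
    using h by (subst bij_betw_cong[of _ _ h]) (auto simp: q_def)
  ultimately have "bij_betw q (A \<union> (?S - A)) (p ` A \<union> (?S - p ` A))"
    by (rule bij_betw_combine) auto
  moreover have "A \<union> (?S - A) = ?S" "p ` A \<union> (?S - p ` A) = ?S" by auto
  ultimately have "bij_betw q ?S ?S" by simp
  then have "q permutes ?S" by (rule bij_imp_permutes) (simp add: q_def)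
  then show thesis using that[of ?S q] fin by (simp add: q_def)
qed

text \<open>A monomial has finitely many variables, so \<open>p\<close> acts on it as a finite
  permutation. This is a product of transpositions, and each of these arises from adjacent ones by
  conjugation.\<close>

lemma symmetric_from_adjacent:
  fixes F :: "'a series"
  assumes adj: "\<And>k m. F (image_mset (transpose k (Suc k)) m) = F m" and p: "inj p"
  shows "F (image_mset p m) = F m"
proof -
  have less: "F (image_mset (transpose a b) m) = F m" if "a < b" for a b m
    using that
  proof (induction b arbitrary: m)
    case (Suc b)
    show ?case
    proof (cases "a = b")
      case False
      then have "transpose a (Suc b) = transpose b (Suc b) \<circ> transpose a b \<circ> transpose b (Suc b)"
        using Suc.prems by (auto simp: transpose_def fun_eq_iff)
      then have "image_mset (transpose a (Suc b)) m =
          image_mset (transpose b (Suc b)) (image_mset (transpose a b) (image_mset (transpose b (Suc b)) m))"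
        by (simp add: multiset.map_comp comp_assoc)
      then show ?thesis using Suc False adj by simp
    qed (use adj in simp)
  qed simp
  have tr: "F (image_mset (transpose a b) m) = F m" for a b m
    using less[of a b] less[of b a] by (cases a b rule: linorder_cases) (auto simp: transpose_commute)
  obtain q S where q: "finite S" "q permutes S" "\<And>x. x \<in> set_mset m \<Longrightarrow> q x = p x"
    using finite_permutation_extends[of p "set_mset m"] inj_on_subset[OF p] by (metis finite_set_mset subset_UNIV)
  have "\<forall>m. F (image_mset q m) = F m" using q(2,1)
  proof (induction rule: permutes_induct)
    case (swap a b q)
    show ?case
    proof
      fix m
      have "F (image_mset (transpose a b) (image_mset q m)) = F m" using tr swap by metis
      then show "F (image_mset (transpose a b \<circ> q) m) = F m" by (simp only: multiset.map_comp)
    qed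
  qed simp
  moreover have "image_mset p m = image_mset q m" by (rule image_mset_cong) (simp add: q(3))
  ultimately show ?thesis by simp
qed

theorem schur_symmetric:
  "lam \<in> partitions n \<Longrightarrow> inj p \<Longrightarrow> schur lam (image_mset p m) = (schur lam m :: 'a :: semiring_1)"
  by (rule symmetric_from_adjacent[OF schur_transpose_adjacent])

section \<open>The generating function of a dual equivalence graph\<close>

lemma finite_partitions: "finite (partitions n)"
proof (rule finite_subset)
  have len: "length xs \<le> sum_list xs" if "\<forall>p\<in>set xs. 0 < p" for xs :: "nat list"
    using that by (induction xs) auto
  show "partitions n \<subseteq> {xs. set xs \<subseteq> {..n} \<and> length xs \<le> n}"
  proof
    fix lam assume lam: "lam \<in> partitions n"
    then have "sum_list lam = n" "length lam \<le> n" using len[of lam] by (auto simp: partitions_def)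
    then show "lam \<in> {xs. set xs \<subseteq> {..n} \<and> length xs \<le> n}"
      using member_le_sum_list[of _ lam] by auto
  qed
  show "finite {xs. set xs \<subseteq> {..n} \<and> length xs \<le> n}" by (rule finite_lists_length_le) simp
qed

context deg
begin

lemma components_conn: "components G {2..<n} = (\<lambda>v. {w. conn n v w}) ` verts G"
  by (simp add: components_def conn_def)

lemma conn_class_eq:
  assumes "conn n v w"
  shows "{u. conn n w u} = {u. conn n v u}"
proof (intro set_eqI iffI)
  show "u \<in> {u. conn n v u}" if "u \<in> {u. conn n w u}" for u
    using that conn_trans[OF assms] by simp
  show "u \<in> {u. conn n w u}" if "u \<in> {u. conn n v u}" for u
    using that conn_trans[OF conn_sym[OF assms order_refl]] by simp
qed

text \<open>Existence is needed so that no component is lost when the sum is grouped by partitions,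
  uniqueness so that none is counted twice.\<close>

lemma component_unique_shape:
  assumes "C \<in> components G {2..<n}"
  shows "\<exists>!lam. lam \<in> partitions n \<and> scgraph_isomorphic n (induced G C) (standard_graph lam)"
proof -
  obtain v where v: "v \<in> verts G" "C = {w. conn n v w}" using assms unfolding components_conn by blast
  obtain g where L: "labelling n n g" by (rule labelling_exists[OF order_refl])
  obtain lam T where lam: "lam \<in> partitions n" "T \<in> SYT lam" "tab_chain lam T = g v"
    by (rule valid_partition[OF labelling_vertD(1,2)[OF L v(1)]])
  have sh: "shape (g v) = boundary (row lam)" using tab_chain_valid(3)[OF lam(1,2)] lam(3) by simp
  show ?thesis
  proof (rule ex1I[of _ lam])
    show "lam \<in> partitions n \<and> scgraph_isomorphic n (induced G C) (standard_graph lam)"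
      unfolding v(2) using labelling_component_iso[OF L v(1) lam(1) sh] lam(1) by blast
    fix mu assume "mu \<in> partitions n \<and> scgraph_isomorphic n (induced G C) (standard_graph mu)"
    then have mu: "mu \<in> partitions n"
      "scgraph_isomorphic n (induced G {w. conn n v w}) (standard_graph mu)"
      unfolding v(2) by blast+
    have "boundary (row mu) = boundary (row lam)"
      using component_iso_shape[OF L v(1) mu] sh by (rule trans[OF sym])
    then show "mu = lam" by (rule partition_boundary_inject[OF mu(1) lam(1)])
  qed
qed

lemma sum_verts_components:
  fixes h :: "'v \<Rightarrow> 'b :: comm_monoid_add"
  shows "(\<Sum>v\<in>verts G. h v) = (\<Sum>C\<in>components G {2..<n}. \<Sum>v\<in>C. h v)"
proof -
  have fin: "finite (verts G)" using axioms(1) by (simp add: signed_colored_graph_def)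
  have sub: "C \<subseteq> verts G" if "C \<in> components G {2..<n}" for C
    using that conn_verts unfolding components_conn by blast
  have un: "\<Union> (components G {2..<n}) = verts G"
    using sub conn_refl unfolding components_conn by blast
  have "(\<Sum>v\<in>\<Union> (components G {2..<n}). h v) = (\<Sum>C\<in>components G {2..<n}. \<Sum>v\<in>C. h v)"
  proof (subst sum.Union_disjoint)
    show "\<forall>C\<in>components G {2..<n}. finite C" using sub fin finite_subset by blast
    show "\<forall>C\<in>components G {2..<n}. \<forall>D\<in>components G {2..<n}. C \<noteq> D \<longrightarrow> C \<inter> D = {}"
    proof (intro ballI impI, rule ccontr)
      fix C D assume CD: "C \<in> components G {2..<n}" "D \<in> components G {2..<n}" "C \<noteq> D" "C \<inter> D \<noteq> {}"
      then obtain u v w where "C = {x. conn n v x}" "D = {x. conn n w x}" "conn n v u" "conn n w u"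
        unfolding components_conn by blast
      then show False using conn_class_eq[of v u] conn_class_eq[of w u] CD(3) by simp
    qed
  qed simp
  then show ?thesis by (simp add: un)
qed

lemma sum_component_Qsym:
  assumes C: "C \<in> components_of_shape n G lam" and lam: "lam \<in> partitions n"
    and \<alpha>: "\<forall>v\<in>C. \<forall>w\<in>C. \<alpha> v = \<alpha> w"
  shows "(\<Sum>v\<in>C. qpow (\<alpha> v) * Qsym n (sig G v) m) = qpow (the_elem (\<alpha> ` C)) * schur lam m"
proof -
  obtain f where "scgraph_iso n (induced G C) (standard_graph lam) f"
    using C by (auto simp: components_of_shape_def scgraph_isomorphic_def)
  then have f: "bij_betw f C (SYT lam)" "\<And>v. v \<in> C \<Longrightarrow> tableau_sig lam (f v) = sig G v"
    by (simp_all add: scgraph_iso_def induced_def standard_graph_def)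
  have "\<alpha> v = the_elem (\<alpha> ` C)" if v: "v \<in> C" for v
  proof -
    have "\<alpha> ` C = {\<alpha> v}" using \<alpha> v by blast
    then show ?thesis by simp
  qed
  then have "(\<Sum>v\<in>C. qpow (\<alpha> v) * Qsym n (sig G v) m) =
      (\<Sum>v\<in>C. qpow (the_elem (\<alpha> ` C)) * Qsym n (tableau_sig lam (f v)) m)"
    using f(2) by (intro sum.cong) simp_all
  also have "\<dots> = qpow (the_elem (\<alpha> ` C)) * (\<Sum>v\<in>C. Qsym n (tableau_sig lam (f v)) m)"
    by (simp add: sum_distrib_left)
  also have "(\<Sum>v\<in>C. Qsym n (tableau_sig lam (f v)) m) = (\<Sum>T\<in>SYT lam. Qsym n (tableau_sig lam T) m)"
    by (rule sum.reindex_bij_betw[OF f(1)])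
  finally show ?thesis by (simp only: schur_eq_sum_Qsym[OF lam])
qed

lemma gen_fun_schur_expansion:
  assumes \<alpha>: "\<forall>C\<in>components G {2..<n}. \<forall>v\<in>C. \<forall>w\<in>C. \<alpha> v = \<alpha> w"
  shows "gen_fun n G \<alpha> m =
    (\<Sum>lam\<in>partitions n. \<Sum>C\<in>components_of_shape n G lam. qpow (the_elem (\<alpha> ` C)) * schur lam m)"
proof -
  let ?K = "components G {2..<n}"
  let ?h = "\<lambda>C. \<Sum>v\<in>C. qpow (\<alpha> v) * Qsym n (sig G v) m"
  define P where "P C lam \<longleftrightarrow> lam \<in> partitions n \<and> scgraph_isomorphic n (induced G C) (standard_graph lam)"
    for C lam
  define part where "part C = (THE lam. P C lam)" for C
  have ex1: "\<exists>!lam. P C lam" if "C \<in> ?K" for C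
    using component_unique_shape[OF that] by (simp add: P_def)
  have part: "P C (part C)" if "C \<in> ?K" for C
    unfolding part_def by (rule theI'[OF ex1[OF that]])
  have shape: "{C \<in> ?K. part C = lam} = components_of_shape n G lam" if "lam \<in> partitions n" for lam
  proof (intro set_eqI iffI)
    fix C assume "C \<in> {C \<in> ?K. part C = lam}"
    then show "C \<in> components_of_shape n G lam" using part by (auto simp: P_def components_of_shape_def)
  next
    fix C assume C: "C \<in> components_of_shape n G lam"
    then have K: "C \<in> ?K" and "P C lam" using that by (auto simp: P_def components_of_shape_def)
    then have "part C = lam" using ex1[OF K] part[OF K] by blast
    then show "C \<in> {C \<in> ?K. part C = lam}" using K by simp
  qed
  have fin: "finite ?K"
    using axioms(1) by (simp add: components_conn signed_colored_graph_def)
  have "gen_fun n G \<alpha> m = sum ?h ?K" unfolding gen_fun_def by (rule sum_verts_components)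
  also have "\<dots> = (\<Sum>lam\<in>partitions n. sum ?h {C \<in> ?K. part C = lam})"
    by (rule sum.group[symmetric, OF fin finite_partitions]) (use part in \<open>auto simp: P_def\<close>)
  also have "\<dots> = (\<Sum>lam\<in>partitions n. \<Sum>C\<in>components_of_shape n G lam. qpow (the_elem (\<alpha> ` C)) * schur lam m)"
  proof (rule sum.cong[OF refl])
    fix lam assume lam: "lam \<in> partitions n"
    show "sum ?h {C \<in> ?K. part C = lam} =
        (\<Sum>C\<in>components_of_shape n G lam. qpow (the_elem (\<alpha> ` C)) * schur lam m)"
      unfolding shape[OF lam]
    proof (rule sum.cong[OF refl])
      fix C assume C: "C \<in> components_of_shape n G lam"
      then have "C \<in> ?K" by (simp add: components_of_shape_def)
      then have "\<forall>v\<in>C. \<forall>w\<in>C. \<alpha> v = \<alpha> w" using \<alpha> by blast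
      then show "?h C = qpow (the_elem (\<alpha> ` C)) * schur lam m" by (rule sum_component_Qsym[OF C lam])
    qed
  qed
  finally show ?thesis .
qed

end

lemma Qsym_nonzero_size: "Qsym n s m \<noteq> 0 \<Longrightarrow> size m = n"
proof (rule ccontr)
  assume "size m \<noteq> n"
  then have "{xs. length xs = n \<and> sorted xs \<and>
      (\<forall>j. 1 \<le> j \<and> j < n \<and> xs ! (j - 1) = xs ! j \<longrightarrow> s j = 1) \<and> mset xs = m} = {}" by auto
  then have "Qsym n s m = (0 :: 'a)" by (simp only: Qsym_def card.empty of_nat_0)
  moreover assume "Qsym n s m \<noteq> (0 :: 'a)"
  ultimately show False by simp
qed

theorem corollary3p10:
  fixes n :: nat and G :: "'v scgraph" and \<alpha> :: "'v \<Rightarrow> int"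
  assumes "dual_equivalence_graph n n G"
    and "\<forall>C\<in>components G {2..<n}. \<forall>v\<in>C. \<forall>w\<in>C. \<alpha> v = \<alpha> w"
  shows "gen_fun n G \<alpha> =
           (\<lambda>m. \<Sum>lam\<in>partitions n. \<Sum>C\<in>components_of_shape n G lam.
                  qpow (the_elem (\<alpha> ` C)) * schur lam m) \<and>
         symmetric_function (gen_fun n G \<alpha>) \<and>
         schur_positive (gen_fun n G \<alpha>)"
proof -
  interpret deg G n by unfold_locales (rule assms(1))
  have expansion: "gen_fun n G \<alpha> =
      (\<lambda>m. \<Sum>lam\<in>partitions n. \<Sum>C\<in>components_of_shape n G lam. qpow (the_elem (\<alpha> ` C)) * schur lam m)"
    using gen_fun_schur_expansion[OF assms(2)] by blast
  have "symmetric_function (gen_fun n G \<alpha>)" unfolding symmetric_function_def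
  \<comment> \<open>\<open>n\<close> bounds the degree because each summand is homogeneous of degree
    \<open>n\<close>.\<close>
  proof (intro conjI exI[of _ n] allI impI)
    fix m assume "gen_fun n G \<alpha> m \<noteq> 0"
    then obtain v where "qpow (\<alpha> v) * Qsym n (sig G v) m \<noteq> 0"
      unfolding gen_fun_def by (meson sum.neutral)
    then have "Qsym n (sig G v) m \<noteq> (0 :: laurent)" by auto
    then show "size m \<le> n" using Qsym_nonzero_size by force
  next
    fix p :: "nat \<Rightarrow> nat" and m assume "bij p"
    then have "schur lam (image_mset p m) = (schur lam m :: laurent)" if "lam \<in> partitions n" for lam
      by (rule schur_symmetric[OF that bij_is_inj])
    then show "gen_fun n G \<alpha> (image_mset p m) = gen_fun n G \<alpha> m" unfolding expansion by simp
  qed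
  moreover have "schur_positive (gen_fun n G \<alpha>)" unfolding schur_positive_def
  proof (intro exI conjI ballI allI)
    let ?c = "\<lambda>lam. \<Sum>C\<in>components_of_shape n G lam. qpow (the_elem (\<alpha> ` C))"
    show "finite (partitions n)" by (rule finite_partitions)
    show "partitions n \<subseteq> (\<Union>n. partitions n)" by blast
    show "0 \<le> Poly_Mapping.lookup (?c lam) k" for lam k
      by (auto simp: lookup_sum qpow_def lookup_single when_def intro!: sum_nonneg)
    show "gen_fun n G \<alpha> = (\<lambda>m. \<Sum>lam\<in>partitions n. ?c lam * schur lam m)"
      unfolding expansion by (simp add: sum_distrib_right)
  qed
  ultimately show ?thesis using expansion by blast
qed

end
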